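(* Let $\Phi,\lambda,f,\mathcal D,F,\Phi^{(1)},\Phi^{(2)}$ be as in the context, and let $Z,\tilde Z$ be independent with density $f$. For Borel $A\subset\mathbb{R}^2$ let $M^{(i)}(A)=\mathbb E\big[\sum_{a\in\Phi^{(i)}}\mathbf 1_{\{\hat a\in A\}}\big]$, $i=1,2$, and let $\mathcal S(A)$ be the Lebesgue measure of $A$. Define $$P_{\mathcal D}(\lambda,f)=2\pi\lambda\int_0^\infty\mathbb E\Big[e^{-\lambda F(s,Z,\tilde Z)}\mathbf 1_{\{(Z,\tilde Z)\in\mathcal D\}}\Big]s\,ds.$$ Then $P_{\mathcal D}(\lambda,f)\in[0,1]$ and for every Borel $A\subset\mathbb{R}^2$, $$M^{(2)}(A)=P_{\mathcal D}(\lambda,f)\,\lambda\,\mathcal S(A),\qquad M^{(1)}(A)=\big(1-P_{\mathcal D}(\lambda,f)\big)\lambda\,\mathcal S(A).$$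
   Context: $\mathbb{H}^3=\{(x,y,z):z>0\}$; for $a=(x,y,z)$, $\hat a=(x,y)$. $d_{\mathbb{H}^3}(a,b)=\operatorname{acosh}\big(\frac{|\hat a-\hat b|^2}{2z\tilde z}+\frac12(\frac{z}{\tilde z}+\frac{\tilde z}{z})\big)$ for marks $z,\tilde z$. $\Phi$ is a Poisson point process on $\mathbb{R}^2\times(0,\infty)$ with intensity $\lambda\,dx\,dy\,f(z)dz$, $\lambda>0$, $f$ a probability density on $(0,\infty)$. $\mathcal D\subset(0,\infty)^2$ is Borel and symmetric. $a\xrightarrow{\phi}b$: $b$ is the unique minimizer of $d_{\mathbb{H}^3}(a,\cdot)$ on $\phi\setminus\{a\}$. $a\overset{\phi,\mathcal D}{\leftrightarrow}b$: $a\xrightarrow{\phi}b$, $b\xrightarrow{\phi}a$, and marks $(z,\tilde z)\in\mathcal D$. $\Phi^{(2)}=\{a\in\Phi:\exists b\in\Phi\setminus\{a\},a\overset{\Phi,\mathcal D}{\leftrightarrow}b\}$, $\Phi^{(1)}=\Phi\setminus\Phi^{(2)}$. $F(s,z,\tilde z)$: with $R=\operatorname{acosh}\big(\frac{s^2}{2z\tilde z}+\frac12(\frac{z}{\tilde z}+\frac{\tilde z}{z})\big)$, $d=\sqrt{s^2+(z-\tilde z)^2\cosh^2R}$, $r=z\sinh R$, $\tilde r=\tilde z\sinh R$, $c=z\cosh R$, $\tilde c=\tilde z\cosh R$, $h=\frac{(\tilde r-r+d)(r+\tilde r-d)}{2d}$, $\tilde h=\frac{(r-\tilde r+d)(r+\tilde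 r-d)}{2d}$, $\delta=\frac\pi2-\arcsin\frac{\tilde c-c}{d}$, $\tilde\delta=\frac\pi2-\arcsin\frac{c-\tilde c}{d}$, $F(s,z,\tilde z)=\pi\int_{-r}^{r}f(w+c)(r^2-w^2)dw+\pi\int_{-\tilde r}^{\tilde r}f(w+\tilde c)(\tilde r^2-w^2)dw-\int_{r-h}^{r}\int_0^{2\pi}\int_0^{\sqrt{r^2-w^2}}f(c+w\cos\delta-\rho\cos\theta\sin\delta)\rho\,d\rho\,d\theta\,dw-\int_{\tilde r-\tilde h}^{\tilde r}\int_0^{2\pi}\int_0^{\sqrt{\tilde r^2-w^2}}f(\tilde c+w\cos\tilde\delta-\rho\cos\theta\sin\tilde\delta)\rho\,d\rho\,d\theta\,dw$. *)

theory Defs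
  imports "HOL-Probability.Probability"
begin

text \<open>Points of the upper half space H^3 are represented as ((x,y),z); the
  horizontal projection is fst, the mark (height) is snd.\<close>

type_synonym pt = "(real \<times> real) \<times> real"

definition dH :: "pt \<Rightarrow> pt \<Rightarrow> real" where
  "dH a b = arcosh ((dist (fst a) (fst b))\<^sup>2 / (2 * snd a * snd b)
                    + (snd a / snd b + snd b / snd a) / 2)"

definition nn_to :: "pt set \<Rightarrow> pt \<Rightarrow> pt \<Rightarrow> bool" where
  "nn_to \<phi> a b \<longleftrightarrow> b \<in> \<phi> \<and> b \<noteq> a \<and> (\<forall>c\<in>\<phi> - {a, b}. dH a b < dH a c)"

definition mutual_nn :: "pt set \<Rightarrow> (real \<times> real) set \<Rightarrow> pt \<Rightarrow> pt \<Rightarrow> bool" where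
  "mutual_nn \<phi> D a b \<longleftrightarrow> nn_to \<phi> a b \<and> nn_to \<phi> b a \<and> (snd a, snd b) \<in> D"

definition Phi2 :: "pt set \<Rightarrow> (real \<times> real) set \<Rightarrow> pt set" where
  "Phi2 \<phi> D = {a \<in> \<phi>. \<exists>b \<in> \<phi> - {a}. mutual_nn \<phi> D a b}"

definition Phi1 :: "pt set \<Rightarrow> (real \<times> real) set \<Rightarrow> pt set" where
  "Phi1 \<phi> D = \<phi> - Phi2 \<phi> D"

definition poisson_pp :: "'w measure \<Rightarrow> ('w \<Rightarrow> 'p set) \<Rightarrow> 'p measure \<Rightarrow> bool" where
  "poisson_pp M \<Phi> \<mu> \<longleftrightarrow> prob_space M \<and>
     (\<forall>\<omega>\<in>space M. \<Phi> \<omega> \<subseteq> space \<mu>) \<and>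
     (\<forall>B\<in>sets \<mu>. emeasure \<mu> B < \<infinity> \<longrightarrow>
        (AE \<omega> in M. finite (\<Phi> \<omega> \<inter> B)) \<and>
        (\<lambda>\<omega>. card (\<Phi> \<omega> \<inter> B)) \<in> measurable M (count_space UNIV) \<and>
        (\<forall>k::nat. measure M {\<omega>\<in>space M. card (\<Phi> \<omega> \<inter> B) = k}
              = (measure \<mu> B) ^ k / fact k * exp (- measure \<mu> B))) \<and>
     (\<forall>(I::nat set) B. finite I \<longrightarrow> (\<forall>i\<in>I. B i \<in> sets \<mu> \<and> emeasure \<mu> (B i) < \<infinity>) \<longrightarrow>
        disjoint_family_on B I \<longrightarrow>
        prob_space.indep_vars M (\<lambda>_. count_space UNIV) (\<lambda>i \<omega>. card (\<Phi> \<omega> \<inter> B i)) I)"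

definition mark_measure :: "(real \<Rightarrow> real) \<Rightarrow> real measure" where
  "mark_measure f = density lborel (\<lambda>z. ennreal (f z * indicator {0<..} z))"

definition intensity :: "real \<Rightarrow> (real \<Rightarrow> real) \<Rightarrow> pt measure" where
  "intensity lam f = scale_measure (ennreal lam) ((lborel \<Otimes>\<^sub>M lborel) \<Otimes>\<^sub>M mark_measure f)"

definition Fun_F :: "(real \<Rightarrow> real) \<Rightarrow> real \<Rightarrow> real \<Rightarrow> real \<Rightarrow> real" where
  "Fun_F f s z z' =
    (let R = arcosh (s\<^sup>2 / (2 * z * z') + (z / z' + z' / z) / 2);
         d = sqrt (s\<^sup>2 + (z - z')\<^sup>2 * (cosh R)\<^sup>2);
         r = z * sinh R; r' = z' * sinh R;
         c = z * cosh R; c' = z' * cosh R;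
         h = (r' - r + d) * (r + r' - d) / (2 * d);
         h' = (r - r' + d) * (r + r' - d) / (2 * d);
         \<delta> = pi / 2 - arcsin ((c' - c) / d);
         \<delta>' = pi / 2 - arcsin ((c - c') / d)
     in pi * (LBINT w=-r..r. f (w + c) * (r\<^sup>2 - w\<^sup>2))
      + pi * (LBINT w=-r'..r'. f (w + c') * (r'\<^sup>2 - w\<^sup>2))
      - (LBINT w=r-h..r. (LBINT \<theta>=0..2*pi. (LBINT \<rho>=0..sqrt (r\<^sup>2 - w\<^sup>2).
            f (c + w * cos \<delta> - \<rho> * cos \<theta> * sin \<delta>) * \<rho>)))
      - (LBINT w=r'-h'..r'. (LBINT \<theta>=0..2*pi. (LBINT \<rho>=0..sqrt (r'\<^sup>2 - w\<^sup>2).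
            f (c' + w * cos \<delta>' - \<rho> * cos \<theta> * sin \<delta>') * \<rho>))))"

text \<open>P_D(lambda,f) = 2 pi lambda int_0^oo E[exp(-lambda F(s,Z,Z')) 1_D(Z,Z')] s ds,
  with Z, Z' independent with density f, so the expectation is the integral
  against the product of the mark distributions.\<close>
definition P_D :: "(real \<times> real) set \<Rightarrow> real \<Rightarrow> (real \<Rightarrow> real) \<Rightarrow> ennreal" where
  "P_D D lam f = ennreal (2 * pi * lam) *
     (\<integral>\<^sup>+ s. (\<integral>\<^sup>+ zz. ennreal (exp (- lam * Fun_F f s (fst zz) (snd zz)) * indicator D zz)
                \<partial>(mark_measure f \<Otimes>\<^sub>M mark_measure f)) * ennreal s \<partial>(restrict_space lborel {0<..}))"

definition mean_meas :: "'w measure \<Rightarrow> ('w \<Rightarrow> pt set) \<Rightarrow> (real \<times> real) set \<Rightarrow> ennreal" where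
  "mean_meas M \<Psi> A = (\<integral>\<^sup>+ \<omega>. emeasure (count_space UNIV) {a \<in> \<Psi> \<omega>. fst a \<in> A} \<partial>M)"

end

theory Submission
  imports Defs
begin

text \<open>
  For \<open>a, b\<close> in the half space let \<open>K a b\<close> be the union of the closed hyperbolic balls of radius
  \<open>d(a,b)\<close> around \<open>a\<close> and \<open>b\<close>. Two points \<open>a \<noteq> b\<close> of \<open>\<phi>\<close> are mutual nearest neighbours iff
  \<open>\<phi> \<inter> K a b \<subseteq> {a, b}\<close>, and then \<open>b\<close> is determined by \<open>a\<close>. Hence the first moment measure of \<open>\<Phi>\<^sup>(\<^sup>2\<^sup>)\<close> is
  the expected number of such pairs, which for a Poisson process with intensity measure \<open>\<mu>\<close> is
  \<open>\<integral>\<integral> exp (- \<mu> (K a b)) \<mu>(da) \<mu>(db)\<close> (a two-point Mecke formula). For pairs in a product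
  \<open>U \<times> V\<close> of disjoint sets, cut \<open>U\<close> and \<open>V\<close> into small cells and count the pairs of cells \<open>(S, T)\<close> that contain exactly one point each while the rest of the closure of
  \<open>\<Union>{K a b | a \<in> S, b \<in> T}\<close> is empty. This count increases to the number of isolated pairs since the
  graph of \<open>K\<close> is closed, and its expectation is explicit by independence.

  In the Euclidean metric the two hyperbolic balls are balls, whose intersection is cut by the radical
  plane into two spherical caps. Fubini, a rotation and polar coordinates identify
  \<open>\<mu> (K a b)\<close> with \<open>\<lambda> F(s, z, z')\<close>, where \<open>s\<close> is the horizontal distance, and translation invariance
  together with polar coordinates in the plane turn the double integral into \<open>P\<^sub>D \<lambda> S(A)\<close>.
\<close>

section \<open>Rotations and polar coordinates in the plane\<close>

text \<open>\<open>poisson_pp\<close> speaks only of the numbers of points in fixed sets of finite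
  measure: their laws, and their independence for disjoint sets. It says nothing directly about a
  set such as \<open>K a b\<close> that depends on points of the process, nor about the
  measurability of \<open>Phi2\<close>. Fixed cells answer both: on each level the count is a finite
  sum of measurable indicators with explicit expectations, and its limit inherits measurability.
  Independence needs disjoint cells, hence the products \<open>U \<times> V\<close> of disjoint
  sets; the part of \<open>H \<times> H\<close> off the diagonal is covered by countably many of
  them. \<open>nn_integral\<close> is additive only for measurable functions. The count for
  \<open>Phi1\<close> is therefore replaced, almost everywhere, by a difference of measurable counts
  on sets of finite area. The bound on \<open>P_D\<close> is not read off from its integral: it
  expresses that a subset of the process has at most the mean number of points of the whole process
  in a unit square.\<close>

lemma nn_integral_lborel_shear_fst:
  fixes h :: "real \<times> real \<Rightarrow> ennreal"
  assumes [measurable]: "h \<in> borel_measurable (borel \<Otimes>\<^sub>M borel)"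
  shows "(\<integral>\<^sup>+p. h (fst p + c * snd p, snd p) \<partial>(lborel \<Otimes>\<^sub>M lborel)) = (\<integral>\<^sup>+p. h p \<partial>(lborel \<Otimes>\<^sub>M lborel))"
proof -
  have "(\<integral>\<^sup>+p. h (fst p + c * snd p, snd p) \<partial>(lborel \<Otimes>\<^sub>M lborel)) = (\<integral>\<^sup>+y. \<integral>\<^sup>+x. h (x + c * y, y) \<partial>lborel \<partial>lborel)"
    by (subst lborel_pair.nn_integral_snd[symmetric]) auto
  also have "\<dots> = (\<integral>\<^sup>+y. \<integral>\<^sup>+x. h (x, y) \<partial>lborel \<partial>lborel)"
  proof (rule nn_integral_cong)
    fix y :: real
    show "(\<integral>\<^sup>+x. h (x + c * y, y) \<partial>lborel) = (\<integral>\<^sup>+x. h (x, y) \<partial>lborel)"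
      using nn_integral_real_affine[of "\<lambda>x. h (x, y)" 1 "c * y"] by (simp add: add.commute)
  qed
  also have "\<dots> = (\<integral>\<^sup>+p. h p \<partial>(lborel \<Otimes>\<^sub>M lborel))"
    by (subst lborel_pair.nn_integral_snd[symmetric]) auto
  finally show ?thesis .
qed

lemma nn_integral_lborel_swap:
  fixes h :: "real \<times> real \<Rightarrow> ennreal"
  assumes [measurable]: "h \<in> borel_measurable (borel \<Otimes>\<^sub>M borel)"
  shows "(\<integral>\<^sup>+p. h (snd p, fst p) \<partial>(lborel \<Otimes>\<^sub>M lborel)) = (\<integral>\<^sup>+p. h p \<partial>(lborel \<Otimes>\<^sub>M lborel))"
proof -
  have "(\<integral>\<^sup>+p. h (snd p, fst p) \<partial>(lborel \<Otimes>\<^sub>M lborel)) = (\<integral>\<^sup>+y. \<integral>\<^sup>+x. h (y, x) \<partial>lborel \<partial>lborel)"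
    by (subst lborel_pair.nn_integral_snd[symmetric]) auto
  also have "\<dots> = (\<integral>\<^sup>+p. h p \<partial>(lborel \<Otimes>\<^sub>M lborel))"
    by (subst lborel.nn_integral_fst[symmetric]) auto
  finally show ?thesis .
qed

lemma nn_integral_lborel_shear_snd:
  fixes h :: "real \<times> real \<Rightarrow> ennreal"
  assumes [measurable]: "h \<in> borel_measurable (borel \<Otimes>\<^sub>M borel)"
  shows "(\<integral>\<^sup>+p. h (fst p, snd p + c * fst p) \<partial>(lborel \<Otimes>\<^sub>M lborel)) = (\<integral>\<^sup>+p. h p \<partial>(lborel \<Otimes>\<^sub>M lborel))"
proof -
  have "(\<integral>\<^sup>+p. h (fst p, snd p + c * fst p) \<partial>(lborel \<Otimes>\<^sub>M lborel)) = (\<integral>\<^sup>+p. h (snd p, fst p + c * snd p) \<partial>(lborel \<Otimes>\<^sub>M lborel))"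
    using nn_integral_lborel_swap[of "\<lambda>p. h (fst p, snd p + c * fst p)"] by simp
  also have "\<dots> = (\<integral>\<^sup>+p. h (snd p, fst p) \<partial>(lborel \<Otimes>\<^sub>M lborel))"
    using nn_integral_lborel_shear_fst[of "\<lambda>p. h (snd p, fst p)" c] by simp
  finally show ?thesis by (simp add: nn_integral_lborel_swap)
qed

lemma nn_integral_lborel_reflect_snd:
  fixes h :: "real \<times> real \<Rightarrow> ennreal"
  assumes [measurable]: "h \<in> borel_measurable (borel \<Otimes>\<^sub>M borel)"
  shows "(\<integral>\<^sup>+p. h (fst p, - snd p) \<partial>(lborel \<Otimes>\<^sub>M lborel)) = (\<integral>\<^sup>+p. h p \<partial>(lborel \<Otimes>\<^sub>M lborel))"
proof -
  have "(\<integral>\<^sup>+p. h (fst p, - snd p) \<partial>(lborel \<Otimes>\<^sub>M lborel)) = (\<integral>\<^sup>+x. \<integral>\<^sup>+y. h (x, - y) \<partial>lborel \<partial>lborel)"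
    by (subst lborel.nn_integral_fst[symmetric]) auto
  also have "\<dots> = (\<integral>\<^sup>+x. \<integral>\<^sup>+y. h (x, y) \<partial>lborel \<partial>lborel)"
  proof (rule nn_integral_cong)
    fix x :: real
    show "(\<integral>\<^sup>+y. h (x, - y) \<partial>lborel) = (\<integral>\<^sup>+y. h (x, y) \<partial>lborel)"
      using nn_integral_real_affine[of "\<lambda>y. h (x, y)" "-1" 0] by simp
  qed
  also have "\<dots> = (\<integral>\<^sup>+p. h p \<partial>(lborel \<Otimes>\<^sub>M lborel))"
    by (subst lborel.nn_integral_fst[symmetric]) auto
  finally show ?thesis .
qed

text \<open>A rotation is a product of three shears, unless it is \<open>\<plusminus>1\<close>.\<close>

lemma nn_integral_lborel_rotate:
  fixes h :: "real \<times> real \<Rightarrow> ennreal"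
  assumes [measurable]: "h \<in> borel_measurable (borel \<Otimes>\<^sub>M borel)" and ab: "a\<^sup>2 + b\<^sup>2 = 1"
  shows "(\<integral>\<^sup>+p. h (a * fst p - b * snd p, b * fst p + a * snd p) \<partial>(lborel \<Otimes>\<^sub>M lborel)) = (\<integral>\<^sup>+p. h p \<partial>(lborel \<Otimes>\<^sub>M lborel))"
proof (cases "b = 0")
  case True
  then have "a = 1 \<or> a = -1" using ab by (simp add: power2_eq_1_iff)
  then show ?thesis
  proof
    assume a: "a = -1"
    have "(\<integral>\<^sup>+p. h (- fst p, - snd p) \<partial>(lborel \<Otimes>\<^sub>M lborel)) = (\<integral>\<^sup>+p. h (- fst p, snd p) \<partial>(lborel \<Otimes>\<^sub>M lborel))"
      using nn_integral_lborel_reflect_snd[of "\<lambda>p. h (- fst p, snd p)"] by simp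
    also have "\<dots> = (\<integral>\<^sup>+p. h (- snd p, fst p) \<partial>(lborel \<Otimes>\<^sub>M lborel))"
      using nn_integral_lborel_swap[of "\<lambda>p. h (- fst p, snd p)"] by simp
    also have "\<dots> = (\<integral>\<^sup>+p. h (snd p, fst p) \<partial>(lborel \<Otimes>\<^sub>M lborel))"
      using nn_integral_lborel_reflect_snd[of "\<lambda>p. h (snd p, fst p)"] by simp
    finally show ?thesis using True a by (simp add: nn_integral_lborel_swap)
  qed (use True in simp)
next
  case False
  \<comment> \<open>For \<open>a = cos t\<close> and \<open>b = sin t\<close> this is
    \<open>- tan (t / 2)\<close>, the coefficient of the two outer shears; the middle one has
    coefficient \<open>b\<close>.\<close>
  define c where "c = (a - 1) / b"
  have c: "1 + c * b = a" using False by (simp add: c_def)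
  have c2: "c + c * a = - b"
  proof -
    have "b * (c + c * a) = (a - 1) * (1 + a)" using False by (simp add: c_def field_simps)
    also have "\<dots> = a\<^sup>2 - 1" by (simp add: power2_eq_square algebra_simps)
    also have "\<dots> = b * (- b)" using ab by (simp add: power2_eq_square)
    finally show ?thesis using False mult_left_cancel by blast
  qed
  have "(\<integral>\<^sup>+p. h p \<partial>(lborel \<Otimes>\<^sub>M lborel)) = (\<integral>\<^sup>+p. h (fst p + c * snd p, snd p) \<partial>(lborel \<Otimes>\<^sub>M lborel))"
    by (simp add: nn_integral_lborel_shear_fst)
  also have "\<dots> = (\<integral>\<^sup>+p. h (fst p + c * (snd p + b * fst p), snd p + b * fst p) \<partial>(lborel \<Otimes>\<^sub>M lborel))"
    using nn_integral_lborel_shear_snd[of "\<lambda>p. h (fst p + c * snd p, snd p)" b] by simp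
  also have "\<dots> = (\<integral>\<^sup>+p. h ((fst p + c * snd p) + c * (snd p + b * (fst p + c * snd p)), snd p + b * (fst p + c * snd p)) \<partial>(lborel \<Otimes>\<^sub>M lborel))"
    using nn_integral_lborel_shear_fst[of "\<lambda>p. h (fst p + c * (snd p + b * fst p), snd p + b * fst p)" c] by simp
  also have "\<dots> = (\<integral>\<^sup>+p. h (a * fst p - b * snd p, b * fst p + a * snd p) \<partial>(lborel \<Otimes>\<^sub>M lborel))"
  proof (intro nn_integral_cong arg_cong[where f=h])
    fix p :: "real \<times> real"
    have 1: "(fst p + c * snd p) + c * (snd p + b * (fst p + c * snd p))
      = (1 + c * b) * fst p + (c + c * (1 + c * b)) * snd p" by (simp add: algebra_simps)
    have 2: "snd p + b * (fst p + c * snd p) = b * fst p + (1 + c * b) * snd p" by (simp add: algebra_simps)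
    show "((fst p + c * snd p) + c * (snd p + b * (fst p + c * snd p)), snd p + b * (fst p + c * snd p))
      = (a * fst p - b * snd p, b * fst p + a * snd p)"
      using 1[unfolded c c2] 2[unfolded c] by simp
  qed
  finally show ?thesis by simp
qed

text \<open>The substitution rule is applied on the compact intervals from \<open>- n\<close> to
  \<open>n\<close>, where the derivative is continuous; monotone convergence removes the truncation
  on both sides.\<close>

lemma nn_integral_arctan_substitution:
  fixes f :: "real \<Rightarrow> real"
  assumes [measurable]: "f \<in> borel_measurable borel" and nonneg: "\<And>x. 0 \<le> f x"
  shows "(\<integral>\<^sup>+x. ennreal (f x * indicator {-(pi/2)<..<pi/2} x) \<partial>lborel)
    = (\<integral>\<^sup>+t. ennreal (f (arctan t) / (1 + t\<^sup>2)) \<partial>lborel)"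
proof -
  have eq: "(\<integral>\<^sup>+x. ennreal (f x * indicator {arctan (- real n)..arctan (real n)} x) \<partial>lborel)
    = (\<integral>\<^sup>+t. ennreal (f (arctan t) * inverse (1 + t\<^sup>2) * indicator {- real n..real n} t) \<partial>lborel)" for n
  proof (rule nn_integral_substitution)
    show "continuous_on {- real n..real n} (\<lambda>t. inverse (1 + t\<^sup>2))"
      by (intro continuous_intros) (metis add_pos_nonneg less_numeral_extra(3) zero_le_power2 zero_less_one)
  qed (auto intro!: derivative_eq_intros DERIV_arctan simp: set_borel_measurable_def)
  have "(\<lambda>n. \<integral>\<^sup>+x. ennreal (f x * indicator {arctan (- real n)..arctan (real n)} x) \<partial>lborel)
    \<longlonglongrightarrow> (\<integral>\<^sup>+x. ennreal (f x * indicator {-(pi/2)<..<pi/2} x) \<partial>lborel)"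
  proof (rule nn_integral_LIMSEQ)
    have "{arctan (- real n)..arctan (real n)} \<subseteq> {arctan (- real (Suc n))..arctan (real (Suc n))}" for n
      by (auto intro!: arctan_monotone')
    then show "incseq (\<lambda>n x. ennreal (f x * indicator {arctan (- real n)..arctan (real n)} x))"
      by (intro incseq_SucI le_funI ennreal_leI mult_left_mono nonneg indicator_leI) blast
    show "(\<lambda>n. ennreal (f x * indicator {arctan (- real n)..arctan (real n)} x))
        \<longlonglongrightarrow> ennreal (f x * indicator {-(pi/2)<..<pi/2} x)" for x
    proof (cases "x \<in> {-(pi/2)<..<pi/2}")
      case True
      obtain N where N: "\<bar>tan x\<bar> \<le> real N" using real_arch_simple by blast
      have "x \<in> {arctan (- real n)..arctan (real n)}" if "n \<ge> N" for n
      proof -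
        have "- real n \<le> tan x" "tan x \<le> real n" using N that by linarith+
        then have "arctan (- real n) \<le> arctan (tan x)" "arctan (tan x) \<le> arctan (real n)"
          by (auto intro: arctan_monotone')
        then show ?thesis using True by (simp add: arctan_tan)
      qed
      then have "\<forall>\<^sub>F n in sequentially. ennreal (f x * indicator {arctan (- real n)..arctan (real n)} x)
        = ennreal (f x * indicator {-(pi/2)<..<pi/2} x)"
        using True unfolding eventually_sequentially by (intro exI[of _ N]) auto
      then show ?thesis by (rule tendsto_eventually)
    next
      case False
      then have "x \<notin> {arctan (- real n)..arctan (real n)}" for n
        using arctan_lbound[of "- real n"] arctan_ubound[of "real n"] by auto
      with False show ?thesis by simp
    qed
  qed simp
  moreover have "(\<lambda>n. \<integral>\<^sup>+t. ennreal (f (arctan t) * inverse (1 + t\<^sup>2) * indicator {- real n..real n} t) \<partial>lborel)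
    \<longlonglongrightarrow> (\<integral>\<^sup>+t. ennreal (f (arctan t) / (1 + t\<^sup>2)) \<partial>lborel)"
  proof (rule nn_integral_LIMSEQ)
    show "incseq (\<lambda>n t. ennreal (f (arctan t) * inverse (1 + t\<^sup>2) * indicator {- real n..real n} t))"
      by (intro incseq_SucI le_funI ennreal_leI mult_left_mono mult_nonneg_nonneg nonneg)
         (auto simp: indicator_def)
    show "(\<lambda>n. ennreal (f (arctan t) * inverse (1 + t\<^sup>2) * indicator {- real n..real n} t))
      \<longlonglongrightarrow> ennreal (f (arctan t) / (1 + t\<^sup>2))" for t
    proof -
      obtain N where N: "\<bar>t\<bar> \<le> real N" using real_arch_simple by blast
      have "t \<in> {- real n..real n}" if "n \<ge> N" for n
        using N that by auto
      then have "\<forall>\<^sub>F n in sequentially. ennreal (f (arctan t) * inverse (1 + t\<^sup>2) * indicator {- real n..real n} t)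
        = ennreal (f (arctan t) / (1 + t\<^sup>2))"
        unfolding eventually_sequentially by (intro exI[of _ N]) (auto simp: divide_inverse)
      then show ?thesis by (rule tendsto_eventually)
    qed
  qed simp
  ultimately show ?thesis unfolding eq by (rule LIMSEQ_unique)
qed

text \<open>Three substitutions in one variable: the slope \<open>t = y / x\<close>, then
  \<open>x = cos (arctan t) * \<rho>\<close>, then \<open>t = tan \<phi>\<close>. The factor
  \<open>cos (arctan t)\<close> arises twice, as the Jacobian of the second and inside the factor
  \<open>x\<close> left by the first; its square \<open>1 / (1 + t^2)\<close> is the derivative of
  \<open>arctan\<close>, as the third requires.\<close>

lemma nn_integral_polar_right_half:
  fixes g :: "real \<times> real \<Rightarrow> real"
  assumes [measurable]: "g \<in> borel_measurable (borel \<Otimes>\<^sub>M borel)" and nonneg: "\<And>p. 0 \<le> g p"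
  shows "(\<integral>\<^sup>+p. ennreal (g p * indicator {0<..} (fst p)) \<partial>(lborel \<Otimes>\<^sub>M lborel))
    = (\<integral>\<^sup>+\<phi>. \<integral>\<^sup>+\<rho>. ennreal (g (\<rho> * cos \<phi>, \<rho> * sin \<phi>) * \<rho> * indicator {0<..} \<rho> * indicator {-(pi/2)<..<pi/2} \<phi>) \<partial>lborel \<partial>lborel)"
proof -
  have "(\<integral>\<^sup>+p. ennreal (g p * indicator {0<..} (fst p)) \<partial>(lborel \<Otimes>\<^sub>M lborel))
    = (\<integral>\<^sup>+x. \<integral>\<^sup>+y. ennreal (g (x, y) * indicator {0<..} x) \<partial>lborel \<partial>lborel)"
    by (subst lborel.nn_integral_fst[symmetric]) auto
  also have "\<dots> = (\<integral>\<^sup>+x. \<integral>\<^sup>+t. ennreal (g (x, x * t) * x * indicator {0<..} x) \<partial>lborel \<partial>lborel)"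
  proof (rule nn_integral_cong)
    fix x :: real
    show "(\<integral>\<^sup>+y. ennreal (g (x, y) * indicator {0<..} x) \<partial>lborel) = (\<integral>\<^sup>+t. ennreal (g (x, x * t) * x * indicator {0<..} x) \<partial>lborel)"
    proof (cases "x > 0")
      case True
      have "(\<integral>\<^sup>+y. ennreal (g (x, y)) \<partial>lborel) = ennreal \<bar>x\<bar> * (\<integral>\<^sup>+t. ennreal (g (x, 0 + x * t)) \<partial>lborel)"
        by (rule nn_integral_real_affine) (use True in auto)
      also have "\<dots> = (\<integral>\<^sup>+t. ennreal (g (x, x * t) * x) \<partial>lborel)"
        using True nonneg by (subst nn_integral_cmult[symmetric]) (auto simp: ennreal_mult[symmetric] mult.commute)
      finally show ?thesis using True by simp
    qed simp
  qed
  also have "\<dots> = (\<integral>\<^sup>+t. \<integral>\<^sup>+x. ennreal (g (x, x * t) * x * indicator {0<..} x) \<partial>lborel \<partial>lborel)"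
    by (rule lborel_pair.Fubini') measurable
  also have "\<dots> = (\<integral>\<^sup>+t. \<integral>\<^sup>+\<rho>. ennreal (g (\<rho> * cos (arctan t), \<rho> * sin (arctan t)) * \<rho> * indicator {0<..} \<rho> / (1 + t\<^sup>2)) \<partial>lborel \<partial>lborel)"
  proof (rule nn_integral_cong)
    fix t :: real
    define k where "k = cos (arctan t)"
    have k: "k > 0" "k * t = sin (arctan t)" "k * k = 1 / (1 + t\<^sup>2)"
      unfolding k_def cos_arctan sin_arctan by (auto simp: add_pos_nonneg)
    have "(\<integral>\<^sup>+x. ennreal (g (x, x * t) * x * indicator {0<..} x) \<partial>lborel)
      = ennreal \<bar>k\<bar> * (\<integral>\<^sup>+\<rho>. ennreal (g (0 + k * \<rho>, (0 + k * \<rho>) * t) * (0 + k * \<rho>) * indicator {0<..} (0 + k * \<rho>)) \<partial>lborel)"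
      by (rule nn_integral_real_affine) (use k in auto)
    also have "\<dots> = (\<integral>\<^sup>+\<rho>. ennreal k * ennreal (g (k * \<rho>, k * \<rho> * t) * (k * \<rho>) * indicator {0<..} (k * \<rho>)) \<partial>lborel)"
      using k by (subst nn_integral_cmult[symmetric]) auto
    also have "\<dots> = (\<integral>\<^sup>+\<rho>. ennreal (g (\<rho> * cos (arctan t), \<rho> * sin (arctan t)) * \<rho> * indicator {0<..} \<rho> / (1 + t\<^sup>2)) \<partial>lborel)"
    proof (rule nn_integral_cong)
      fix \<rho> :: real
      have "indicator {0<..} (k * \<rho>) = (indicator {0<..} \<rho> :: real)"
        using k by (auto simp: indicator_def zero_less_mult_iff)
      moreover have "g (k * \<rho>, k * \<rho> * t) = g (\<rho> * cos (arctan t), \<rho> * sin (arctan t))"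
        unfolding k(2)[symmetric] k_def by (simp add: mult_ac)
      moreover have "k * (G * (k * \<rho>) * I) = G * \<rho> * I / (1 + t\<^sup>2)" for G I :: real
      proof -
        have "k * (G * (k * \<rho>) * I) = (k * k) * (G * \<rho> * I)" by simp
        then show ?thesis unfolding k(3) by simp
      qed
      ultimately show "ennreal k * ennreal (g (k * \<rho>, k * \<rho> * t) * (k * \<rho>) * indicator {0<..} (k * \<rho>))
        = ennreal (g (\<rho> * cos (arctan t), \<rho> * sin (arctan t)) * \<rho> * indicator {0<..} \<rho> / (1 + t\<^sup>2))"
        using k(1) by (simp add: ennreal_mult'[symmetric])
    qed
    finally show "(\<integral>\<^sup>+x. ennreal (g (x, x * t) * x * indicator {0<..} x) \<partial>lborel)
      = (\<integral>\<^sup>+\<rho>. ennreal (g (\<rho> * cos (arctan t), \<rho> * sin (arctan t)) * \<rho> * indicator {0<..} \<rho> / (1 + t\<^sup>2)) \<partial>lborel)" .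
  qed
  also have "\<dots> = (\<integral>\<^sup>+\<rho>. \<integral>\<^sup>+t. ennreal (g (\<rho> * cos (arctan t), \<rho> * sin (arctan t)) * \<rho> * indicator {0<..} \<rho> / (1 + t\<^sup>2)) \<partial>lborel \<partial>lborel)"
    by (rule lborel_pair.Fubini') measurable
  also have "\<dots> = (\<integral>\<^sup>+\<rho>. \<integral>\<^sup>+\<phi>. ennreal (g (\<rho> * cos \<phi>, \<rho> * sin \<phi>) * \<rho> * indicator {0<..} \<rho> * indicator {-(pi/2)<..<pi/2} \<phi>) \<partial>lborel \<partial>lborel)"
    by (intro nn_integral_cong nn_integral_arctan_substitution[symmetric]) (auto simp: indicator_def nonneg)
  also have "\<dots> = (\<integral>\<^sup>+\<phi>. \<integral>\<^sup>+\<rho>. ennreal (g (\<rho> * cos \<phi>, \<rho> * sin \<phi>) * \<rho> * indicator {0<..} \<rho> * indicator {-(pi/2)<..<pi/2} \<phi>) \<partial>lborel \<partial>lborel)"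
    by (rule lborel_pair.Fubini') measurable
  finally show ?thesis .
qed

text \<open>Splitting along the horizontal axis rather than the vertical one yields the angular
  range from \<open>0\<close> to \<open>2 * pi\<close> that \<open>Fun_F\<close> uses. The axis and
  the ray \<open>\<theta> = pi\<close> are null sets.\<close>

lemma nn_integral_polar:
  fixes g :: "real \<times> real \<Rightarrow> real"
  assumes [measurable]: "g \<in> borel_measurable (borel \<Otimes>\<^sub>M borel)" and nonneg: "\<And>p. 0 \<le> g p"
  shows "(\<integral>\<^sup>+p. ennreal (g p) \<partial>(lborel \<Otimes>\<^sub>M lborel))
    = (\<integral>\<^sup>+\<theta>. \<integral>\<^sup>+\<rho>. ennreal (g (\<rho> * cos \<theta>, \<rho> * sin \<theta>) * \<rho> * indicator {0<..} \<rho> * indicator {0<..<2 * pi} \<theta>) \<partial>lborel \<partial>lborel)"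
proof -
  have ae0: "AE p in lborel \<Otimes>\<^sub>M lborel. snd p \<noteq> (0::real)"
  proof -
    have "AE p in lborel \<Otimes>\<^sub>M lborel. snd p \<noteq> (0::real)"
      by (rule lborel_pair.AE_pair_measure) (measurable, auto intro: AE_lborel_singleton)
    then show ?thesis .
  qed
  let ?J = "\<lambda>\<theta>. \<integral>\<^sup>+\<rho>. ennreal (g (\<rho> * cos \<theta>, \<rho> * sin \<theta>) * \<rho> * indicator {0<..} \<rho>) \<partial>lborel"
  \<comment> \<open>\<open>\<alpha>\<close> will be \<open>pi / 2\<close> for the upper and
    \<open>3 / 2 * pi\<close> for the lower half-plane: a rotation by \<open>\<alpha>\<close>
    carries the right half-plane there and shifts all angles by \<open>\<alpha>\<close>.\<close>
  have half: "(\<integral>\<^sup>+p. ennreal (g (- b * snd p, b * fst p) * indicator {0<..} (fst p)) \<partial>(lborel \<Otimes>\<^sub>M lborel))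
    = (\<integral>\<^sup>+\<theta>. ?J \<theta> * indicator {\<alpha> - pi / 2<..<\<alpha> + pi / 2} \<theta> \<partial>lborel)"
    if b: "cos \<alpha> = 0" "sin \<alpha> = b" for b \<alpha>
  proof -
    have "(\<integral>\<^sup>+p. ennreal (g (- b * snd p, b * fst p) * indicator {0<..} (fst p)) \<partial>(lborel \<Otimes>\<^sub>M lborel))
      = (\<integral>\<^sup>+\<phi>. \<integral>\<^sup>+\<rho>. ennreal (g (- b * (\<rho> * sin \<phi>), b * (\<rho> * cos \<phi>)) * \<rho> * indicator {0<..} \<rho> * indicator {-(pi/2)<..<pi/2} \<phi>) \<partial>lborel \<partial>lborel)"
      using nn_integral_polar_right_half[of "\<lambda>p. g (- b * snd p, b * fst p)"] nonneg by simp
    also have "\<dots> = (\<integral>\<^sup>+\<phi>. ?J (\<alpha> + 1 * \<phi>) * indicator {\<alpha> - pi / 2<..<\<alpha> + pi / 2} (\<alpha> + 1 * \<phi>) \<partial>lborel)"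
      by (intro nn_integral_cong) (auto simp: cos_add sin_add b mult_ac indicator_def)
    also have "\<dots> = (\<integral>\<^sup>+\<theta>. ?J \<theta> * indicator {\<alpha> - pi / 2<..<\<alpha> + pi / 2} \<theta> \<partial>lborel)"
      by (subst nn_integral_real_affine[where c=1 and t=\<alpha>]) auto
    finally show ?thesis .
  qed
  have up: "(\<integral>\<^sup>+p. ennreal (g p * indicator {0<..} (snd p)) \<partial>(lborel \<Otimes>\<^sub>M lborel))
    = (\<integral>\<^sup>+p. ennreal (g (- 1 * snd p, 1 * fst p) * indicator {0<..} (fst p)) \<partial>(lborel \<Otimes>\<^sub>M lborel))"
    using nn_integral_lborel_rotate[of "\<lambda>p. ennreal (g p * indicator {0<..} (snd p))" 0 1] by simp
  have dn: "(\<integral>\<^sup>+p. ennreal (g p * indicator {..<0} (snd p)) \<partial>(lborel \<Otimes>\<^sub>M lborel))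
    = (\<integral>\<^sup>+p. ennreal (g (- (- 1) * snd p, - 1 * fst p) * indicator {0<..} (fst p)) \<partial>(lborel \<Otimes>\<^sub>M lborel))"
    using nn_integral_lborel_rotate[of "\<lambda>p. ennreal (g p * indicator {..<0} (snd p))" 0 "-1"]
    by (simp add: indicator_def)
  have "(\<integral>\<^sup>+p. ennreal (g p) \<partial>(lborel \<Otimes>\<^sub>M lborel)) = (\<integral>\<^sup>+p. ennreal (g p * indicator {0<..} (snd p)) + ennreal (g p * indicator {..<0} (snd p)) \<partial>(lborel \<Otimes>\<^sub>M lborel))"
    by (rule nn_integral_cong_AE) (use ae0 in eventually_elim, auto simp: indicator_def)
  also have "\<dots> = (\<integral>\<^sup>+p. ennreal (g p * indicator {0<..} (snd p)) \<partial>(lborel \<Otimes>\<^sub>M lborel)) + (\<integral>\<^sup>+p. ennreal (g p * indicator {..<0} (snd p)) \<partial>(lborel \<Otimes>\<^sub>M lborel))"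
    by (rule nn_integral_add) auto
  also have "\<dots> = (\<integral>\<^sup>+\<theta>. ?J \<theta> * indicator {pi/2 - pi / 2<..<pi/2 + pi / 2} \<theta> \<partial>lborel)
     + (\<integral>\<^sup>+\<theta>. ?J \<theta> * indicator {3/2*pi - pi / 2<..<3/2*pi + pi / 2} \<theta> \<partial>lborel)"
    unfolding up dn by (intro arg_cong2[where f="(+)"] half cos_3over2_pi sin_3over2_pi cos_pi_half sin_pi_half)
  also have "\<dots> = (\<integral>\<^sup>+\<theta>. ?J \<theta> * indicator {pi/2 - pi / 2<..<pi/2 + pi / 2} \<theta>
     + ?J \<theta> * indicator {3/2*pi - pi / 2<..<3/2*pi + pi / 2} \<theta> \<partial>lborel)"
    by (rule nn_integral_add[symmetric]) auto
  also have "\<dots> = (\<integral>\<^sup>+\<theta>. \<integral>\<^sup>+\<rho>. ennreal (g (\<rho> * cos \<theta>, \<rho> * sin \<theta>) * \<rho> * indicator {0<..} \<rho> * indicator {0<..<2 * pi} \<theta>) \<partial>lborel \<partial>lborel)"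
  proof (rule nn_integral_cong_AE)
    have "AE \<theta> in lborel. \<theta> \<noteq> pi" by (rule AE_lborel_singleton)
    then show "AE \<theta> in lborel. ?J \<theta> * indicator {pi/2 - pi / 2<..<pi/2 + pi / 2} \<theta>
     + ?J \<theta> * indicator {3/2*pi - pi / 2<..<3/2*pi + pi / 2} \<theta>
     = (\<integral>\<^sup>+\<rho>. ennreal (g (\<rho> * cos \<theta>, \<rho> * sin \<theta>) * \<rho> * indicator {0<..} \<rho> * indicator {0<..<2 * pi} \<theta>) \<partial>lborel)"
      by eventually_elim (auto simp: indicator_def)
  qed
  finally show ?thesis .
qed

lemma nn_integral_radial:
  fixes g :: "real \<Rightarrow> real"
  assumes [measurable]: "g \<in> borel_measurable borel" and nonneg: "\<And>s. 0 \<le> g s"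
  shows "(\<integral>\<^sup>+p. ennreal (g (norm p)) \<partial>(lborel :: (real \<times> real) measure))
    = ennreal (2 * pi) * (\<integral>\<^sup>+s. ennreal (g s * s * indicator {0<..} s) \<partial>lborel)"
proof -
  have [simp]: "norm (\<rho> * cos \<theta>, \<rho> * sin \<theta>) = \<bar>\<rho>\<bar>" for \<rho> \<theta> :: real
    by (simp add: norm_Pair power_mult_distrib flip: distrib_left)
  have "(\<integral>\<^sup>+p. ennreal (g (norm p)) \<partial>(lborel :: (real \<times> real) measure))
     = (\<integral>\<^sup>+\<theta>. \<integral>\<^sup>+\<rho>. ennreal (g \<bar>\<rho>\<bar> * \<rho> * indicator {0<..} \<rho> * indicator {0<..<2 * pi} \<theta>) \<partial>lborel \<partial>lborel)"
    using nn_integral_polar[of "\<lambda>p. g (norm p)"] nonneg by (simp add: borel_prod lborel_prod)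
  also have "\<dots> = (\<integral>\<^sup>+\<theta>. (\<integral>\<^sup>+s. ennreal (g s * s * indicator {0<..} s) \<partial>lborel) * indicator {0<..<2 * pi} \<theta> \<partial>lborel)"
    by (intro nn_integral_cong) (auto simp: indicator_def intro!: nn_integral_cong)
  also have "\<dots> = ennreal (2 * pi) * (\<integral>\<^sup>+s. ennreal (g s * s * indicator {0<..} s) \<partial>lborel)"
    by (subst nn_integral_cmult_indicator) (auto simp: mult.commute)
  finally show ?thesis .
qed

section \<open>Integrals over balls and spherical caps\<close>

text \<open>\<open>(\<sigma>, \<kappa>)\<close> is the axis of the cap in the plane of
  \<open>x\<close> and \<open>z\<close>. Once a rotation has made it the coordinate
  \<open>w\<close>, the half-space condition restricts \<open>w\<close> alone, and polar coordinates
  describe the plane orthogonal to the axis.\<close>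

lemma nn_integral_cap:
  fixes g :: "real \<Rightarrow> real"
  assumes [measurable]: "g \<in> borel_measurable borel" "T \<in> sets borel" and nonneg: "\<And>z. 0 \<le> g z"
    and unit: "\<sigma>\<^sup>2 + \<kappa>\<^sup>2 = 1"
  shows "(\<integral>\<^sup>+x. \<integral>\<^sup>+y. \<integral>\<^sup>+z. ennreal (g z * indicator {..r\<^sup>2} (x\<^sup>2 + y\<^sup>2 + (z - c)\<^sup>2) * indicator T (\<sigma> * x + \<kappa> * (z - c))) \<partial>lborel \<partial>lborel \<partial>lborel)
    = (\<integral>\<^sup>+w. \<integral>\<^sup>+\<theta>. \<integral>\<^sup>+\<rho>. ennreal (g (c + w * \<kappa> - \<rho> * cos \<theta> * \<sigma>) * indicator {..r\<^sup>2} (w\<^sup>2 + \<rho>\<^sup>2) * indicator T w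
         * \<rho> * indicator {0<..} \<rho> * indicator {0<..<2 * pi} \<theta>) \<partial>lborel \<partial>lborel \<partial>lborel)"
proof -
  let ?P = "\<lambda>w \<theta> \<rho>. g (c + w * \<kappa> - \<rho> * cos \<theta> * \<sigma>) * indicator {..r\<^sup>2} (w\<^sup>2 + \<rho>\<^sup>2) * indicator T w * \<rho> * indicator {0<..} \<rho> * indicator {0<..<2 * pi} \<theta>"
  have "(\<integral>\<^sup>+x. \<integral>\<^sup>+y. \<integral>\<^sup>+z. ennreal (g z * indicator {..r\<^sup>2} (x\<^sup>2 + y\<^sup>2 + (z - c)\<^sup>2) * indicator T (\<sigma> * x + \<kappa> * (z - c))) \<partial>lborel \<partial>lborel \<partial>lborel)
    = (\<integral>\<^sup>+y. \<integral>\<^sup>+x. \<integral>\<^sup>+z. ennreal (g z * indicator {..r\<^sup>2} (x\<^sup>2 + y\<^sup>2 + (z - c)\<^sup>2) * indicator T (\<sigma> * x + \<kappa> * (z - c))) \<partial>lborel \<partial>lborel \<partial>lborel)"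
    by (rule lborel_pair.Fubini') measurable
  also have "\<dots> = (\<integral>\<^sup>+y. \<integral>\<^sup>+w. \<integral>\<^sup>+u. ennreal (g (c + w * \<kappa> + u * \<sigma>) * indicator {..r\<^sup>2} (w\<^sup>2 + u\<^sup>2 + y\<^sup>2) * indicator T w) \<partial>lborel \<partial>lborel \<partial>lborel)"
  proof (rule nn_integral_cong)
    fix y :: real
    have "(\<integral>\<^sup>+x. \<integral>\<^sup>+z. ennreal (g z * indicator {..r\<^sup>2} (x\<^sup>2 + y\<^sup>2 + (z - c)\<^sup>2) * indicator T (\<sigma> * x + \<kappa> * (z - c))) \<partial>lborel \<partial>lborel)
      = (\<integral>\<^sup>+x. \<integral>\<^sup>+z. ennreal (g (c + z) * indicator {..r\<^sup>2} (x\<^sup>2 + y\<^sup>2 + z\<^sup>2) * indicator T (\<sigma> * x + \<kappa> * z)) \<partial>lborel \<partial>lborel)"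
      by (rule nn_integral_cong, subst nn_integral_real_affine[where c=1 and t=c]) auto
    also have "\<dots> = (\<integral>\<^sup>+p. ennreal (g (c + snd p) * indicator {..r\<^sup>2} ((fst p)\<^sup>2 + y\<^sup>2 + (snd p)\<^sup>2) * indicator T (\<sigma> * fst p + \<kappa> * snd p)) \<partial>(lborel \<Otimes>\<^sub>M lborel))"
      by (subst lborel.nn_integral_fst[symmetric]) auto
    also have "\<dots> = (\<integral>\<^sup>+p. ennreal (g (c + (\<kappa> * fst p + \<sigma> * snd p)) * indicator {..r\<^sup>2} ((\<sigma> * fst p - \<kappa> * snd p)\<^sup>2 + y\<^sup>2 + (\<kappa> * fst p + \<sigma> * snd p)\<^sup>2)
        * indicator T (\<sigma> * (\<sigma> * fst p - \<kappa> * snd p) + \<kappa> * (\<kappa> * fst p + \<sigma> * snd p))) \<partial>(lborel \<Otimes>\<^sub>M lborel))"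
      by (subst nn_integral_lborel_rotate[OF _ unit, symmetric]) simp_all
    also have "\<dots> = (\<integral>\<^sup>+p. ennreal (g (c + fst p * \<kappa> + snd p * \<sigma>) * indicator {..r\<^sup>2} ((fst p)\<^sup>2 + (snd p)\<^sup>2 + y\<^sup>2) * indicator T (fst p)) \<partial>(lborel \<Otimes>\<^sub>M lborel))"
    proof (rule nn_integral_cong)
      fix p :: "real \<times> real"
      have "(\<sigma> * fst p - \<kappa> * snd p)\<^sup>2 + y\<^sup>2 + (\<kappa> * fst p + \<sigma> * snd p)\<^sup>2 = (\<sigma>\<^sup>2 + \<kappa>\<^sup>2) * ((fst p)\<^sup>2 + (snd p)\<^sup>2) + y\<^sup>2"
        by (simp add: power2_eq_square algebra_simps)
      moreover have "\<sigma> * (\<sigma> * fst p - \<kappa> * snd p) + \<kappa> * (\<kappa> * fst p + \<sigma> * snd p) = (\<sigma>\<^sup>2 + \<kappa>\<^sup>2) * fst p"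
        by (simp add: power2_eq_square algebra_simps)
      ultimately show "ennreal (g (c + (\<kappa> * fst p + \<sigma> * snd p)) * indicator {..r\<^sup>2} ((\<sigma> * fst p - \<kappa> * snd p)\<^sup>2 + y\<^sup>2 + (\<kappa> * fst p + \<sigma> * snd p)\<^sup>2)
        * indicator T (\<sigma> * (\<sigma> * fst p - \<kappa> * snd p) + \<kappa> * (\<kappa> * fst p + \<sigma> * snd p)))
        = ennreal (g (c + fst p * \<kappa> + snd p * \<sigma>) * indicator {..r\<^sup>2} ((fst p)\<^sup>2 + (snd p)\<^sup>2 + y\<^sup>2) * indicator T (fst p))"
        unfolding unit by (simp add: mult_ac add_ac)
    qed
    also have "\<dots> = (\<integral>\<^sup>+w. \<integral>\<^sup>+u. ennreal (g (c + w * \<kappa> + u * \<sigma>) * indicator {..r\<^sup>2} (w\<^sup>2 + u\<^sup>2 + y\<^sup>2) * indicator T w) \<partial>lborel \<partial>lborel)"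
      by (subst lborel.nn_integral_fst[symmetric]) auto
    finally show "(\<integral>\<^sup>+x. \<integral>\<^sup>+z. ennreal (g z * indicator {..r\<^sup>2} (x\<^sup>2 + y\<^sup>2 + (z - c)\<^sup>2) * indicator T (\<sigma> * x + \<kappa> * (z - c))) \<partial>lborel \<partial>lborel)
      = (\<integral>\<^sup>+w. \<integral>\<^sup>+u. ennreal (g (c + w * \<kappa> + u * \<sigma>) * indicator {..r\<^sup>2} (w\<^sup>2 + u\<^sup>2 + y\<^sup>2) * indicator T w) \<partial>lborel \<partial>lborel)" .
  qed
  also have "\<dots> = (\<integral>\<^sup>+w. \<integral>\<^sup>+y. \<integral>\<^sup>+u. ennreal (g (c + w * \<kappa> + u * \<sigma>) * indicator {..r\<^sup>2} (w\<^sup>2 + u\<^sup>2 + y\<^sup>2) * indicator T w) \<partial>lborel \<partial>lborel \<partial>lborel)"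
    by (rule lborel_pair.Fubini') measurable
  also have "\<dots> = (\<integral>\<^sup>+w. \<integral>\<^sup>+\<theta>. \<integral>\<^sup>+\<rho>. ennreal (?P w \<theta> \<rho>) \<partial>lborel \<partial>lborel \<partial>lborel)"
  proof (rule nn_integral_cong)
    fix w :: real
    \<comment> \<open>Reflecting \<open>u\<close> produces the minus sign with which
      \<open>Fun_F\<close> writes the height.\<close>
    have "(\<integral>\<^sup>+y. \<integral>\<^sup>+u. ennreal (g (c + w * \<kappa> + u * \<sigma>) * indicator {..r\<^sup>2} (w\<^sup>2 + u\<^sup>2 + y\<^sup>2) * indicator T w) \<partial>lborel \<partial>lborel)
      = (\<integral>\<^sup>+y. \<integral>\<^sup>+u. ennreal (g (c + w * \<kappa> - u * \<sigma>) * indicator {..r\<^sup>2} (w\<^sup>2 + u\<^sup>2 + y\<^sup>2) * indicator T w) \<partial>lborel \<partial>lborel)"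
      by (rule nn_integral_cong, subst nn_integral_real_affine[where c="-1" and t=0]) auto
    also have "\<dots> = (\<integral>\<^sup>+p. ennreal (g (c + w * \<kappa> - fst p * \<sigma>) * indicator {..r\<^sup>2} (w\<^sup>2 + (fst p)\<^sup>2 + (snd p)\<^sup>2) * indicator T w) \<partial>(lborel \<Otimes>\<^sub>M lborel))"
      by (subst lborel_pair.nn_integral_snd[symmetric]) auto
    also have "\<dots> = (\<integral>\<^sup>+\<theta>. \<integral>\<^sup>+\<rho>. ennreal (g (c + w * \<kappa> - \<rho> * cos \<theta> * \<sigma>) * indicator {..r\<^sup>2} (w\<^sup>2 + (\<rho> * cos \<theta>)\<^sup>2 + (\<rho> * sin \<theta>)\<^sup>2) * indicator T w
         * \<rho> * indicator {0<..} \<rho> * indicator {0<..<2 * pi} \<theta>) \<partial>lborel \<partial>lborel)"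
      by (subst nn_integral_polar) (auto simp: nonneg)
    also have "\<dots> = (\<integral>\<^sup>+\<theta>. \<integral>\<^sup>+\<rho>. ennreal (?P w \<theta> \<rho>) \<partial>lborel \<partial>lborel)"
    proof -
      have "w\<^sup>2 + (\<rho> * cos \<theta>)\<^sup>2 + (\<rho> * sin \<theta>)\<^sup>2 = w\<^sup>2 + \<rho>\<^sup>2" for \<rho> \<theta> :: real
      proof -
        have "w\<^sup>2 + (\<rho> * cos \<theta>)\<^sup>2 + (\<rho> * sin \<theta>)\<^sup>2 = w\<^sup>2 + \<rho>\<^sup>2 * ((cos \<theta>)\<^sup>2 + (sin \<theta>)\<^sup>2)"
          by (simp only: power_mult_distrib distrib_left add.assoc)
        then show ?thesis by (simp only: sin_cos_squared_add2 mult_1_right)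
      qed
      then show ?thesis by (simp only:)
    qed
    finally show "(\<integral>\<^sup>+y. \<integral>\<^sup>+u. ennreal (g (c + w * \<kappa> + u * \<sigma>) * indicator {..r\<^sup>2} (w\<^sup>2 + u\<^sup>2 + y\<^sup>2) * indicator T w) \<partial>lborel \<partial>lborel)
     = (\<integral>\<^sup>+\<theta>. \<integral>\<^sup>+\<rho>. ennreal (?P w \<theta> \<rho>) \<partial>lborel \<partial>lborel)" .
  qed
  finally show ?thesis .
qed

text \<open>A Bochner integral of a non-integrable function is \<open>0\<close>, so nested ones
  could lose mass. The finiteness assumption confines this to a null set of
  \<open>x\<close>.\<close>

lemma lborel_integral_nested2:
  fixes G :: "real \<Rightarrow> real \<Rightarrow> real"
  assumes [measurable]: "(\<lambda>(x, y). G x y) \<in> borel_measurable (borel \<Otimes>\<^sub>M borel)"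
    and nonneg: "\<And>x y. 0 \<le> G x y"
    and fin: "(\<integral>\<^sup>+x. \<integral>\<^sup>+y. ennreal (G x y) \<partial>lborel \<partial>lborel) < \<infinity>"
  shows "ennreal (LINT x|lborel. LINT y|lborel. G x y) = (\<integral>\<^sup>+x. \<integral>\<^sup>+y. ennreal (G x y) \<partial>lborel \<partial>lborel)"
proof -
  have ae: "AE x in lborel. (\<integral>\<^sup>+y. ennreal (G x y) \<partial>lborel) \<noteq> \<infinity>"
    by (rule nn_integral_noteq_infinite) (use fin in auto)
  have "(\<integral>\<^sup>+x. ennreal (LINT y|lborel. G x y) \<partial>lborel) = (\<integral>\<^sup>+x. \<integral>\<^sup>+y. ennreal (G x y) \<partial>lborel \<partial>lborel)"
    by (rule nn_integral_cong_AE, use ae in eventually_elim)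
       (auto simp: integral_eq_nn_integral nonneg less_top)
  moreover have "(LINT x|lborel. LINT y|lborel. G x y) = enn2real (\<integral>\<^sup>+x. ennreal (LINT y|lborel. G x y) \<partial>lborel)"
    by (rule integral_eq_nn_integral) (auto simp: nonneg intro!: integral_nonneg)
  ultimately show ?thesis using fin by (simp add: less_top)
qed

lemma lborel_integral_nested3:
  fixes G :: "real \<Rightarrow> real \<Rightarrow> real \<Rightarrow> real"
  assumes [measurable]: "(\<lambda>(x, y, z). G x y z) \<in> borel_measurable (borel \<Otimes>\<^sub>M borel \<Otimes>\<^sub>M borel)"
    and nonneg: "\<And>x y z. 0 \<le> G x y z"
    and fin: "(\<integral>\<^sup>+x. \<integral>\<^sup>+y. \<integral>\<^sup>+z. ennreal (G x y z) \<partial>lborel \<partial>lborel \<partial>lborel) < \<infinity>"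
  shows "ennreal (LINT x|lborel. LINT y|lborel. LINT z|lborel. G x y z)
    = (\<integral>\<^sup>+x. \<integral>\<^sup>+y. \<integral>\<^sup>+z. ennreal (G x y z) \<partial>lborel \<partial>lborel \<partial>lborel)"
proof -
  have [measurable (raw)]: "(\<lambda>\<omega>. G (a \<omega>) (b \<omega>) (c \<omega>)) \<in> borel_measurable N"
    if [measurable]: "a \<in> borel_measurable N" "b \<in> borel_measurable N" "c \<in> borel_measurable N"
    for a b c and N :: "'a measure"
  proof -
    have "(\<lambda>\<omega>. (a \<omega>, b \<omega>, c \<omega>)) \<in> N \<rightarrow>\<^sub>M borel \<Otimes>\<^sub>M borel \<Otimes>\<^sub>M borel" by measurable
    from measurable_compose[OF this assms(1)] show ?thesis by simp
  qed
  have ae: "AE x in lborel. (\<integral>\<^sup>+y. \<integral>\<^sup>+z. ennreal (G x y z) \<partial>lborel \<partial>lborel) \<noteq> \<infinity>"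
    by (rule nn_integral_noteq_infinite) (use fin in auto)
  have "(\<integral>\<^sup>+x. ennreal (LINT y|lborel. LINT z|lborel. G x y z) \<partial>lborel) = (\<integral>\<^sup>+x. \<integral>\<^sup>+y. \<integral>\<^sup>+z. ennreal (G x y z) \<partial>lborel \<partial>lborel \<partial>lborel)"
    by (rule nn_integral_cong_AE, use ae in eventually_elim)
       (rule lborel_integral_nested2, auto simp: nonneg less_top)
  moreover have "(LINT x|lborel. LINT y|lborel. LINT z|lborel. G x y z) = enn2real (\<integral>\<^sup>+x. ennreal (LINT y|lborel. LINT z|lborel. G x y z) \<partial>lborel)"
    by (rule integral_eq_nn_integral) (auto simp: nonneg intro!: integral_nonneg)
  ultimately show ?thesis using fin by (simp add: less_top)
qed

text \<open>\<open>f\<close> may be arbitrary at heights \<open>z \<le> 0\<close>; the condition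
  \<open>r < c\<close> keeps the ball in the half space, where \<open>f\<close> and \<open>g\<close>
  agree. \<open>T\<close> may be closed or open because the two caps of a lens share their base,
  which is a null set but should be counted in only one of them.\<close>

lemma LBINT_cap:
  fixes f :: "real \<Rightarrow> real" and c :: real
  defines "g \<equiv> \<lambda>z. f z * indicator {0<..} z"
  assumes [measurable]: "f \<in> borel_measurable borel" and f_nonneg: "\<And>z. z > 0 \<Longrightarrow> 0 \<le> f z"
    and unit: "\<sigma>\<^sup>2 + \<kappa>\<^sup>2 = 1" and rc: "0 < r" "r < c" and t: "- r \<le> t" "t \<le> r"
    and T: "T = {t..} \<or> T = {t<..}"
    and fin: "(\<integral>\<^sup>+x. \<integral>\<^sup>+y. \<integral>\<^sup>+z. ennreal (g z * indicator {..r\<^sup>2} (x\<^sup>2 + y\<^sup>2 + (z - c)\<^sup>2) * indicator T (\<sigma> * x + \<kappa> * (z - c))) \<partial>lborel \<partial>lborel \<partial>lborel) < \<infinity>"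
      (is "?I < _")
  shows "(LBINT w=t..r. (LBINT \<theta>=0..2*pi. (LBINT \<rho>=0..sqrt (r\<^sup>2 - w\<^sup>2). f (c + w * \<kappa> - \<rho> * cos \<theta> * \<sigma>) * \<rho>))) = enn2real ?I"
proof -
  let ?P = "\<lambda>w \<theta> \<rho>. g (c + w * \<kappa> - \<rho> * cos \<theta> * \<sigma>) * indicator {..r\<^sup>2} (w\<^sup>2 + \<rho>\<^sup>2) * indicator T w
    * \<rho> * indicator {0<..} \<rho> * indicator {0<..<2 * pi} \<theta>"
  let ?L = "\<lambda>w \<theta>. LBINT \<rho>=0..sqrt (r\<^sup>2 - w\<^sup>2). f (c + w * \<kappa> - \<rho> * cos \<theta> * \<sigma>) * \<rho>"
  have [measurable]: "T \<in> sets borel" using T by auto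
  have [measurable]: "g \<in> borel_measurable borel" unfolding g_def by measurable
  have g_nonneg: "0 \<le> g z" for z using f_nonneg by (auto simp: g_def indicator_def)
  define G where "G = (\<lambda>w \<theta> \<rho>. g (c + w * \<kappa> - \<rho> * cos \<theta> * \<sigma>) * \<rho> * indicator {t<..<r} w
    * indicator {0<..<2 * pi} \<theta> * indicator {0<..<sqrt (r\<^sup>2 - w\<^sup>2)} \<rho>)"
  have [measurable]: "(\<lambda>(x, y, z). G x y z) \<in> borel_measurable (borel \<Otimes>\<^sub>M borel \<Otimes>\<^sub>M borel)"
  proof -
    have "(\<lambda>(w, \<theta>, \<rho>). G w \<theta> \<rho>) = (\<lambda>x. g (c + fst x * \<kappa> - snd (snd x) * cos (fst (snd x)) * \<sigma>) * snd (snd x) * indicator {t<..<r} (fst x)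
      * indicator {0<..<2 * pi} (fst (snd x)) * (if 0 < snd (snd x) \<and> snd (snd x) < sqrt (r\<^sup>2 - (fst x)\<^sup>2) then 1 else 0))"
      by (auto simp: G_def fun_eq_iff indicator_def)
    then show ?thesis by (simp only:) measurable
  qed
  have G_nonneg: "0 \<le> G w \<theta> \<rho>" for w \<theta> \<rho>
    by (auto simp: G_def indicator_def g_nonneg)
  have "?I = (\<integral>\<^sup>+w. \<integral>\<^sup>+\<theta>. \<integral>\<^sup>+\<rho>. ennreal (?P w \<theta> \<rho>) \<partial>lborel \<partial>lborel \<partial>lborel)"
    by (rule nn_integral_cap[OF _ _ g_nonneg unit]) auto
  also have "\<dots> = (\<integral>\<^sup>+w. \<integral>\<^sup>+\<theta>. \<integral>\<^sup>+\<rho>. ennreal (G w \<theta> \<rho>) \<partial>lborel \<partial>lborel \<partial>lborel)"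
  proof (rule nn_integral_cong_AE)
    have "AE w in lborel. w \<noteq> t" "AE w in lborel. w \<noteq> r" by (rule AE_lborel_singleton)+
    then show "AE w in lborel. (\<integral>\<^sup>+\<theta>. \<integral>\<^sup>+\<rho>. ennreal (?P w \<theta> \<rho>) \<partial>lborel \<partial>lborel) = (\<integral>\<^sup>+\<theta>. \<integral>\<^sup>+\<rho>. ennreal (G w \<theta> \<rho>) \<partial>lborel \<partial>lborel)"
    proof eventually_elim
      case (elim w)
      show ?case
      proof (rule nn_integral_cong, rule nn_integral_cong_AE)
        fix \<theta> :: real
        have "AE \<rho> in lborel. \<rho> \<noteq> sqrt (r\<^sup>2 - w\<^sup>2)" by (rule AE_lborel_singleton)
        then show "AE \<rho> in lborel. ennreal (?P w \<theta> \<rho>) = ennreal (G w \<theta> \<rho>)"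
        proof eventually_elim
          case (elim \<rho>)
          have Tw: "w \<in> T \<longleftrightarrow> t < w" using T \<open>w \<noteq> t\<close> by auto
          have "w\<^sup>2 + \<rho>\<^sup>2 \<le> r\<^sup>2 \<and> t < w \<longleftrightarrow> w < r \<and> t < w \<and> \<rho> < sqrt (r\<^sup>2 - w\<^sup>2)" if "\<rho> > 0"
          proof (cases "t < w \<and> w < r")
            case True
            then have "w\<^sup>2 \<le> r\<^sup>2" using t rc by (intro abs_le_square_iff[THEN iffD1]) auto
            then have "\<rho>\<^sup>2 \<le> r\<^sup>2 - w\<^sup>2 \<longleftrightarrow> \<rho> \<le> sqrt (r\<^sup>2 - w\<^sup>2)"
              using that real_sqrt_le_iff[of "\<rho>\<^sup>2" "r\<^sup>2 - w\<^sup>2"] by simp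
            then show ?thesis using True elim by auto
          next
            case False
            have "w < r" if "w\<^sup>2 + \<rho>\<^sup>2 \<le> r\<^sup>2"
            proof -
              have "w\<^sup>2 < r\<^sup>2" using that \<open>\<rho> > 0\<close> by (smt (verit) zero_less_power)
              then show ?thesis using rc by (simp add: power2_less_imp_less)
            qed
            with False show ?thesis by auto
          qed
          then show ?case unfolding G_def by (auto simp: indicator_def Tw)
        qed
      qed
    qed
  qed
  finally have I: "?I = (\<integral>\<^sup>+w. \<integral>\<^sup>+\<theta>. \<integral>\<^sup>+\<rho>. ennreal (G w \<theta> \<rho>) \<partial>lborel \<partial>lborel \<partial>lborel)" .
  have "(LBINT w=t..r. (LBINT \<theta>=0..2*pi. ?L w \<theta>))
    = (LINT w|lborel. LINT \<theta>|lborel. LINT \<rho>|lborel. G w \<theta> \<rho>)"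
  proof -
    have "(LBINT w=t..r. (LBINT \<theta>=0..2*pi. ?L w \<theta>))
      = (LINT w|lborel. indicator {t<..<r} w * (LBINT \<theta>=0..2*pi. ?L w \<theta>))"
      using t by (simp add: interval_integral_Ioo set_lebesgue_integral_def)
    also have "\<dots> = (LINT w|lborel. LINT \<theta>|lborel. LINT \<rho>|lborel. G w \<theta> \<rho>)"
    proof (rule Bochner_Integration.integral_cong[OF refl])
      fix w :: real
      show "indicator {t<..<r} w * (LBINT \<theta>=0..2*pi. ?L w \<theta>)
        = (LINT \<theta>|lborel. LINT \<rho>|lborel. G w \<theta> \<rho>)"
      proof (cases "w \<in> {t<..<r}")
        case True
        then have w2: "w\<^sup>2 \<le> r\<^sup>2" using t rc by (intro abs_le_square_iff[THEN iffD1]) auto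
        have "(LBINT \<theta>=0..2*pi. ?L w \<theta>)
          = (LINT \<theta>|lborel. indicator {0<..<2*pi} \<theta> * ?L w \<theta>)"
          by (subst interval_integral_Ioo) (auto simp: set_lebesgue_integral_def)
        also have "\<dots> = (LINT \<theta>|lborel. LINT \<rho>|lborel. G w \<theta> \<rho>)"
        proof (rule Bochner_Integration.integral_cong[OF refl])
          fix \<theta> :: real
          have "?L w \<theta>
            = (LINT \<rho>|lborel. indicator {0<..<sqrt (r\<^sup>2 - w\<^sup>2)} \<rho> * (f (c + w * \<kappa> - \<rho> * cos \<theta> * \<sigma>) * \<rho>))"
            using w2 by (subst interval_integral_Ioo) (auto simp: set_lebesgue_integral_def)
          also have "\<dots> = (LINT \<rho>|lborel. indicator {0<..<sqrt (r\<^sup>2 - w\<^sup>2)} \<rho> * (g (c + w * \<kappa> - \<rho> * cos \<theta> * \<sigma>) * \<rho>))"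
          proof (rule Bochner_Integration.integral_cong[OF refl])
            fix \<rho> :: real
            have "c + w * \<kappa> - \<rho> * cos \<theta> * \<sigma> > 0" if "\<rho> \<in> {0<..<sqrt (r\<^sup>2 - w\<^sup>2)}"
            proof -
              have "\<rho>\<^sup>2 \<le> r\<^sup>2 - w\<^sup>2" using that w2 by (auto intro: real_le_rsqrt sqrt_ge_absD)
              then have le: "w\<^sup>2 + \<rho>\<^sup>2 \<le> r\<^sup>2" by simp
              \<comment> \<open>Cauchy-Schwarz: the height of a point of the ball differs from
                \<open>c\<close> by at most its distance from the centre. The defect is the square
                of the other rotated coordinate.\<close>
              have "(w * \<kappa> - \<rho> * cos \<theta> * \<sigma>)\<^sup>2 \<le> (w\<^sup>2 + (\<rho> * cos \<theta>)\<^sup>2) * (\<sigma>\<^sup>2 + \<kappa>\<^sup>2)"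
              proof -
                have "(w\<^sup>2 + (\<rho> * cos \<theta>)\<^sup>2) * (\<sigma>\<^sup>2 + \<kappa>\<^sup>2) - (w * \<kappa> - \<rho> * cos \<theta> * \<sigma>)\<^sup>2 = (w * \<sigma> + \<rho> * cos \<theta> * \<kappa>)\<^sup>2"
                  by (simp add: power2_eq_square algebra_simps)
                then show ?thesis by (metis diff_ge_0_iff_ge zero_le_power2)
              qed
              also have "\<dots> = w\<^sup>2 + \<rho>\<^sup>2 * (cos \<theta>)\<^sup>2" unfolding unit by (simp add: power_mult_distrib)
              also have "\<dots> \<le> w\<^sup>2 + \<rho>\<^sup>2 * 1"
                by (intro add_left_mono mult_left_mono) (auto simp: abs_square_le_1)
              also have "\<dots> \<le> r\<^sup>2" using le by simp
              finally have "\<bar>w * \<kappa> - \<rho> * cos \<theta> * \<sigma>\<bar> \<le> r" using rc by (simp add: abs_le_square_iff[symmetric])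
              then show ?thesis using rc by linarith
            qed
            then show "indicator {0<..<sqrt (r\<^sup>2 - w\<^sup>2)} \<rho> * (f (c + w * \<kappa> - \<rho> * cos \<theta> * \<sigma>) * \<rho>)
              = indicator {0<..<sqrt (r\<^sup>2 - w\<^sup>2)} \<rho> * (g (c + w * \<kappa> - \<rho> * cos \<theta> * \<sigma>) * \<rho>)"
              by (auto simp: g_def indicator_def)
          qed
          finally have *: "?L w \<theta>
            = (LINT \<rho>|lborel. indicator {0<..<sqrt (r\<^sup>2 - w\<^sup>2)} \<rho> * (g (c + w * \<kappa> - \<rho> * cos \<theta> * \<sigma>) * \<rho>))" .
          have "(LINT \<rho>|lborel. G w \<theta> \<rho>) = (LINT \<rho>|lborel. indicator {0<..<2*pi} \<theta> * (indicator {0<..<sqrt (r\<^sup>2 - w\<^sup>2)} \<rho> * (g (c + w * \<kappa> - \<rho> * cos \<theta> * \<sigma>) * \<rho>)))"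
            using True unfolding G_def by (intro Bochner_Integration.integral_cong refl) (simp add: mult_ac)
          also have "\<dots> = indicator {0<..<2*pi} \<theta> * ?L w \<theta>"
            unfolding * by (rule integral_mult_right_zero)
          finally show "indicator {0<..<2*pi} \<theta> * ?L w \<theta>
            = (LINT \<rho>|lborel. G w \<theta> \<rho>)" ..
        qed
        finally show ?thesis using True by simp
      next
        case False
        then show ?thesis by (simp add: G_def)
      qed
    qed
    finally show ?thesis .
  qed
  moreover have "ennreal (LINT w|lborel. LINT \<theta>|lborel. LINT \<rho>|lborel. G w \<theta> \<rho>) = ?I"
    unfolding I by (rule lborel_integral_nested3) (use fin I G_nonneg in auto)
  moreover have "0 \<le> (LINT w|lborel. LINT \<theta>|lborel. LINT \<rho>|lborel. G w \<theta> \<rho>)"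
    by (intro Bochner_Integration.integral_nonneg G_nonneg)
  ultimately show ?thesis by (metis enn2real_ennreal)
qed

lemma emeasure_disc:
  assumes "0 \<le> A"
  shows "(\<integral>\<^sup>+p. indicator {..A} ((fst p)\<^sup>2 + (snd p)\<^sup>2) \<partial>(lborel \<Otimes>\<^sub>M lborel :: (real \<times> real) measure)) = ennreal (pi * A)"
proof -
  have "(\<integral>\<^sup>+p. indicator {..A} ((fst p)\<^sup>2 + (snd p)\<^sup>2) \<partial>(lborel \<Otimes>\<^sub>M lborel :: (real \<times> real) measure))
    = (\<integral>\<^sup>+p. indicator (cball 0 (sqrt A)) p \<partial>(lborel :: (real \<times> real) measure))"
    unfolding lborel_prod by (rule nn_integral_cong) (auto simp: indicator_def norm_prod_def)
  also have "\<dots> = ennreal (pi * A)"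
    using assms by (simp add: emeasure_cball unit_ball_vol_2)
  finally show ?thesis .
qed

text \<open>The horizontal slice at height \<open>z\<close> is a disc of area
  \<open>pi * max 0 (r^2 - (z - c)^2)\<close>. Since this is at most \<open>pi * r^2\<close>,
  integrability of \<open>g\<close> gives finite mass.\<close>

lemma LBINT_ball:
  fixes f :: "real \<Rightarrow> real" and c :: real
  defines "g \<equiv> \<lambda>z. f z * indicator {0<..} z"
  assumes [measurable]: "f \<in> borel_measurable borel" and f_nonneg: "\<And>z. z > 0 \<Longrightarrow> 0 \<le> f z"
    and rc: "0 < r" "r < c"
    and fin: "(\<integral>\<^sup>+z. ennreal (g z) \<partial>lborel) < \<infinity>"
  shows "pi * (LBINT w=-r..r. f (w + c) * (r\<^sup>2 - w\<^sup>2))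
     = enn2real (\<integral>\<^sup>+x. \<integral>\<^sup>+y. \<integral>\<^sup>+z. ennreal (g z * indicator {..r\<^sup>2} (x\<^sup>2 + y\<^sup>2 + (z - c)\<^sup>2)) \<partial>lborel \<partial>lborel \<partial>lborel)" (is "_ = enn2real ?I")
    and "(\<integral>\<^sup>+x. \<integral>\<^sup>+y. \<integral>\<^sup>+z. ennreal (g z * indicator {..r\<^sup>2} (x\<^sup>2 + y\<^sup>2 + (z - c)\<^sup>2)) \<partial>lborel \<partial>lborel \<partial>lborel) < \<infinity>"
proof -
  have [measurable]: "g \<in> borel_measurable borel" unfolding g_def by measurable
  have g_nonneg: "0 \<le> g z" for z using f_nonneg by (auto simp: g_def indicator_def)
  have "?I = (\<integral>\<^sup>+p. \<integral>\<^sup>+z. ennreal (g z * indicator {..r\<^sup>2} ((fst p)\<^sup>2 + (snd p)\<^sup>2 + (z - c)\<^sup>2)) \<partial>lborel \<partial>(lborel \<Otimes>\<^sub>M lborel))"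
    by (subst lborel.nn_integral_fst[symmetric]) auto
  also have "\<dots> = (\<integral>\<^sup>+z. \<integral>\<^sup>+p. ennreal (g z * indicator {..r\<^sup>2} ((fst p)\<^sup>2 + (snd p)\<^sup>2 + (z - c)\<^sup>2)) \<partial>(lborel \<Otimes>\<^sub>M lborel) \<partial>lborel)"
  proof -
    interpret L: pair_sigma_finite "lborel \<Otimes>\<^sub>M lborel :: (real \<times> real) measure" "lborel :: real measure"
      unfolding lborel_prod ..
    show ?thesis by (rule L.Fubini'[symmetric]) measurable
  qed
  also have "\<dots> = (\<integral>\<^sup>+z. ennreal (pi * (g z * max 0 (r\<^sup>2 - (z - c)\<^sup>2))) \<partial>lborel)"
  proof (rule nn_integral_cong)
    fix z :: real
    have "(\<integral>\<^sup>+p. ennreal (g z * indicator {..r\<^sup>2} ((fst p)\<^sup>2 + (snd p)\<^sup>2 + (z - c)\<^sup>2)) \<partial>(lborel \<Otimes>\<^sub>M lborel))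
      = (\<integral>\<^sup>+p. ennreal (g z) * indicator {..r\<^sup>2 - (z - c)\<^sup>2} ((fst p)\<^sup>2 + (snd p)\<^sup>2) \<partial>(lborel \<Otimes>\<^sub>M lborel))"
      by (rule nn_integral_cong) (auto simp: indicator_def)
    also have "\<dots> = ennreal (g z) * (\<integral>\<^sup>+p. indicator {..r\<^sup>2 - (z - c)\<^sup>2} ((fst p)\<^sup>2 + (snd p)\<^sup>2) \<partial>(lborel \<Otimes>\<^sub>M lborel))"
      by (rule nn_integral_cmult) auto
    also have "\<dots> = ennreal (pi * (g z * max 0 (r\<^sup>2 - (z - c)\<^sup>2)))"
    proof (cases "0 \<le> r\<^sup>2 - (z - c)\<^sup>2")
      case True
      then show ?thesis using g_nonneg by (simp add: emeasure_disc ennreal_mult[symmetric] mult_ac max_def)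
    next
      case False
      have "indicator {..r\<^sup>2 - (z - c)\<^sup>2} ((fst p)\<^sup>2 + (snd p)\<^sup>2) = (0::ennreal)" for p :: "real \<times> real"
      proof -
        have "0 \<le> (fst p)\<^sup>2 + (snd p)\<^sup>2" by simp
        then have "\<not> (fst p)\<^sup>2 + (snd p)\<^sup>2 \<le> r\<^sup>2 - (z - c)\<^sup>2" using False by linarith
        then show ?thesis by (simp add: indicator_def)
      qed
      then show ?thesis using False by (simp add: max_def)
    qed
    finally show "(\<integral>\<^sup>+p. ennreal (g z * indicator {..r\<^sup>2} ((fst p)\<^sup>2 + (snd p)\<^sup>2 + (z - c)\<^sup>2)) \<partial>(lborel \<Otimes>\<^sub>M lborel))
      = ennreal (pi * (g z * max 0 (r\<^sup>2 - (z - c)\<^sup>2)))" .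
  qed
  finally have I: "?I = (\<integral>\<^sup>+z. ennreal (pi * (g z * max 0 (r\<^sup>2 - (z - c)\<^sup>2))) \<partial>lborel)" .
  also have "\<dots> \<le> (\<integral>\<^sup>+z. ennreal (pi * r\<^sup>2) * ennreal (g z) \<partial>lborel)"
  proof (rule nn_integral_mono)
    fix z :: real
    have "g z * max 0 (r\<^sup>2 - (z - c)\<^sup>2) \<le> g z * r\<^sup>2"
      by (intro mult_left_mono g_nonneg) auto
    then show "ennreal (pi * (g z * max 0 (r\<^sup>2 - (z - c)\<^sup>2))) \<le> ennreal (pi * r\<^sup>2) * ennreal (g z)"
      using g_nonneg by (simp add: ennreal_mult[symmetric] mult_ac ennreal_leI)
  qed
  also have "\<dots> = ennreal (pi * r\<^sup>2) * (\<integral>\<^sup>+z. ennreal (g z) \<partial>lborel)" by (rule nn_integral_cmult) auto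
  also have "\<dots> < \<infinity>" using fin by (simp add: ennreal_mult_less_top)
  finally show I_fin: "?I < \<infinity>" .
  have "(LBINT w=-r..r. f (w + c) * (r\<^sup>2 - w\<^sup>2)) = (LINT w|lborel. indicator {-r<..<r} w * (f (w + c) * (r\<^sup>2 - w\<^sup>2)))"
    using rc by (subst interval_integral_Ioo) (auto simp: set_lebesgue_integral_def)
  also have "\<dots> = (LINT w|lborel. g (w + c) * max 0 (r\<^sup>2 - w\<^sup>2))"
  proof (rule Bochner_Integration.integral_cong[OF refl])
    fix w :: real
    show "indicator {-r<..<r} w * (f (w + c) * (r\<^sup>2 - w\<^sup>2)) = g (w + c) * max 0 (r\<^sup>2 - w\<^sup>2)"
    proof (cases "w \<in> {-r<..<r}")
      case True
      then have "w\<^sup>2 \<le> r\<^sup>2" using rc by (intro abs_le_square_iff[THEN iffD1]) auto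
      then show ?thesis using True rc by (auto simp: g_def max_def)
    next
      case False
      then have "r\<^sup>2 \<le> w\<^sup>2" using rc by (intro abs_le_square_iff[THEN iffD1]) auto
      then show ?thesis using False by (auto simp: max_def)
    qed
  qed
  also have "\<dots> = enn2real (\<integral>\<^sup>+w. ennreal (g (w + c) * max 0 (r\<^sup>2 - w\<^sup>2)) \<partial>lborel)"
    by (rule integral_eq_nn_integral) (auto simp: g_nonneg)
  also have "(\<integral>\<^sup>+w. ennreal (g (w + c) * max 0 (r\<^sup>2 - w\<^sup>2)) \<partial>lborel) = (\<integral>\<^sup>+z. ennreal (g z * max 0 (r\<^sup>2 - (z - c)\<^sup>2)) \<partial>lborel)"
    using nn_integral_real_affine[of "\<lambda>z. ennreal (g z * max 0 (r\<^sup>2 - (z - c)\<^sup>2))" 1 c] by (simp add: add.commute)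
  finally have L: "(LBINT w=-r..r. f (w + c) * (r\<^sup>2 - w\<^sup>2)) = enn2real (\<integral>\<^sup>+z. ennreal (g z * max 0 (r\<^sup>2 - (z - c)\<^sup>2)) \<partial>lborel)" .
  have I2: "?I = ennreal pi * (\<integral>\<^sup>+z. ennreal (g z * max 0 (r\<^sup>2 - (z - c)\<^sup>2)) \<partial>lborel)"
    unfolding I by (subst nn_integral_cmult[symmetric]) (auto simp: ennreal_mult[symmetric] g_nonneg)
  show "pi * (LBINT w=-r..r. f (w + c) * (r\<^sup>2 - w\<^sup>2)) = enn2real ?I"
    unfolding L I2 by (simp add: enn2real_mult)
qed

section \<open>Translations, counting measure and the Poisson mean\<close>

lemma nn_integral_lborel_translate:
  fixes h :: "'a::euclidean_space \<Rightarrow> ennreal"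
  assumes "h \<in> borel_measurable borel"
  shows "(\<integral>\<^sup>+p. h (x + p) \<partial>lborel) = (\<integral>\<^sup>+p. h p \<partial>lborel)"
proof -
  have "(\<integral>\<^sup>+p. h p \<partial>lborel) = (\<integral>\<^sup>+p. h p \<partial>distr lborel borel ((+) x))"
    by (simp add: lborel_distr_plus)
  also have "\<dots> = (\<integral>\<^sup>+p. h (x + p) \<partial>lborel)"
    using assms by (intro nn_integral_distr) auto
  finally show ?thesis by simp
qed

lemma emeasure_count_space_image:
  assumes "inj_on h X"
  shows "emeasure (count_space UNIV) (h ` X) = emeasure (count_space UNIV) X"
  by (cases "finite X") (use assms in \<open>auto simp: card_image finite_image_iff emeasure_count_space\<close>)

lemma nn_integral_poisson_mean:
  fixes X :: "'w \<Rightarrow> nat"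
  assumes "prob_space M" and X [measurable]: "X \<in> measurable M (count_space UNIV)"
    and P: "\<And>k. measure M {\<omega>\<in>space M. X \<omega> = k} = c ^ k / fact k * exp (- c)" and c: "0 \<le> c"
  shows "(\<integral>\<^sup>+\<omega>. of_nat (X \<omega>) \<partial>M) = ennreal c"
proof -
  interpret prob_space M by fact
  have "(\<integral>\<^sup>+\<omega>. of_nat (X \<omega>) \<partial>M) = (\<integral>\<^sup>+\<omega>. (\<Sum>k. of_nat k * indicator {\<omega>\<in>space M. X \<omega> = k} \<omega>) \<partial>M)"
  proof (rule nn_integral_cong)
    fix \<omega> assume \<omega>: "\<omega> \<in> space M"
    have "(\<Sum>k. of_nat k * indicator {\<omega>\<in>space M. X \<omega> = k} \<omega> :: ennreal) = (\<Sum>k\<in>{X \<omega>}. of_nat k * indicator {\<omega>\<in>space M. X \<omega> = k} \<omega>)"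
      by (rule suminf_finite) auto
    then show "(of_nat (X \<omega>) :: ennreal) = (\<Sum>k. of_nat k * indicator {\<omega>\<in>space M. X \<omega> = k} \<omega>)"
      using \<omega> by simp
  qed
  also have "\<dots> = (\<Sum>k. of_nat k * emeasure M {\<omega>\<in>space M. X \<omega> = k})"
    by (subst nn_integral_suminf) (auto simp: nn_integral_cmult_indicator)
  also have "\<dots> = (\<Sum>k. ennreal (real k * (c ^ k / fact k * exp (- c))))"
    unfolding emeasure_eq_measure P using c
    by (intro suminf_cong) (simp add: ennreal_of_nat_eq_real_of_nat flip: ennreal_mult)
  also have "\<dots> = ennreal c"
  proof -
    have "(\<lambda>k. c ^ k / fact k) sums exp c"
      using exp_converges[of c] by (simp add: divide_inverse mult.commute scaleR_conv_of_real)
    then have "(\<lambda>k. c * exp (- c) * (c ^ k / fact k)) sums (c * exp (- c) * exp c)" by (rule sums_mult)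
    moreover have "c * exp (- c) * (c ^ k / fact k) = real (Suc k) * (c ^ Suc k / fact (Suc k) * exp (- c))" for k
      by (simp add: fact_Suc del: of_nat_Suc)
    moreover have "c * exp (- c) * exp c = c" by (simp add: exp_minus)
    ultimately have "(\<lambda>k. real (Suc k) * (c ^ Suc k / fact (Suc k) * exp (- c))) sums c"
      by (simp only:)
    \<comment> \<open>The term for \<open>k = 0\<close> vanishes, so the index shift does not change
      the sum.\<close>
    then have "(\<lambda>k. real k * (c ^ k / fact k * exp (- c))) sums c"
      using sums_Suc_iff[of "\<lambda>k. real k * (c ^ k / fact k * exp (- c))" c] by simp
    then show ?thesis using c by (intro suminf_ennreal_eq) auto
  qed
  finally show ?thesis .
qed

section \<open>The union of two hyperbolic balls\<close>

text \<open>For positive heights \<open>near a b c\<close> says that \<open>d(a,c) \<le> d(a,b)\<close>. Clearing denominators makes the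
  condition closed on all of space, and it forces \<open>c\<close> to have positive height.\<close>

definition near :: "pt \<Rightarrow> pt \<Rightarrow> pt \<Rightarrow> bool" where
  "near a b c \<longleftrightarrow> ((dist (fst a) (fst c))\<^sup>2 + (snd a)\<^sup>2 + (snd c)\<^sup>2) * snd b
     \<le> ((dist (fst a) (fst b))\<^sup>2 + (snd a)\<^sup>2 + (snd b)\<^sup>2) * snd c"

definition Kset :: "pt \<Rightarrow> pt \<Rightarrow> pt set" where
  "Kset a b = {c. near a b c \<or> near b a c}"

lemma closed_Kset_graph: "closed {(a, b, c). c \<in> Kset a b}"
proof -
  have "closed {x :: pt \<times> pt \<times> pt. near (fst x) (fst (snd x)) (snd (snd x)) \<or> near (fst (snd x)) (fst x) (snd (snd x))}"
    unfolding near_def by (intro closed_Collect_disj closed_Collect_le continuous_intros)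
  then show ?thesis by (simp add: Kset_def case_prod_unfold)
qed

lemma closed_Kset: "closed (Kset a b)"
  unfolding Kset_def near_def by (intro closed_Collect_disj closed_Collect_le continuous_intros)

lemma Kset_borel [measurable]: "Kset a b \<in> sets borel"
  by (rule borel_closed[OF closed_Kset])

section \<open>The intensity of a union of two hyperbolic balls\<close>

locale mark_density =
  fixes f :: "real \<Rightarrow> real"
  assumes f_meas [measurable]: "f \<in> borel_measurable borel"
    and f_nonneg: "\<And>z. z > 0 \<Longrightarrow> f z \<ge> 0"
    and f_prob: "(\<integral>\<^sup>+ z. ennreal (f z * indicator {0<..} z) \<partial>lborel) = 1"
begin

text \<open>With the density cut off at height \<open>0\<close>, marks can be integrated over the
  whole real line whatever \<open>f\<close> does at nonpositive heights.\<close>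

definition g :: "real \<Rightarrow> real" where "g z = f z * indicator {0<..} z"

abbreviation N :: "pt measure" where "N \<equiv> (lborel \<Otimes>\<^sub>M lborel) \<Otimes>\<^sub>M mark_measure f"

lemma g_meas [measurable]: "g \<in> borel_measurable borel"
  unfolding g_def by measurable

lemma g_nonneg: "0 \<le> g z"
  using f_nonneg by (auto simp: g_def indicator_def)

lemma mark_eq: "mark_measure f = density lborel (\<lambda>z. ennreal (g z))"
  by (simp add: mark_measure_def g_def)

lemma sets_mark [measurable_cong]: "sets (mark_measure f) = sets borel"
  by (simp add: mark_eq)

lemma prob_mark: "prob_space (mark_measure f)"
  by (rule prob_spaceI) (simp add: mark_eq emeasure_density g_def f_prob)

sublocale mark: prob_space "mark_measure f" by (rule prob_mark)

lemma sets_N: "sets N = sets borel"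
proof -
  have "sets N = sets ((borel \<Otimes>\<^sub>M borel) \<Otimes>\<^sub>M borel)"
    by (intro sets_pair_measure_cong) (auto simp: sets_mark)
  then show ?thesis by (simp only: borel_prod)
qed

lemma nn_integral_N:
  assumes [measurable]: "h \<in> borel_measurable borel"
  shows "(\<integral>\<^sup>+c. h c \<partial>N) = (\<integral>\<^sup>+x. \<integral>\<^sup>+y. \<integral>\<^sup>+z. ennreal (g z) * h ((x, y), z) \<partial>lborel \<partial>lborel \<partial>lborel)"
proof -
  have [measurable]: "h \<in> borel_measurable ((borel \<Otimes>\<^sub>M borel) \<Otimes>\<^sub>M borel)" by (simp add: borel_prod)
  have hN: "h \<in> borel_measurable N" using assms by (simp add: measurable_cong_sets[OF sets_N refl])
  have "(\<integral>\<^sup>+c. h c \<partial>N) = (\<integral>\<^sup>+p. \<integral>\<^sup>+z. h (p, z) \<partial>mark_measure f \<partial>(lborel \<Otimes>\<^sub>M lborel))"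
    using hN by (rule mark.nn_integral_fst[symmetric])
  also have "\<dots> = (\<integral>\<^sup>+p. \<integral>\<^sup>+z. ennreal (g z) * h (p, z) \<partial>lborel \<partial>(lborel \<Otimes>\<^sub>M lborel))"
    unfolding mark_eq by (rule nn_integral_cong, subst nn_integral_density) auto
  also have "\<dots> = (\<integral>\<^sup>+x. \<integral>\<^sup>+y. \<integral>\<^sup>+z. ennreal (g z) * h ((x, y), z) \<partial>lborel \<partial>lborel \<partial>lborel)"
    by (subst lborel.nn_integral_fst[symmetric]) auto
  finally show ?thesis .
qed

lemma emeasure_N:
  assumes "S \<in> sets borel"
  shows "emeasure N S = (\<integral>\<^sup>+x. \<integral>\<^sup>+y. \<integral>\<^sup>+z. ennreal (g z) * indicator S ((x, y), z) \<partial>lborel \<partial>lborel \<partial>lborel)"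
proof -
  have "emeasure N S = (\<integral>\<^sup>+c. indicator S c \<partial>N)" using assms sets_N by simp
  then show ?thesis using assms by (simp add: nn_integral_N)
qed

text \<open>The hyperbolic ball of radius \<open>R\<close> around a point at height \<open>z\<close>
  is the Euclidean ball of radius \<open>z * sinh R\<close> whose centre has the same projection and
  height \<open>z * cosh R\<close>. Inclusion-exclusion, with the intersection cut into two caps,
  gives the four terms of \<open>Fun_F\<close>.\<close>

lemma measure_Kset_eq_Fun_F:
  assumes s: "s > 0" and z: "z > 0" "z' > 0"
  shows "measure N (Kset ((0, 0), z) ((s, 0), z')) = Fun_F f s z z'"
proof -
  \<comment> \<open>\<open>q\<close> is \<open>cosh R\<close> and \<open>S\<close> below is
    \<open>sinh R\<close>. The geometry is done with these; \<open>arcosh\<close> enters only when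
    \<open>Fun_F\<close> is unfolded at the end.\<close>
  define q where "q = (s\<^sup>2 + z\<^sup>2 + z'\<^sup>2) / (2 * z * z')"
  have q: "s\<^sup>2 + z\<^sup>2 + z'\<^sup>2 = 2 * z * z' * q" using z by (simp add: q_def)
  have q_R: "s\<^sup>2 / (2 * z * z') + (z / z' + z' / z) / 2 = q"
    using z by (simp add: q_def field_simps power2_eq_square)
  have q1: "q > 1"
  proof -
    have "2 * z * z' * (q - 1) = s\<^sup>2 + (z - z')\<^sup>2" using q by (simp add: power2_eq_square algebra_simps)
    also have "\<dots> > 0" using s by (simp add: add_pos_nonneg)
    finally show ?thesis using zero_less_mult_pos[of "2 * z * z'" "q - 1"] z by simp
  qed
  define S where "S = sqrt (q\<^sup>2 - 1)"
  have q2: "q\<^sup>2 > 1" using q1 by (simp add: one_less_power)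
  have S: "S > 0" "S\<^sup>2 = q\<^sup>2 - 1" using q2 by (auto simp: S_def)
  have Sq: "S < q" by (rule power2_less_imp_less) (use S q1 in auto)
  define d where "d = sqrt (s\<^sup>2 + (z - z')\<^sup>2 * q\<^sup>2)"
  define r where "r = z * S" define r' where "r' = z' * S"
  define c where "c = z * q" define c' where "c' = z' * q"
  define h where "h = (r' - r + d) * (r + r' - d) / (2 * d)"
  define h' where "h' = (r - r' + d) * (r + r' - d) / (2 * d)"
  \<comment> \<open>\<open>(\<sigma>, \<kappa>)\<close> is the unit vector from the first Euclidean
    centre to the second in the vertical plane through both. Its components are the sine and cosine
    of its angle with the vertical, which is the \<open>\<delta>\<close> of
    \<open>Fun_F\<close>.\<close>
  define \<sigma> where "\<sigma> = s / d" define \<kappa> where "\<kappa> = (c' - c) / d"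
  have rc: "0 < r" "r < c" "0 < r'" "r' < c'" using z S Sq by (auto simp: r_def c_def r'_def c'_def)
  have dd: "d\<^sup>2 = s\<^sup>2 + (z - z')\<^sup>2 * q\<^sup>2" unfolding d_def by (rule real_sqrt_pow2) simp
  have d2: "d\<^sup>2 = s\<^sup>2 + (c' - c)\<^sup>2"
    unfolding dd by (simp add: c_def c'_def power2_eq_square algebra_simps)
  have d: "d > 0"
  proof -
    have "s\<^sup>2 + (z - z')\<^sup>2 * q\<^sup>2 > 0" using s by (intro add_pos_nonneg) auto
    then show ?thesis by (simp add: d_def)
  qed
  \<comment> \<open>This and \<open>d \<le> r + r'\<close> say that the two spheres meet. Hence the
    cap heights \<open>h\<close> and \<open>h'\<close> lie between \<open>0\<close> and the
    diameters, as \<open>LBINT_cap\<close> requires.\<close>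
  have rr_le: "\<bar>r - r'\<bar> \<le> d"
  proof (rule power2_le_imp_le)
    have "(r - r')\<^sup>2 = (z - z')\<^sup>2 * (q\<^sup>2 - 1)"
      unfolding S(2)[symmetric] r_def r'_def by (simp add: power2_eq_square algebra_simps)
    also have "\<dots> \<le> (z - z')\<^sup>2 * q\<^sup>2" by (intro mult_left_mono) auto
    also have "\<dots> \<le> s\<^sup>2 + (z - z')\<^sup>2 * q\<^sup>2" by simp
    also have "\<dots> = d\<^sup>2" by (simp add: dd)
    finally show "\<bar>r - r'\<bar>\<^sup>2 \<le> d\<^sup>2" by simp
  qed (use d in simp)
  have d_le: "d \<le> r + r'"
  proof (rule power2_le_imp_le)
    \<comment> \<open>Eliminating \<open>s\<close> in favour of \<open>q\<close> leaves
      \<open>2 * z * z' * (2 * q + 1) * (q - 1)\<close>, which is nonnegative because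
      \<open>q > 1\<close>.\<close>
    have "(r + r')\<^sup>2 - d\<^sup>2 = (z + z')\<^sup>2 * S\<^sup>2 - (s\<^sup>2 + (z - z')\<^sup>2 * q\<^sup>2)"
      unfolding dd by (simp add: r_def r'_def power2_eq_square algebra_simps)
    also have "\<dots> = 2 * z * z' * ((2 * q + 1) * (q - 1)) - (s\<^sup>2 + z\<^sup>2 + z'\<^sup>2 - 2 * z * z' * q)"
      unfolding S(2) by (simp add: power2_eq_square algebra_simps)
    also have "\<dots> = 2 * z * z' * ((2 * q + 1) * (q - 1))" using q by simp
    also have "\<dots> \<ge> 0" using z q1 by simp
    finally show "d\<^sup>2 \<le> (r + r')\<^sup>2" by simp
  qed (use rc in simp)
  \<comment> \<open>\<open>r - h\<close> and \<open>r' - h'\<close> are the signed distances of the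
    radical plane from the two centres, each measured towards the other centre; therefore they add
    up to \<open>d\<close>.\<close>
  have t: "2 * d * (r - h) = d\<^sup>2 + r\<^sup>2 - r'\<^sup>2" "2 * d * (r' - h') = d\<^sup>2 + r'\<^sup>2 - r\<^sup>2"
    using d by (simp_all add: h_def h'_def field_simps power2_eq_square)
  have tt: "(r - h) + (r' - h') = d"
  proof -
    have "2 * d * ((r - h) + (r' - h')) = 2 * d * d"
      using t by (simp add: distrib_left power2_eq_square)
    then show ?thesis using d by simp
  qed
  have h_nonneg: "0 \<le> h" "0 \<le> h'" using rr_le d_le d by (auto simp: h_def h'_def)
  have t_ge: "- r \<le> r - h" "- r' \<le> r' - h'"
  proof -
    have "2 * d * (r - h + r) = (d + r + r') * (d + r - r')" unfolding distrib_left t by (simp add: power2_eq_square algebra_simps)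
    also have "\<dots> \<ge> 0" using rr_le d rc by (intro mult_nonneg_nonneg) auto
    finally show "- r \<le> r - h" using d by (simp add: zero_le_mult_iff)
    have "2 * d * (r' - h' + r') = (d + r + r') * (d + r' - r)" unfolding distrib_left t by (simp add: power2_eq_square algebra_simps)
    also have "\<dots> \<ge> 0" using rr_le d rc by (intro mult_nonneg_nonneg) auto
    finally show "- r' \<le> r' - h'" using d by (simp add: zero_le_mult_iff)
  qed
  have unit: "\<sigma>\<^sup>2 + \<kappa>\<^sup>2 = 1"
  proof -
    have "\<sigma>\<^sup>2 + \<kappa>\<^sup>2 = d\<^sup>2 / d\<^sup>2"
      unfolding \<sigma>_def \<kappa>_def power_divide d2 by (rule add_divide_distrib[symmetric])
    then show ?thesis using d by simp
  qed
  then have unit': "\<sigma>\<^sup>2 + (- \<kappa>)\<^sup>2 = 1" by (simp only: power2_minus)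
  have \<sigma>: "\<sigma> > 0" using s d by (simp add: \<sigma>_def)
  have \<kappa>: "\<bar>\<kappa>\<bar> \<le> 1"
  proof -
    have "\<kappa>\<^sup>2 \<le> 1" using unit zero_le_power2[of \<sigma>] by linarith
    then show ?thesis by (simp add: abs_square_le_1)
  qed
  have \<sigma>_eq: "sqrt (1 - \<kappa>\<^sup>2) = \<sigma>" using unit \<sigma> by (intro real_sqrt_unique) auto

  define w where "w = (\<lambda>p :: pt. \<sigma> * fst (fst p) + \<kappa> * (snd p - c))"
  define A1 where "A1 = (\<lambda>p :: pt. (fst (fst p))\<^sup>2 + (snd (fst p))\<^sup>2 + (snd p - c)\<^sup>2)"
  define A2 where "A2 = (\<lambda>p :: pt. (s - fst (fst p))\<^sup>2 + (snd (fst p))\<^sup>2 + (snd p - c')\<^sup>2)"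
  define B1 where "B1 = {p. A1 p \<le> r\<^sup>2}"
  define B2 where "B2 = {p. A2 p \<le> r'\<^sup>2}"
  define C1 where "C1 = {p. A1 p \<le> r\<^sup>2 \<and> r - h \<le> w p}"
  \<comment> \<open>The strict inequality leaves the radical plane to \<open>C1\<close>, so the caps
    are disjoint.\<close>
  define C2 where "C2 = {p. A2 p \<le> r'\<^sup>2 \<and> w p < r - h}"
  have B_sets [measurable]: "B1 \<in> sets borel" "B2 \<in> sets borel"
    unfolding B1_def B2_def A1_def A2_def
    by (intro borel_closed closed_Collect_le continuous_intros)+
  have C_sets [measurable]: "C1 \<in> sets borel" "C2 \<in> sets borel"
  proof -
    have "C1 = B1 \<inter> {p. r - h \<le> w p}" "C2 = B2 - {p. r - h \<le> w p}"
      by (auto simp: C1_def C2_def B1_def B2_def)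
    moreover have "{p. r - h \<le> w p} \<in> sets borel"
      unfolding w_def by (intro borel_closed closed_Collect_le continuous_intros)
    ultimately show "C1 \<in> sets borel" "C2 \<in> sets borel" by auto
  qed
  have setsN: "B1 \<in> sets N" "B2 \<in> sets N" "C1 \<in> sets N" "C2 \<in> sets N"
    unfolding sets_N by (fact B_sets C_sets)+
  have near1: "near ((0, 0), z) ((s, 0), z') p \<longleftrightarrow> p \<in> B1" for p
  proof -
    have "near ((0, 0), z) ((s, 0), z') p \<longleftrightarrow> ((fst (fst p))\<^sup>2 + (snd (fst p))\<^sup>2 + z\<^sup>2 + (snd p)\<^sup>2) * z' \<le> (s\<^sup>2 + z\<^sup>2 + z'\<^sup>2) * snd p"
      by (cases p) (auto simp: near_def dist_prod_def dist_real_def)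
    also have "\<dots> \<longleftrightarrow> ((fst (fst p))\<^sup>2 + (snd (fst p))\<^sup>2 + z\<^sup>2 + (snd p)\<^sup>2) * z' \<le> (2 * z * q * snd p) * z'"
      unfolding q by (simp add: mult_ac)
    also have "\<dots> \<longleftrightarrow> (fst (fst p))\<^sup>2 + (snd (fst p))\<^sup>2 + z\<^sup>2 + (snd p)\<^sup>2 \<le> 2 * z * q * snd p"
      using z by (simp add: mult_le_cancel_right)
    also have "\<dots> \<longleftrightarrow> p \<in> B1"
    proof -
      have "r\<^sup>2 = z\<^sup>2 * (q\<^sup>2 - 1)" by (simp add: r_def power_mult_distrib S)
      then have "A1 p - r\<^sup>2 = (fst (fst p))\<^sup>2 + (snd (fst p))\<^sup>2 + z\<^sup>2 + (snd p)\<^sup>2 - 2 * z * q * snd p"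
        by (simp add: A1_def c_def power2_eq_square algebra_simps)
      then show ?thesis by (auto simp: B1_def)
    qed
    finally show ?thesis .
  qed
  have near2: "near ((s, 0), z') ((0, 0), z) p \<longleftrightarrow> p \<in> B2" for p
  proof -
    have "near ((s, 0), z') ((0, 0), z) p \<longleftrightarrow> ((s - fst (fst p))\<^sup>2 + (snd (fst p))\<^sup>2 + z'\<^sup>2 + (snd p)\<^sup>2) * z \<le> (s\<^sup>2 + z\<^sup>2 + z'\<^sup>2) * snd p"
      by (cases p) (auto simp: near_def dist_prod_def dist_real_def add_ac)
    also have "\<dots> \<longleftrightarrow> ((s - fst (fst p))\<^sup>2 + (snd (fst p))\<^sup>2 + z'\<^sup>2 + (snd p)\<^sup>2) * z \<le> (2 * z' * q * snd p) * z"
      unfolding q by (simp add: mult_ac)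
    also have "\<dots> \<longleftrightarrow> (s - fst (fst p))\<^sup>2 + (snd (fst p))\<^sup>2 + z'\<^sup>2 + (snd p)\<^sup>2 \<le> 2 * z' * q * snd p"
      using z by (simp add: mult_le_cancel_right)
    also have "\<dots> \<longleftrightarrow> p \<in> B2"
    proof -
      have "r'\<^sup>2 = z'\<^sup>2 * (q\<^sup>2 - 1)" by (simp add: r'_def power_mult_distrib S)
      then have "A2 p - r'\<^sup>2 = (s - fst (fst p))\<^sup>2 + (snd (fst p))\<^sup>2 + z'\<^sup>2 + (snd p)\<^sup>2 - 2 * z' * q * snd p"
        by (simp add: A2_def c'_def power2_eq_square algebra_simps)
      then show ?thesis by (auto simp: B2_def)
    qed
    finally show ?thesis .
  qed
  have K: "Kset ((0, 0), z) ((s, 0), z') = B1 \<union> B2"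
    by (auto simp: Kset_def near1 near2)

  have dw: "d * w p = s * fst (fst p) + (c' - c) * (snd p - c)" for p
    using d by (simp add: w_def \<sigma>_def \<kappa>_def distrib_left)
  \<comment> \<open>The radical plane of the two spheres is \<open>w p = r - h\<close>.\<close>
  have radical: "(A1 p - r\<^sup>2) - (A2 p - r'\<^sup>2) = 2 * d * (w p - (r - h))" for p
  proof -
    have "2 * d * (w p - (r - h)) = 2 * (d * w p) - 2 * d * (r - h)" by (simp add: algebra_simps)
    also have "\<dots> = 2 * (s * fst (fst p) + (c' - c) * (snd p - c)) - (s\<^sup>2 + (c' - c)\<^sup>2 + r\<^sup>2 - r'\<^sup>2)"
      unfolding dw t d2 by simp
    finally show ?thesis by (simp add: A1_def A2_def power2_eq_square algebra_simps)
  qed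
  \<comment> \<open>Beyond the radical plane, membership in the first ball implies membership in the
    second; before it, the converse implication holds. So on either side the lens is a cap of a
    single ball.\<close>
  have side: "r - h \<le> w p \<longleftrightarrow> A2 p - r'\<^sup>2 \<le> A1 p - r\<^sup>2" for p
  proof -
    have "r - h \<le> w p \<longleftrightarrow> 0 \<le> 2 * d * (w p - (r - h))" using d by (simp add: zero_le_mult_iff)
    then show ?thesis unfolding radical[symmetric] by simp
  qed
  have B12: "B1 \<inter> B2 = C1 \<union> C2" "C1 \<inter> C2 = {}"
    unfolding B1_def B2_def C1_def C2_def using side by (auto simp: not_le[symmetric])

  have fin_g: "(\<integral>\<^sup>+z. ennreal (f z * indicator {0<..} z) \<partial>lborel) < \<infinity>" by (simp add: f_prob)
  have eB1: "emeasure N B1 = (\<integral>\<^sup>+x. \<integral>\<^sup>+y. \<integral>\<^sup>+\<zeta>. ennreal (f \<zeta> * indicator {0<..} \<zeta> * indicator {..r\<^sup>2} (x\<^sup>2 + y\<^sup>2 + (\<zeta> - c)\<^sup>2)) \<partial>lborel \<partial>lborel \<partial>lborel)"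
    by (subst emeasure_N, simp) (intro nn_integral_cong, auto simp: B1_def A1_def g_def indicator_def)
  have eB2: "emeasure N B2 = (\<integral>\<^sup>+x. \<integral>\<^sup>+y. \<integral>\<^sup>+\<zeta>. ennreal (f \<zeta> * indicator {0<..} \<zeta> * indicator {..r'\<^sup>2} (x\<^sup>2 + y\<^sup>2 + (\<zeta> - c')\<^sup>2)) \<partial>lborel \<partial>lborel \<partial>lborel)"
  proof -
    have "emeasure N B2 = (\<integral>\<^sup>+x. \<integral>\<^sup>+y. \<integral>\<^sup>+\<zeta>. ennreal (f \<zeta> * indicator {0<..} \<zeta> * indicator {..r'\<^sup>2} ((s - x)\<^sup>2 + y\<^sup>2 + (\<zeta> - c')\<^sup>2)) \<partial>lborel \<partial>lborel \<partial>lborel)"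
      by (subst emeasure_N, simp) (intro nn_integral_cong, auto simp: B2_def A2_def g_def indicator_def)
    also have "\<dots> = (\<integral>\<^sup>+x. \<integral>\<^sup>+y. \<integral>\<^sup>+\<zeta>. ennreal (f \<zeta> * indicator {0<..} \<zeta> * indicator {..r'\<^sup>2} (x\<^sup>2 + y\<^sup>2 + (\<zeta> - c')\<^sup>2)) \<partial>lborel \<partial>lborel \<partial>lborel)"
      by (subst nn_integral_real_affine[where c="-1" and t=s]) auto
    finally show ?thesis .
  qed
  have eC1: "emeasure N C1 = (\<integral>\<^sup>+x. \<integral>\<^sup>+y. \<integral>\<^sup>+\<zeta>. ennreal (f \<zeta> * indicator {0<..} \<zeta> * indicator {..r\<^sup>2} (x\<^sup>2 + y\<^sup>2 + (\<zeta> - c)\<^sup>2) * indicator {r - h..} (\<sigma> * x + \<kappa> * (\<zeta> - c))) \<partial>lborel \<partial>lborel \<partial>lborel)"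
    by (subst emeasure_N, simp) (intro nn_integral_cong, auto simp: C1_def A1_def w_def g_def indicator_def)
  have eC2: "emeasure N C2 = (\<integral>\<^sup>+x. \<integral>\<^sup>+y. \<integral>\<^sup>+\<zeta>. ennreal (f \<zeta> * indicator {0<..} \<zeta> * indicator {..r'\<^sup>2} (x\<^sup>2 + y\<^sup>2 + (\<zeta> - c')\<^sup>2) * indicator {r' - h'<..} (\<sigma> * x + (- \<kappa>) * (\<zeta> - c'))) \<partial>lborel \<partial>lborel \<partial>lborel)"
  proof -
    \<comment> \<open>Replacing \<open>x\<close> by \<open>s - x\<close> places the second centre
      above the origin and turns the axis towards the first centre into
      \<open>(\<sigma>, - \<kappa>)\<close>. The coordinate along this axis is
      \<open>d - w p\<close>.\<close>
    have w': "w p < r - h \<longleftrightarrow> r' - h' < \<sigma> * (s - fst (fst p)) + (- \<kappa>) * (snd p - c')" for p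
    proof -
      have "d * (\<sigma> * (s - fst (fst p)) + (- \<kappa>) * (snd p - c'))
        = (d * \<sigma>) * (s - fst (fst p)) - (d * \<kappa>) * (snd p - c')"
        by (simp add: algebra_simps)
      also have "\<dots> = s * (s - fst (fst p)) - (c' - c) * (snd p - c')"
        using d by (simp add: \<sigma>_def \<kappa>_def)
      also have "\<dots> = d\<^sup>2 - d * w p" unfolding dw d2 by (simp add: power2_eq_square algebra_simps)
      finally have "d * (\<sigma> * (s - fst (fst p)) + (- \<kappa>) * (snd p - c')) = d * (d - w p)"
        by (simp add: power2_eq_square right_diff_distrib)
      then have "\<sigma> * (s - fst (fst p)) + (- \<kappa>) * (snd p - c') = d - w p" using d by simp
      then show ?thesis using tt by auto
    qed
    have "emeasure N C2 = (\<integral>\<^sup>+x. \<integral>\<^sup>+y. \<integral>\<^sup>+\<zeta>. ennreal (f \<zeta> * indicator {0<..} \<zeta> * indicator {..r'\<^sup>2} ((s - x)\<^sup>2 + y\<^sup>2 + (\<zeta> - c')\<^sup>2) * indicator {r' - h'<..} (\<sigma> * (s - x) + (- \<kappa>) * (\<zeta> - c'))) \<partial>lborel \<partial>lborel \<partial>lborel)"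
      by (subst emeasure_N, simp) (intro nn_integral_cong, auto simp: C2_def A2_def w' g_def indicator_def)
    also have "\<dots> = (\<integral>\<^sup>+x. \<integral>\<^sup>+y. \<integral>\<^sup>+\<zeta>. ennreal (f \<zeta> * indicator {0<..} \<zeta> * indicator {..r'\<^sup>2} (x\<^sup>2 + y\<^sup>2 + (\<zeta> - c')\<^sup>2) * indicator {r' - h'<..} (\<sigma> * x + (- \<kappa>) * (\<zeta> - c'))) \<partial>lborel \<partial>lborel \<partial>lborel)"
      by (subst nn_integral_real_affine[where c="-1" and t=s]) auto
    finally show ?thesis .
  qed
  have finB: "emeasure N B1 < \<infinity>" "emeasure N B2 < \<infinity>"
    unfolding eB1 eB2 by (intro LBINT_ball(2) f_meas f_nonneg rc fin_g; assumption)+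
  have mB: "measure N B1 = pi * (LBINT w=-r..r. f (w + c) * (r\<^sup>2 - w\<^sup>2))"
    "measure N B2 = pi * (LBINT w=-r'..r'. f (w + c') * (r'\<^sup>2 - w\<^sup>2))"
    unfolding measure_def eB1 eB2 by (intro LBINT_ball(1)[symmetric] f_meas f_nonneg rc fin_g; assumption)+
  have finC: "emeasure N C1 < \<infinity>" "emeasure N C2 < \<infinity>"
  proof -
    have "C1 \<subseteq> B1" "C2 \<subseteq> B2" by (auto simp: C1_def B1_def C2_def B2_def)
    then have "emeasure N C1 \<le> emeasure N B1" "emeasure N C2 \<le> emeasure N B2"
      using setsN by (auto intro!: emeasure_mono)
    then show "emeasure N C1 < \<infinity>" "emeasure N C2 < \<infinity>" using finB le_less_trans by blast+
  qed
  have mC1: "measure N C1 = (LBINT w=r-h..r. (LBINT \<theta>=0..2*pi. (LBINT \<rho>=0..sqrt (r\<^sup>2 - w\<^sup>2). f (c + w * \<kappa> - \<rho> * cos \<theta> * \<sigma>) * \<rho>)))"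
    unfolding measure_def eC1
    by (rule LBINT_cap[symmetric, OF f_meas f_nonneg unit rc(1,2) t_ge(1)]) (use h_nonneg finC eC1 in auto)
  have mC2: "measure N C2 = (LBINT w=r'-h'..r'. (LBINT \<theta>=0..2*pi. (LBINT \<rho>=0..sqrt (r'\<^sup>2 - w\<^sup>2). f (c' + w * (- \<kappa>) - \<rho> * cos \<theta> * \<sigma>) * \<rho>)))"
    unfolding measure_def eC2
    by (rule LBINT_cap[symmetric, OF f_meas f_nonneg unit' rc(3,4) t_ge(2)]) (use h_nonneg finC eC2 in auto)
  have fm: "B1 \<in> fmeasurable N" "B2 \<in> fmeasurable N" "C1 \<in> fmeasurable N" "C2 \<in> fmeasurable N"
    using finB finC setsN by (auto intro!: fmeasurableI)
  have "measure N (B1 \<union> B2) = measure N B1 + measure N B2 - measure N (B1 \<inter> B2)"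
    using fm by (intro measure_Un3) auto
  also have "measure N (B1 \<inter> B2) = measure N C1 + measure N C2"
    unfolding B12(1) using fm B12(2) by (intro measure_Un_AE) auto
  finally have mK: "measure N (Kset ((0, 0), z) ((s, 0), z')) = measure N B1 + measure N B2 - measure N C1 - measure N C2"
    unfolding K by simp
  have cs: "cos (pi / 2 - arcsin \<kappa>) = \<kappa>" "sin (pi / 2 - arcsin \<kappa>) = \<sigma>"
    "cos (pi / 2 - arcsin (- \<kappa>)) = - \<kappa>" "sin (pi / 2 - arcsin (- \<kappa>)) = \<sigma>"
    using \<kappa> by (auto simp: cos_add sin_add cos_diff sin_diff cos_arcsin \<sigma>_eq arcsin_minus)
  have \<kappa>': "(c - c') / d = - \<kappa>" by (simp add: \<kappa>_def minus_divide_left)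
  have "Fun_F f s z z' = measure N B1 + measure N B2 - measure N C1 - measure N C2"
    unfolding Fun_F_def Let_def q_R cosh_arcosh_real[OF less_imp_le[OF q1]] sinh_arcosh_real[OF less_imp_le[OF q1]]
      S_def[symmetric] d_def[symmetric] r_def[symmetric] r'_def[symmetric] c_def[symmetric] c'_def[symmetric]
      h_def[symmetric] h'_def[symmetric] \<kappa>' \<kappa>_def[symmetric] cs mB mC1 mC2 ..
  then show "measure N (Kset ((0, 0), z) ((s, 0), z')) = Fun_F f s z z'"
    using mK by simp
qed

end

section \<open>Comparison of hyperbolic distances; horizontal extent and symmetry of
  \<open>Kset\<close>\<close>

lemma near_left: "0 < snd a \<Longrightarrow> 0 < snd b \<Longrightarrow> near a b a"
proof -
  assume a: "0 < snd a" and b: "0 < snd b"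
  have "2 * snd a * snd b \<le> (snd a)\<^sup>2 + (snd b)\<^sup>2" using sum_squares_bound[of "snd a" "snd b"] by simp
  then have "2 * snd a * snd b \<le> (dist (fst a) (fst b))\<^sup>2 + (snd a)\<^sup>2 + (snd b)\<^sup>2"
    using zero_le_power2[of "dist (fst a) (fst b)"] by linarith
  then have "(2 * snd a * snd b) * snd a \<le> ((dist (fst a) (fst b))\<^sup>2 + (snd a)\<^sup>2 + (snd b)\<^sup>2) * snd a"
    using a by (intro mult_right_mono) auto
  then show ?thesis by (simp add: near_def power2_eq_square algebra_simps)
qed

lemma Kset_left: "0 < snd a \<Longrightarrow> 0 < snd b \<Longrightarrow> a \<in> Kset a b"
  by (simp add: Kset_def near_left)

lemma Kset_right: "0 < snd a \<Longrightarrow> 0 < snd b \<Longrightarrow> b \<in> Kset a b"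
  by (simp add: Kset_def near_left)

text \<open>\<open>arcosh\<close> is strictly increasing from \<open>1\<close> on, and the arguments
  in \<open>dH\<close> are at least \<open>1\<close> by the inequality between the arithmetic and
  geometric means of the heights.\<close>

lemma dH_less_iff:
  assumes a: "0 < snd a" and b: "0 < snd b" and c: "0 < snd c"
  shows "dH a b < dH a c \<longleftrightarrow> \<not> near a b c"
proof -
  define u where "u = (\<lambda>b. (dist (fst a) (fst b))\<^sup>2 / (2 * snd a * snd b) + (snd a / snd b + snd b / snd a) / 2)"
  define Q where "Q = (\<lambda>b :: pt. (dist (fst a) (fst b))\<^sup>2 + (snd a)\<^sup>2 + (snd b)\<^sup>2)"
  have u: "u b = Q b / (2 * snd a * snd b)" if "0 < snd b" for b
    using a that by (simp add: u_def Q_def field_simps power2_eq_square)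
  have u1: "1 \<le> u b" if b: "0 < snd b" for b
  proof -
    have "2 * snd a * snd b \<le> (snd a)\<^sup>2 + (snd b)\<^sup>2" using sum_squares_bound[of "snd a" "snd b"] by simp
    then have "2 * snd a * snd b \<le> (dist (fst a) (fst b))\<^sup>2 + (snd a)\<^sup>2 + (snd b)\<^sup>2"
      using zero_le_power2[of "dist (fst a) (fst b)"] by linarith
    then show ?thesis unfolding u[OF b] Q_def using a b by simp
  qed
  have "dH a b = arcosh (u b)" for b by (simp add: dH_def u_def)
  then have "dH a b < dH a c \<longleftrightarrow> u b < u c"
    using arcosh_less_iff_real[OF u1[OF b] u1[OF c]] by simp
  also have "\<dots> \<longleftrightarrow> \<not> near a b c"
  proof -
    have "u b = (Q b * snd c) / (2 * snd a * snd b * snd c)" "u c = (Q c * snd b) / (2 * snd a * snd b * snd c)"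
      using a b c by (simp_all add: u)
    moreover have "0 < 2 * snd a * snd b * snd c" using a b c by simp
    ultimately have "u b < u c \<longleftrightarrow> Q b * snd c < Q c * snd b"
      by (simp only: divide_less_cancel) auto
    then show ?thesis by (auto simp: near_def Q_def not_le)
  qed
  finally show ?thesis .
qed

text \<open>The inequality \<open>u * snd c \<le> u\<^sup>2 + (snd c)\<^sup>2\<close> lets the
  unknown height of \<open>c\<close> cancel. What remains depends only on the heights and the
  distance of \<open>a\<close> and \<open>b\<close>, so it can be made locally uniform.\<close>

lemma near_dist_le:
  assumes a: "0 < snd a" and b: "0 < snd b" and n: "near a b c"
  shows "dist (fst a) (fst c) \<le> ((dist (fst a) (fst b))\<^sup>2 + (snd a)\<^sup>2 + (snd b)\<^sup>2) / snd b"
proof -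
  define u where "u = dist (fst a) (fst c)"
  define Q where "Q = (dist (fst a) (fst b))\<^sup>2 + (snd a)\<^sup>2 + (snd b)\<^sup>2"
  have Q: "Q > 0" using a by (simp add: Q_def add_nonneg_pos add_pos_nonneg)
  have u0: "0 \<le> u" by (simp add: u_def)
  have le: "(u\<^sup>2 + (snd a)\<^sup>2 + (snd c)\<^sup>2) * snd b \<le> Q * snd c"
    using n by (simp add: near_def u_def Q_def)
  have "0 < (u\<^sup>2 + (snd a)\<^sup>2 + (snd c)\<^sup>2) * snd b"
    using a b by (intro mult_pos_pos add_pos_nonneg add_nonneg_pos) auto
  with le Q have c: "0 < snd c" by (metis less_le_trans zero_less_mult_pos)
  have "u * snd c \<le> u\<^sup>2 + (snd c)\<^sup>2"
  proof -
    have "2 * u * snd c \<le> u\<^sup>2 + (snd c)\<^sup>2" by (rule sum_squares_bound)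
    moreover have "0 \<le> u * snd c" using u0 c by simp
    ultimately show ?thesis by linarith
  qed
  also have "\<dots> \<le> u\<^sup>2 + (snd a)\<^sup>2 + (snd c)\<^sup>2" by simp
  finally have "(u * snd c) * snd b \<le> (u\<^sup>2 + (snd a)\<^sup>2 + (snd c)\<^sup>2) * snd b"
    using b by (intro mult_right_mono) auto
  with le have "(u * snd b) * snd c \<le> Q * snd c" by (simp add: mult_ac)
  then have "u * snd b \<le> Q" using c by simp
  then show ?thesis using b by (simp add: u_def Q_def pos_le_divide_eq)
qed

text \<open>A cylinder of unlimited height is good enough: marks have a probability distribution, so
  the intensity of a cylinder is \<open>lam\<close> times the area of its base. The neighbourhoods
  hold heights within a factor \<open>2\<close> and projections within distance
  \<open>1\<close>.\<close>

lemma Kset_locally_bounded: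
  assumes a: "0 < snd a" and b: "0 < snd b"
  shows "\<exists>X Y R. open X \<and> open Y \<and> a \<in> X \<and> b \<in> Y \<and>
    closure (\<Union>a'\<in>X. \<Union>b'\<in>Y. Kset a' b') \<subseteq> cball (fst a) R \<times> UNIV"
proof -
  define N where "N = (\<lambda>a :: pt. ball (fst a) 1 \<times> {snd a / 2<..<2 * snd a})"
  define D where "D = dist (fst a) (fst b)"
  define Q where "Q = (D + 2)\<^sup>2 + (2 * snd a)\<^sup>2 + (2 * snd b)\<^sup>2"
  \<comment> \<open>The quotients bound the horizontal radii of the balls around \<open>b'\<close>
    and \<open>a'\<close>, respectively. \<open>D\<close> accounts for measuring from
    \<open>a\<close> when the ball is around \<open>b'\<close>, and \<open>1\<close> for moving the
    centre inside its neighbourhood.\<close>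
  define R where "R = Q / (snd a / 2) + Q / (snd b / 2) + D + 1"
  have op: "open (N c)" for c unfolding N_def by (intro open_Times) auto
  have mem: "c \<in> N c" if "0 < snd c" for c using that by (cases c) (auto simp: N_def)
  have Q0: "0 \<le> Q" by (simp add: Q_def)
  have "c \<in> cball (fst a) R \<times> UNIV" if a': "a' \<in> N a" and b': "b' \<in> N b" and c: "c \<in> Kset a' b'" for a' b' c
  proof -
    have d: "dist (fst a) (fst a') < 1" "dist (fst b) (fst b') < 1" using a' b' by (auto simp: N_def)
    have h: "snd a / 2 < snd a'" "snd a' < 2 * snd a" "snd b / 2 < snd b'" "snd b' < 2 * snd b"
      using a' b' by (auto simp: N_def)
    have pos: "0 < snd a'" "0 < snd b'" using h a b by linarith+
    have D': "dist (fst a') (fst b') \<le> D + 2"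
      using d dist_triangle[of "fst a'" "fst b'" "fst a"] dist_triangle[of "fst a" "fst b'" "fst b"]
      unfolding D_def by (simp add: dist_commute)
    have Q': "(dist (fst a') (fst b'))\<^sup>2 + (snd a')\<^sup>2 + (snd b')\<^sup>2 \<le> Q"
      unfolding Q_def using D' h pos by (intro add_mono power_mono) auto
    have bound: "q / v \<le> Q / (m / 2)" if "q \<le> Q" "m / 2 < v" "0 < m" for q v m
    proof -
      have "q / v \<le> Q / v" using that by (intro divide_right_mono) auto
      also have "\<dots> \<le> Q / (m / 2)" using that Q0 by (intro divide_left_mono) auto
      finally show ?thesis .
    qed
    from c have "near a' b' c \<or> near b' a' c" by (simp add: Kset_def)
    then have "dist (fst a) (fst c) \<le> R"
    proof
      assume "near a' b' c"
      from near_dist_le[OF pos this] have "dist (fst a') (fst c) \<le> Q / (snd b / 2)"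
        using bound[OF Q' h(3) b] by linarith
      moreover have "0 \<le> Q / (snd a / 2)" using Q0 a by simp
      moreover have "0 \<le> D" by (simp add: D_def)
      ultimately show ?thesis
        using d dist_triangle[of "fst a" "fst c" "fst a'"] unfolding R_def by linarith
    next
      assume n: "near b' a' c"
      have "(dist (fst b') (fst a'))\<^sup>2 + (snd b')\<^sup>2 + (snd a')\<^sup>2 \<le> Q" using Q' by (simp add: dist_commute add_ac)
      then have "dist (fst b') (fst c) \<le> Q / (snd a / 2)"
        using near_dist_le[OF pos(2,1) n] bound[OF _ h(1) a] by fastforce
      moreover have "0 \<le> Q / (snd b / 2)" using Q0 b by simp
      ultimately show ?thesis
        using d dist_triangle[of "fst a" "fst c" "fst b"] dist_triangle[of "fst b" "fst c" "fst b'"]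
        unfolding R_def D_def by linarith
    qed
    then show ?thesis by (cases c) auto
  qed
  then have "(\<Union>a'\<in>N a. \<Union>b'\<in>N b. Kset a' b') \<subseteq> cball (fst a) R \<times> UNIV" by auto
  then have "closure (\<Union>a'\<in>N a. \<Union>b'\<in>N b. Kset a' b') \<subseteq> cball (fst a) R \<times> UNIV"
    by (intro closure_minimal closed_Times) auto
  then show ?thesis using op mem a b by blast
qed

text \<open>\<open>near\<close> involves only heights and horizontal distances. A horizontal
  rotation taking the first axis to the unit vector \<open>(p, q)\<close>, followed by the
  translation by \<open>x\<close>, carries the model pair to the given one.\<close>

lemma Kset_isometry:
  assumes ab: "p\<^sup>2 + q\<^sup>2 = 1" and y: "fst y - fst x = s * p" "snd y - snd x = s * q"
  shows "(x + (p * fst v - q * snd v, q * fst v + p * snd v), \<zeta>) \<in> Kset (x, z) (y, z')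
      \<longleftrightarrow> (v, \<zeta>) \<in> Kset ((0, 0), z) ((s, 0), z')"
proof -
  let ?w = "x + (p * fst v - q * snd v, q * fst v + p * snd v)"
  have d2: "(dist u w)\<^sup>2 = (fst u - fst w)\<^sup>2 + (snd u - snd w)\<^sup>2" for u w :: "real \<times> real"
    by (simp add: dist_prod_def dist_real_def)
  have 1: "(dist x ?w)\<^sup>2 = (dist (0, 0) v)\<^sup>2"
  proof -
    have "(dist x ?w)\<^sup>2 = (p\<^sup>2 + q\<^sup>2) * ((fst v)\<^sup>2 + (snd v)\<^sup>2)"
      unfolding d2 by (simp add: power2_eq_square algebra_simps)
    then show ?thesis unfolding ab d2 by simp
  qed
  have 2: "(dist y ?w)\<^sup>2 = (dist (s, 0) v)\<^sup>2"
  proof -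
    have e: "fst y - fst ?w = s * p - (p * fst v - q * snd v)" "snd y - snd ?w = s * q - (q * fst v + p * snd v)"
      using y by simp_all
    have "(dist y ?w)\<^sup>2 = (p\<^sup>2 + q\<^sup>2) * ((s - fst v)\<^sup>2 + (snd v)\<^sup>2)"
      unfolding d2 e by (simp add: power2_eq_square algebra_simps)
    then show ?thesis unfolding ab d2 by simp
  qed
  have 3: "(dist x y)\<^sup>2 = (dist (0, 0) (s, 0 :: real))\<^sup>2"
  proof -
    have "(dist x y)\<^sup>2 = (fst y - fst x)\<^sup>2 + (snd y - snd x)\<^sup>2"
      unfolding d2 by (simp add: power2_commute)
    also have "\<dots> = (p\<^sup>2 + q\<^sup>2) * s\<^sup>2" unfolding y by (simp add: power2_eq_square algebra_simps)
    finally show ?thesis unfolding ab d2 by simp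
  qed
  show "(?w, \<zeta>) \<in> Kset (x, z) (y, z') \<longleftrightarrow> (v, \<zeta>) \<in> Kset ((0, 0), z) ((s, 0), z')"
    unfolding Kset_def near_def mem_Collect_eq fst_conv snd_conv dist_commute[of y x] dist_commute[of "(s, 0)" "(0, 0)"] 1 2 3 ..
qed

context mark_density
begin

lemma emeasure_Kset_isometry:
  "emeasure N (Kset (x, z) (y, z')) = emeasure N (Kset ((0, 0), z) ((norm (y - x), 0), z'))"
proof -
  define s where "s = norm (y - x)"
  \<comment> \<open>For \<open>y = x\<close> any direction will do; the heights may still
    differ.\<close>
  obtain p q where pq: "p\<^sup>2 + q\<^sup>2 = (1::real)" "fst y - fst x = s * p" "snd y - snd x = s * q"
  proof (cases "s = 0")
    case True
    then have "y = x" by (simp add: s_def)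
    then show ?thesis using that[of 1 0] True by simp
  next
    case False
    have "s\<^sup>2 = (fst y - fst x)\<^sup>2 + (snd y - snd x)\<^sup>2" by (simp add: s_def norm_prod_def)
    then have "((fst y - fst x) / s)\<^sup>2 + ((snd y - snd x) / s)\<^sup>2 = s\<^sup>2 / s\<^sup>2"
      by (simp only: power_divide add_divide_distrib)
    also have "\<dots> = 1" using False by simp
    finally have "((fst y - fst x) / s)\<^sup>2 + ((snd y - snd x) / s)\<^sup>2 = 1" .
    then show ?thesis using that[of "(fst y - fst x) / s" "(snd y - snd x) / s"] False by simp
  qed
  let ?h = "\<lambda>S v. \<integral>\<^sup>+\<zeta>. indicator S (v, \<zeta>) \<partial>mark_measure f"
  have eN: "emeasure N S = (\<integral>\<^sup>+v. ?h S v \<partial>(lborel \<Otimes>\<^sub>M lborel))"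
    and hm: "?h S \<in> borel_measurable (borel \<Otimes>\<^sub>M borel)" if S: "S \<in> sets borel" for S
  proof -
    have SN: "S \<in> sets N" using S unfolding sets_N .
    then have "indicator S \<in> borel_measurable N" by simp
    from mark.nn_integral_fst[OF this] SN
    show "emeasure N S = (\<integral>\<^sup>+v. ?h S v \<partial>(lborel \<Otimes>\<^sub>M lborel))" by simp
    have "sets ((borel \<Otimes>\<^sub>M borel) \<Otimes>\<^sub>M mark_measure f) = sets N"
      by (intro sets_pair_measure_cong) auto
    then have "(\<lambda>(v, \<zeta>). indicator S (v, \<zeta>) :: ennreal) \<in> borel_measurable ((borel \<Otimes>\<^sub>M borel) \<Otimes>\<^sub>M mark_measure f)"
      using SN by simp
    then show "?h S \<in> borel_measurable (borel \<Otimes>\<^sub>M borel)" by (rule mark.borel_measurable_nn_integral)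
  qed
  let ?S = "Kset (x, z) (y, z')"
  have hb: "?h ?S \<in> borel_measurable borel" using hm[OF Kset_borel] by (simp add: borel_prod)
  have hx: "(\<lambda>v. ?h ?S (x + v)) \<in> borel_measurable (borel \<Otimes>\<^sub>M borel)"
    unfolding borel_prod by (rule measurable_compose[OF _ hb]) simp
  have "emeasure N ?S = (\<integral>\<^sup>+v. ?h ?S v \<partial>(lborel \<Otimes>\<^sub>M lborel))" by (rule eN[OF Kset_borel])
  also have "\<dots> = (\<integral>\<^sup>+v. ?h ?S (x + v) \<partial>(lborel \<Otimes>\<^sub>M lborel))"
    unfolding lborel_prod by (rule nn_integral_lborel_translate[OF hb, symmetric])
  also have "\<dots> = (\<integral>\<^sup>+v. ?h ?S (x + (p * fst v - q * snd v, q * fst v + p * snd v)) \<partial>(lborel \<Otimes>\<^sub>M lborel))"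
    by (rule nn_integral_lborel_rotate[symmetric, OF hx pq(1)])
  also have "\<dots> = (\<integral>\<^sup>+v. ?h (Kset ((0, 0), z) ((s, 0), z')) v \<partial>(lborel \<Otimes>\<^sub>M lborel))"
    by (simp add: indicator_def Kset_isometry[OF pq])
  also have "\<dots> = emeasure N (Kset ((0, 0), z) ((s, 0), z'))"
    by (rule eN[OF Kset_borel, symmetric])
  finally show ?thesis by (simp add: s_def)
qed

end

section \<open>Expected number of isolated pairs of a Poisson process\<close>

text \<open>This keeps of the geometry only what the counting needs: a closed graph, the endpoints
  inside \<open>K a b\<close>, and local finiteness. \<open>H\<close> stands for the half space, and
  \<open>W\<close> enumerates a countable base from which the cells are formed.\<close>

locale poisson_void =
  fixes M :: "'w measure" and \<Phi> :: "'w \<Rightarrow> 'p::{second_countable_topology,t2_space} set"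
    and \<mu> :: "'p measure" and K :: "'p \<Rightarrow> 'p \<Rightarrow> 'p set" and H :: "'p set"
    and W :: "nat \<Rightarrow> 'p set"
  assumes pp: "poisson_pp M \<Phi> \<mu>"
    and sets_mu [measurable_cong]: "sets \<mu> = sets borel"
    and sigma_finite_mu: "sigma_finite_measure \<mu>"
    and closed_graph: "closed {(a, b, c). c \<in> K a b}"
    and K_left: "\<And>a b. a \<in> H \<Longrightarrow> b \<in> H \<Longrightarrow> a \<in> K a b"
    and K_right: "\<And>a b. a \<in> H \<Longrightarrow> b \<in> H \<Longrightarrow> b \<in> K a b"
    and H_borel [measurable]: "H \<in> sets borel"
    and K_locally_finite: "\<And>a b. a \<in> H \<Longrightarrow> b \<in> H \<Longrightarrow> \<exists>X Y. open X \<and> open Y \<and> a \<in> X \<and> b \<in> Y \<and>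
        emeasure \<mu> (closure (\<Union>a'\<in>X. \<Union>b'\<in>Y. K a' b')) < \<infinity>"
    and basis: "topological_basis (range W)"
begin

sublocale M: prob_space M
  using pp by (simp add: poisson_pp_def)

sublocale mu: sigma_finite_measure \<mu>
  by (rule sigma_finite_mu)

lemma space_mu [simp]: "space \<mu> = UNIV"
  using sets_eq_imp_space_eq[OF sets_mu] by simp

text \<open>An address of \<open>a\<close>: the sets with equal address are the atoms of the algebra
  generated by the first \<open>n\<close> base sets. They refine as \<open>n\<close> grows and
  eventually enter every neighbourhood of \<open>a\<close>.\<close>

definition code :: "nat \<Rightarrow> 'p \<Rightarrow> nat set" where
  "code n a = {k. k < n \<and> a \<in> W k}"

definition cell :: "nat \<Rightarrow> nat set \<Rightarrow> 'p set" where
  "cell n S = {a. code n a = S}"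

text \<open>The union may run over uncountably many pairs; the closure makes it Borel without adding
  anything in the limit, see \<open>Inter_khull\<close>.\<close>

definition khull :: "nat \<Rightarrow> nat set \<Rightarrow> nat set \<Rightarrow> 'p set" where
  "khull n S T = closure (\<Union>a\<in>cell n S. \<Union>b\<in>cell n T. K a b)"

definition good :: "nat \<Rightarrow> nat set \<Rightarrow> nat set \<Rightarrow> bool" where
  "good n S T \<longleftrightarrow> emeasure \<mu> (khull n S T) < \<infinity>"

definition idx :: "(nat \<times> nat set \<times> nat set) set" where
  "idx = (SIGMA n:UNIV. Pow {..<n} \<times> Pow {..<n})"

text \<open>An event of probability one on which every hull of finite measure contains finitely many points.
  Counts are multiplied by its indicator because they need not be measurable on the exceptional null
  set, on which \<open>card\<close> of an infinite set is \<open>0\<close>.\<close>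

definition reg :: "'w set" where
  "reg = (SOME G. G \<in> sets M \<and> emeasure M (space M - G) = 0 \<and>
     (\<forall>\<omega>\<in>G. \<forall>(n, S, T)\<in>idx. good n S T \<longrightarrow> finite (\<Phi> \<omega> \<inter> khull n S T)))"

definition npairs :: "('p \<times> 'p) set \<Rightarrow> 'w \<Rightarrow> ennreal" where
  "npairs E \<omega> = emeasure (count_space UNIV)
     {(a, b). (a, b) \<in> E \<and> a \<in> \<Phi> \<omega> \<and> b \<in> \<Phi> \<omega> \<and> \<Phi> \<omega> \<inter> K a b \<subseteq> {a, b}}"

lemma open_W: "open (W k)"
  using basis by (simp add: topological_basis_open)

lemma code_subset [simp]: "code n a \<subseteq> {..<n}"
  by (auto simp: code_def)

lemma in_cell_code [simp]: "a \<in> cell n (code n a)"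
  by (simp add: cell_def)

lemma in_cell_code_iff: "a' \<in> cell n (code n a) \<longleftrightarrow> (\<forall>k<n. a' \<in> W k \<longleftrightarrow> a \<in> W k)"
  unfolding cell_def code_def set_eq_iff mem_Collect_eq by blast

lemma cell_borel [measurable]: "cell n S \<in> sets borel"
proof -
  have "cell n S = (if S \<subseteq> {..<n} then (\<Inter>k\<in>{..<n}. if k \<in> S then W k else - W k) else {})"
    unfolding cell_def code_def set_eq_iff mem_Collect_eq by (auto split: if_splits)
  moreover have "(if k \<in> S then W k else - W k) \<in> sets borel" for k
    using borel_open[OF open_W[of k]] by auto
  then have "(\<Inter>k\<in>{..<n}. if k \<in> S then W k else - W k) \<in> sets borel"
    by (cases "n = 0") (simp, intro sets.finite_INT, auto)
  ultimately show ?thesis by simp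
qed

lemma khull_borel [measurable]: "khull n S T \<in> sets borel"
  by (simp add: khull_def)

lemma cell_code_antimono: "m \<le> n \<Longrightarrow> cell n (code n a) \<subseteq> cell m (code m a)"
  by (auto simp: in_cell_code_iff)

lemma khull_code_antimono: "m \<le> n \<Longrightarrow> khull n (code n a) (code n b) \<subseteq> khull m (code m a) (code m b)"
  unfolding khull_def
  by (intro closure_mono UN_mono cell_code_antimono) auto

lemma good_code_mono: "m \<le> n \<Longrightarrow> good m (code m a) (code m b) \<Longrightarrow> good n (code n a) (code n b)"
  unfolding good_def
  by (rule le_less_trans[OF emeasure_mono[OF khull_code_antimono]]) (auto simp: sets_mu)

lemma eventually_cell_subset:
  assumes "open X" "a \<in> X"
  shows "\<forall>\<^sub>F n in sequentially. cell n (code n a) \<subseteq> X"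
proof -
  obtain k where k: "a \<in> W k" "W k \<subseteq> X"
    using topological_basisE[OF basis assms] by auto
  have "cell n (code n a) \<subseteq> X" if "n > k" for n
    using k that by (auto simp: in_cell_code_iff)
  then show ?thesis
    unfolding eventually_sequentially by (meson Suc_le_lessD)
qed

lemma K_subset_khull: "K a b \<subseteq> khull n (code n a) (code n b)"
  unfolding khull_def by (rule order_trans[OF _ closure_subset]) (use in_cell_code in blast)

text \<open>If \<open>c \<notin> K a b\<close>, the closed graph leaves neighbourhoods
  \<open>X\<close>, \<open>Y\<close>, \<open>Z\<close> of \<open>a\<close>, \<open>b\<close>,
  \<open>c\<close> such that no point of \<open>Z\<close> lies in a set \<open>K a' b'\<close> with
  \<open>a'\<close> in \<open>X\<close> and \<open>b'\<close> in \<open>Y\<close>. Once the cells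
  lie in \<open>X\<close> and \<open>Y\<close>, the open set \<open>Z\<close> misses the union and
  thus its closure.\<close>

lemma Inter_khull: "(\<Inter>n. khull n (code n a) (code n b)) = K a b"
proof (intro antisym subsetI)
  fix c assume c: "c \<in> (\<Inter>n. khull n (code n a) (code n b))"
  show "c \<in> K a b"
  proof (rule ccontr)
    assume "c \<notin> K a b"
    then have "(a, b, c) \<in> - {(a, b, c). c \<in> K a b}" by simp
    with closed_graph obtain X YZ where X: "open X" "a \<in> X" "open YZ" "(b, c) \<in> YZ"
      and sub: "X \<times> YZ \<subseteq> - {(a, b, c). c \<in> K a b}"
      by (metis open_Compl open_prod_elim mem_Sigma_iff)
    from X obtain Y Z where Y: "open Y" "b \<in> Y" and Z: "open Z" "c \<in> Z" "Y \<times> Z \<subseteq> YZ"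
      by (metis open_prod_elim mem_Sigma_iff)
    have "\<forall>\<^sub>F n in sequentially. cell n (code n a) \<subseteq> X \<and> cell n (code n b) \<subseteq> Y"
      using X Y by (intro eventually_conj eventually_cell_subset) auto
    then obtain n where n: "cell n (code n a) \<subseteq> X" "cell n (code n b) \<subseteq> Y"
      by (auto simp: eventually_sequentially)
    have "Z \<inter> (\<Union>a'\<in>cell n (code n a). \<Union>b'\<in>cell n (code n b). K a' b') = {}"
      using n sub Z by fastforce
    then have "Z \<inter> khull n (code n a) (code n b) = {}"
      using Z by (simp add: khull_def open_Int_closure_eq_empty)
    with c Z show False by auto
  qed
qed (use K_subset_khull in auto)

lemma ex_good:
  assumes "a \<in> H" "b \<in> H"
  shows "\<exists>n. good n (code n a) (code n b)"
proof -
  obtain X Y where XY: "open X" "open Y" "a \<in> X" "b \<in> Y"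
    and fin: "emeasure \<mu> (closure (\<Union>a'\<in>X. \<Union>b'\<in>Y. K a' b')) < \<infinity>"
    using K_locally_finite[OF assms] by auto
  have "\<forall>\<^sub>F n in sequentially. cell n (code n a) \<subseteq> X \<and> cell n (code n b) \<subseteq> Y"
    using XY by (intro eventually_conj eventually_cell_subset) auto
  then obtain n where n: "cell n (code n a) \<subseteq> X" "cell n (code n b) \<subseteq> Y"
    by (auto simp: eventually_sequentially)
  have "khull n (code n a) (code n b) \<subseteq> closure (\<Union>a'\<in>X. \<Union>b'\<in>Y. K a' b')"
    unfolding khull_def using n by (intro closure_mono UN_mono) auto
  then have "emeasure \<mu> (khull n (code n a) (code n b)) \<le> emeasure \<mu> (closure (\<Union>a'\<in>X. \<Union>b'\<in>Y. K a' b'))"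
    by (intro emeasure_mono) (auto simp: sets_mu)
  with fin show ?thesis
    unfolding good_def by (meson le_less_trans)
qed

lemma countable_idx: "countable idx"
  unfolding idx_def by (intro countable_SIGMA) (auto intro: countable_finite)

text \<open>The choice behind \<open>reg\<close> succeeds because there are only countably many
  hulls, each of which, if of finite measure, almost surely contains finitely many points.\<close>

lemma reg_props:
  "reg \<in> sets M" "emeasure M (space M - reg) = 0"
  "\<And>\<omega> n S T. \<omega> \<in> reg \<Longrightarrow> S \<subseteq> {..<n} \<Longrightarrow> T \<subseteq> {..<n} \<Longrightarrow> good n S T \<Longrightarrow> finite (\<Phi> \<omega> \<inter> khull n S T)"
proof -
  have "AE \<omega> in M. \<forall>i\<in>idx. case i of (n, S, T) \<Rightarrow> good n S T \<longrightarrow> finite (\<Phi> \<omega> \<inter> khull n S T)"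
    unfolding AE_ball_countable[OF countable_idx]
    using pp by (auto simp: poisson_pp_def good_def sets_mu split: prod.splits)
  then obtain N where N: "N \<in> null_sets M"
    "{\<omega>\<in>space M. \<not> (\<forall>i\<in>idx. case i of (n, S, T) \<Rightarrow> good n S T \<longrightarrow> finite (\<Phi> \<omega> \<inter> khull n S T))} \<subseteq> N"
    unfolding eventually_ae_filter by blast
  let ?P = "\<lambda>G. G \<in> sets M \<and> emeasure M (space M - G) = 0 \<and>
     (\<forall>\<omega>\<in>G. \<forall>(n, S, T)\<in>idx. good n S T \<longrightarrow> finite (\<Phi> \<omega> \<inter> khull n S T))"
  have "?P (space M - N)"
  proof (intro conjI)
    have "space M - (space M - N) = N" using N(1) by (auto dest: sets.sets_into_space)
    then show "emeasure M (space M - (space M - N)) = 0" using N by auto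
    show "\<forall>\<omega>\<in>space M - N. \<forall>(n, S, T)\<in>idx. good n S T \<longrightarrow> finite (\<Phi> \<omega> \<inter> khull n S T)"
      using N(2) by blast
  qed (use N in auto)
  then have *: "?P reg" unfolding reg_def by (rule someI)
  then show "reg \<in> sets M" "emeasure M (space M - reg) = 0" by auto
  show "finite (\<Phi> \<omega> \<inter> khull n S T)"
    if "\<omega> \<in> reg" "S \<subseteq> {..<n}" "T \<subseteq> {..<n}" "good n S T" for \<omega> n S T
    using * that unfolding idx_def by auto
qed

lemma reg_space: "\<omega> \<in> reg \<Longrightarrow> \<omega> \<in> space M"
  using reg_props(1) sets.sets_into_space by blast

lemma AE_reg: "AE \<omega> in M. \<omega> \<in> reg"
  using reg_props(1,2) by (intro AE_I[of _ _ "space M - reg"]) auto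

lemma card_measurable:
  "X \<in> sets borel \<Longrightarrow> emeasure \<mu> X < \<infinity> \<Longrightarrow> (\<lambda>\<omega>. card (\<Phi> \<omega> \<inter> X)) \<in> measurable M (count_space UNIV)"
  using pp by (auto simp: poisson_pp_def sets_mu)

lemma prob_card:
  "X \<in> sets borel \<Longrightarrow> emeasure \<mu> X < \<infinity> \<Longrightarrow>
    measure M {\<omega>\<in>space M. card (\<Phi> \<omega> \<inter> X) = k} = measure \<mu> X ^ k / fact k * exp (- measure \<mu> X)"
  using pp by (auto simp: poisson_pp_def sets_mu)

lemma prob_three:
  assumes X: "X \<in> sets borel" "Y \<in> sets borel" "Z \<in> sets borel"
    and fin: "emeasure \<mu> X < \<infinity>" "emeasure \<mu> Y < \<infinity>" "emeasure \<mu> Z < \<infinity>"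
    and disj: "X \<inter> Y = {}" "X \<inter> Z = {}" "Y \<inter> Z = {}"
  shows "measure M {\<omega>\<in>space M. card (\<Phi> \<omega> \<inter> X) = 1 \<and> card (\<Phi> \<omega> \<inter> Y) = 1 \<and> card (\<Phi> \<omega> \<inter> Z) = 0}
    = measure \<mu> X * measure \<mu> Y * exp (- (measure \<mu> X + measure \<mu> Y + measure \<mu> Z))"
proof -
  define C where "C = (\<lambda>i::nat. if i = 0 then X else if i = 1 then Y else Z)"
  define A where "A = (\<lambda>i::nat. if i = 2 then {0::nat} else {1})"
  have ind: "M.indep_vars (\<lambda>_. count_space UNIV) (\<lambda>i \<omega>. card (\<Phi> \<omega> \<inter> C i)) {0,1,2}"
    using pp X fin disj unfolding poisson_pp_def
    by (intro conjunct2[OF conjunct2[OF conjunct2[OF pp[unfolded poisson_pp_def]]], rule_format])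
       (auto simp: C_def sets_mu disjoint_family_on_def)
  have "{\<omega>\<in>space M. card (\<Phi> \<omega> \<inter> X) = 1 \<and> card (\<Phi> \<omega> \<inter> Y) = 1 \<and> card (\<Phi> \<omega> \<inter> Z) = 0}
     = (\<Inter>i\<in>{0,1,2}. (\<lambda>\<omega>. card (\<Phi> \<omega> \<inter> C i)) -` A i \<inter> space M)"
    by (auto simp: C_def A_def)
  also have "measure M \<dots> = (\<Prod>i\<in>{0,1,2}. measure M ((\<lambda>\<omega>. card (\<Phi> \<omega> \<inter> C i)) -` A i \<inter> space M))"
    by (rule M.indep_varsD[OF ind]) auto
  also have "\<dots> = measure M {\<omega>\<in>space M. card (\<Phi> \<omega> \<inter> X) = 1} * measure M {\<omega>\<in>space M. card (\<Phi> \<omega> \<inter> Y) = 1}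
      * measure M {\<omega>\<in>space M. card (\<Phi> \<omega> \<inter> Z) = 0}"
    by (simp add: C_def A_def vimage_def Int_def conj_commute mult.assoc)
  also have "\<dots> = measure \<mu> X * measure \<mu> Y * exp (- (measure \<mu> X + measure \<mu> Y + measure \<mu> Z))"
    unfolding prob_card[OF X(1) fin(1)] prob_card[OF X(2) fin(2)] prob_card[OF X(3) fin(3)]
    by (simp add: exp_diff exp_minus exp_add field_simps)
  finally show ?thesis .
qed


text \<open>The case distinction matters: \<open>measure\<close> of a set of infinite measure is
  \<open>0\<close>, and the exponential would then be \<open>1\<close> instead of
  \<open>0\<close>.\<close>

definition ker :: "nat \<Rightarrow> nat set \<Rightarrow> nat set \<Rightarrow> ennreal" where
  "ker n S T = (if good n S T then ennreal (exp (- measure \<mu> (khull n S T))) else 0)"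

text \<open>Removing the two pieces from the hull in the last condition makes the three counted sets
  disjoint when \<open>U\<close> and \<open>V\<close> are, so \<open>prob_three\<close>
  applies.\<close>

definition isolated :: "'p set \<Rightarrow> 'p set \<Rightarrow> nat \<Rightarrow> nat set \<Rightarrow> nat set \<Rightarrow> 'w \<Rightarrow> bool" where
  "isolated U V n S T \<omega> \<longleftrightarrow> good n S T \<and> card (\<Phi> \<omega> \<inter> (U \<inter> cell n S)) = 1 \<and>
     card (\<Phi> \<omega> \<inter> (V \<inter> cell n T)) = 1 \<and>
     card (\<Phi> \<omega> \<inter> (khull n S T - (U \<inter> cell n S \<union> V \<inter> cell n T))) = 0"

lemma ker_mono: "m \<le> n \<Longrightarrow> ker m (code m a) (code m b) \<le> ker n (code n a) (code n b)"
  using good_code_mono[of m n a b] khull_code_antimono[of m n a b]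
  by (auto simp: ker_def good_def sets_mu intro!: measure_mono_fmeasurable fmeasurableI)

text \<open>Continuity from above needs hulls of finite measure, hence the shift of the index to a
  level \<open>m\<close> that is already good.\<close>

lemma ker_LIMSEQ:
  assumes "a \<in> H" "b \<in> H"
  shows "(\<lambda>n. ker n (code n a) (code n b)) \<longlonglongrightarrow> ennreal (exp (- measure \<mu> (K a b)))"
proof -
  obtain m where m: "good m (code m a) (code m b)" using ex_good[OF assms] by auto
  have g: "good (n + m) (code (n + m) a) (code (n + m) b)" for n
    using good_code_mono[OF _ m] by simp
  let ?A = "\<lambda>n. khull (n + m) (code (n + m) a) (code (n + m) b)"
  have "(\<lambda>n. measure \<mu> (?A n)) \<longlonglongrightarrow> measure \<mu> (\<Inter>n. ?A n)"
  proof (rule Lim_measure_decseq)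
    show "decseq ?A" by (auto intro!: decseq_SucI khull_code_antimono)
  qed (use g in \<open>auto simp: sets_mu good_def less_top\<close>)
  moreover have "(\<Inter>n. ?A n) = K a b"
  proof (intro antisym subsetI)
    fix x assume x: "x \<in> (\<Inter>n. ?A n)"
    have "x \<in> khull n (code n a) (code n b)" for n
      using x khull_code_antimono[of n "n + m" a b] by auto
    then show "x \<in> K a b" using Inter_khull[of a b] by blast
  qed (use Inter_khull[of a b] in blast)
  ultimately have "(\<lambda>n. ker (n + m) (code (n + m) a) (code (n + m) b)) \<longlonglongrightarrow> ennreal (exp (- measure \<mu> (K a b)))"
    using g by (simp add: ker_def) (intro tendsto_intros)
  then show ?thesis by (rule LIMSEQ_offset)
qed

text \<open>The graph is closed, hence in the product sigma-algebra, and the measures of its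
  sections depend measurably on the base point.\<close>

lemma measure_K_measurable [measurable]:
  "(\<lambda>p. measure \<mu> (K (fst p) (snd p))) \<in> borel_measurable borel"
proof -
  define Q where "Q = {x :: ('p \<times> 'p) \<times> 'p. snd x \<in> K (fst (fst x)) (snd (fst x))}"
  have "closed Q"
  proof -
    have "Q = (\<lambda>x. (fst (fst x), snd (fst x), snd x)) -` {(a, b, c). c \<in> K a b}"
      by (auto simp: Q_def)
    moreover have "continuous_on UNIV (\<lambda>x :: ('p \<times> 'p) \<times> 'p. (fst (fst x), snd (fst x), snd x))"
      by (intro continuous_intros)
    ultimately show ?thesis by (simp only: closed_vimage[OF closed_graph])
  qed
  then have "Q \<in> sets borel" by simp
  moreover have "sets (borel \<Otimes>\<^sub>M \<mu>) = sets (borel :: (('p \<times> 'p) \<times> 'p) measure)"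
    by (subst sets_pair_measure_cong[OF refl sets_mu]) (rule arg_cong[OF borel_prod])
  ultimately have "Q \<in> sets (borel \<Otimes>\<^sub>M \<mu>)" by simp
  from mu.measurable_emeasure_Pair[OF this]
  have [measurable]: "(\<lambda>p. emeasure \<mu> (K (fst p) (snd p))) \<in> borel_measurable borel"
    by (simp add: Q_def vimage_def)
  show ?thesis unfolding measure_def by measurable
qed

definition dens :: "'p \<times> 'p \<Rightarrow> ennreal" where
  "dens p = ennreal (exp (- measure \<mu> (K (fst p) (snd p))))"

lemma sets_mu2: "sets (\<mu> \<Otimes>\<^sub>M \<mu>) = sets borel"
  by (simp add: borel_prod[symmetric] cong: sets_pair_measure_cong[OF sets_mu sets_mu])

lemma dens_measurable [measurable]: "dens \<in> borel_measurable (\<mu> \<Otimes>\<^sub>M \<mu>)"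
  unfolding measurable_cong_sets[OF sets_mu2 refl] dens_def by measurable

section \<open>Pairs in a product of two disjoint sets of finite measure\<close>

context
  fixes U V :: "'p set"
  assumes UV [measurable]: "U \<in> sets borel" "V \<in> sets borel"
    and UV_fin: "emeasure \<mu> U < \<infinity>" "emeasure \<mu> V < \<infinity>"
    and UV_disj: "U \<inter> V = {}" and UV_H: "U \<subseteq> H" "V \<subseteq> H"
    and UV_reg: "\<And>\<omega>. \<omega> \<in> reg \<Longrightarrow> finite (\<Phi> \<omega> \<inter> U)" "\<And>\<omega>. \<omega> \<in> reg \<Longrightarrow> finite (\<Phi> \<omega> \<inter> V)"
begin

text \<open>A point of one piece lies in the hull because \<open>K\<close> of it and any partner in
  the other piece contains it; therefore both pieces must be inhabited.\<close>

lemma cells_subset_khull: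
  assumes "a \<in> U \<inter> cell n S" "b \<in> V \<inter> cell n T"
  shows "U \<inter> cell n S \<union> V \<inter> cell n T \<subseteq> khull n S T"
proof -
  have "x \<in> khull n S T" if "x \<in> U \<inter> cell n S" for x
    using K_left[of x b] K_subset_khull[of x b n] that assms UV_H by (auto simp: cell_def)
  moreover have "x \<in> khull n S T" if "x \<in> V \<inter> cell n T" for x
    using K_right[of a x] K_subset_khull[of a x n] that assms UV_H by (auto simp: cell_def)
  ultimately show ?thesis by blast
qed

lemma fin_sub: "X \<subseteq> U \<Longrightarrow> X \<in> sets borel \<Longrightarrow> emeasure \<mu> X < \<infinity>" "X \<subseteq> V \<Longrightarrow> X \<in> sets borel \<Longrightarrow> emeasure \<mu> X < \<infinity>"
  using UV_fin emeasure_mono[of X U \<mu>] emeasure_mono[of X V \<mu>] by (auto simp: sets_mu)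

lemma isolated_sets [measurable]: "{\<omega>\<in>space M. isolated U V n S T \<omega>} \<in> sets M"
proof (cases "good n S T")
  case True
  have "emeasure \<mu> (khull n S T - (U \<inter> cell n S \<union> V \<inter> cell n T)) < \<infinity>"
    using True emeasure_mono[of "khull n S T - (U \<inter> cell n S \<union> V \<inter> cell n T)" "khull n S T" \<mu>]
    by (auto simp: good_def sets_mu)
  then have [measurable]:
    "(\<lambda>\<omega>. card (\<Phi> \<omega> \<inter> (U \<inter> cell n S))) \<in> measurable M (count_space UNIV)"
    "(\<lambda>\<omega>. card (\<Phi> \<omega> \<inter> (V \<inter> cell n T))) \<in> measurable M (count_space UNIV)"
    "(\<lambda>\<omega>. card (\<Phi> \<omega> \<inter> (khull n S T - (U \<inter> cell n S \<union> V \<inter> cell n T)))) \<in> measurable M (count_space UNIV)"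
    by (intro card_measurable fin_sub(1)[of "U \<inter> cell n S"] fin_sub(2)[of "V \<inter> cell n T"]; simp)+
  show ?thesis using True unfolding isolated_def by measurable
qed (simp add: isolated_def)

text \<open>If both pieces are inhabited, the hull is their disjoint union with the rest, so the
  three exponents of the Poisson probabilities add up to the measure of the hull. Otherwise both
  sides vanish.\<close>

lemma emeasure_isolated:
  "emeasure M {\<omega>\<in>space M. isolated U V n S T \<omega>}
    = emeasure \<mu> (U \<inter> cell n S) * emeasure \<mu> (V \<inter> cell n T) * ker n S T"
proof -
  let ?X = "U \<inter> cell n S" and ?Y = "V \<inter> cell n T"
  consider "\<not> good n S T" | "?X = {}" | "?Y = {}"
    | a b where "good n S T" "a \<in> ?X" "b \<in> ?Y" by blast
  then show ?thesis
  proof cases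
    case 4
    let ?Z = "khull n S T - (?X \<union> ?Y)"
    have finK: "emeasure \<mu> (khull n S T) < \<infinity>" using 4 by (simp add: good_def)
    have sub: "?X \<union> ?Y \<subseteq> khull n S T" using 4 by (intro cells_subset_khull)
    have finZ: "emeasure \<mu> ?Z < \<infinity>"
      using finK emeasure_mono[of ?Z "khull n S T" \<mu>] by (auto simp: sets_mu)
    have finX: "emeasure \<mu> ?X < \<infinity>" "emeasure \<mu> ?Y < \<infinity>"
      by (intro fin_sub(1)[of ?X] fin_sub(2)[of ?Y]; simp)+
    have disj: "?X \<inter> ?Y = {}" using UV_disj by auto
    have fm: "?X \<in> fmeasurable \<mu>" "?Y \<in> fmeasurable \<mu>" "?Z \<in> fmeasurable \<mu>"
      using finX finZ by (auto intro!: fmeasurableI simp: sets_mu)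
    have "khull n S T = (?X \<union> ?Y) \<union> ?Z" using sub by auto
    then have "measure \<mu> (khull n S T) = measure \<mu> ((?X \<union> ?Y) \<union> ?Z)" by simp
    also have "\<dots> = measure \<mu> ?X + measure \<mu> ?Y + measure \<mu> ?Z"
    proof -
      have "measure \<mu> ((?X \<union> ?Y) \<union> ?Z) = measure \<mu> (?X \<union> ?Y) + measure \<mu> ?Z"
        using fm by (intro measure_Un_AE fmeasurable.Un) auto
      moreover have "measure \<mu> (?X \<union> ?Y) = measure \<mu> ?X + measure \<mu> ?Y"
        using fm disj by (intro measure_Un_AE) auto
      ultimately show ?thesis by simp
    qed
    finally have eq: "measure \<mu> (khull n S T) = measure \<mu> ?X + measure \<mu> ?Y + measure \<mu> ?Z" .
    have "emeasure M {\<omega>\<in>space M. isolated U V n S T \<omega>}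
      = ennreal (measure \<mu> ?X * measure \<mu> ?Y * exp (- measure \<mu> (khull n S T)))"
      unfolding M.emeasure_eq_measure isolated_def eq using 4(1)
      by (subst prob_three[symmetric]) (use finX finZ disj in auto)
    then show ?thesis
      using 4(1) finX by (simp add: ker_def ennreal_mult emeasure_eq_ennreal_measure[of \<mu>] less_top)
  qed (simp_all add: isolated_def ker_def)
qed

text \<open>Finer cells around \<open>a\<close> and \<open>b\<close> still contain these points, and
  no further ones, while the hull shrinks. Thus a pair once detected stays detected, which makes the
  counts monotone.\<close>

lemma isolated_code_mono:
  assumes "m \<le> n" "a \<in> \<Phi> \<omega> \<inter> U" "b \<in> \<Phi> \<omega> \<inter> V" "\<omega> \<in> reg" "isolated U V m (code m a) (code m b) \<omega>"
  shows "isolated U V n (code n a) (code n b) \<omega>" "\<Phi> \<omega> \<inter> K a b \<subseteq> {a, b}"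
proof -
  let ?X = "\<lambda>n. U \<inter> cell n (code n a)" and ?Y = "\<lambda>n. V \<inter> cell n (code n b)"
    and ?B = "\<lambda>n. khull n (code n a) (code n b)"
  have gm: "good m (code m a) (code m b)" using assms by (simp add: isolated_def)
  have gn: "good n (code n a) (code n b)" using good_code_mono[OF assms(1) gm] .
  have "a \<in> \<Phi> \<omega> \<inter> ?X m" "b \<in> \<Phi> \<omega> \<inter> ?Y m" using assms by auto
  moreover have "card (\<Phi> \<omega> \<inter> ?X m) = 1" "card (\<Phi> \<omega> \<inter> ?Y m) = 1"
    using assms(5) by (auto simp: isolated_def)
  ultimately have X: "\<Phi> \<omega> \<inter> ?X m = {a}" and Y: "\<Phi> \<omega> \<inter> ?Y m = {b}"
    by (metis card_1_singletonE singletonD)+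
  \<comment> \<open>\<open>card\<close> being \<open>0\<close> would also admit an infinite set;
    \<open>reg\<close> excludes this.\<close>
  have "finite (\<Phi> \<omega> \<inter> (?B m - (?X m \<union> ?Y m)))"
    using reg_props(3)[OF assms(4) _ _ gm] by (rule rev_finite_subset) auto
  then have "\<Phi> \<omega> \<inter> (?B m - (?X m \<union> ?Y m)) = {}"
    using assms(5) by (simp add: isolated_def)
  with X Y have B: "\<Phi> \<omega> \<inter> ?B m \<subseteq> {a, b}" by blast
  then show "\<Phi> \<omega> \<inter> K a b \<subseteq> {a, b}" using K_subset_khull[of a b m] by blast
  have Xn: "\<Phi> \<omega> \<inter> ?X n = {a}" "\<Phi> \<omega> \<inter> ?Y n = {b}"
    using X Y cell_code_antimono[OF assms(1), of a] cell_code_antimono[OF assms(1), of b]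
      assms(2,3) in_cell_code[of a n] in_cell_code[of b n] by blast+
  have "\<Phi> \<omega> \<inter> (?B n - (?X n \<union> ?Y n)) = {}"
    using B khull_code_antimono[OF assms(1), of a b] assms(2,3) by auto
  with gn Xn show "isolated U V n (code n a) (code n b) \<omega>"
    by (simp add: isolated_def)
qed

text \<open>Only finitely many points can obstruct the detection of \<open>a\<close> and
  \<open>b\<close>, and each of them eventually drops out: of the cells by separation, of the hulls
  because these shrink to \<open>K a b\<close>.\<close>

lemma ex_isolated:
  assumes a: "a \<in> \<Phi> \<omega> \<inter> U" and b: "b \<in> \<Phi> \<omega> \<inter> V" and \<omega>: "\<omega> \<in> reg" and void: "\<Phi> \<omega> \<inter> K a b \<subseteq> {a, b}"
  shows "\<exists>n. isolated U V n (code n a) (code n b) \<omega>"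
proof -
  let ?B = "\<lambda>n. khull n (code n a) (code n b)"
  obtain m where m: "good m (code m a) (code m b)" using ex_good[of a b] a b UV_H by auto
  have ab: "a \<noteq> b" using a b UV_disj by auto
  \<comment> \<open>All possible obstructions: the points of \<open>U\<close> and \<open>V\<close>,
    and those of the hull at a good level \<open>m\<close>, which contains all later hulls.\<close>
  define P where "P = (\<Phi> \<omega> \<inter> U \<union> \<Phi> \<omega> \<inter> V \<union> \<Phi> \<omega> \<inter> ?B m)"
  have finP: "finite P"
    using UV_reg[OF \<omega>] reg_props(3)[OF \<omega> _ _ m] by (simp add: P_def)
  have sep: "\<forall>\<^sub>F n in sequentially. \<forall>x\<in>P - {a}. x \<notin> cell n (code n a)" for a
  proof (rule eventually_ball_finite)
    show "\<forall>x\<in>P - {a}. \<forall>\<^sub>F n in sequentially. x \<notin> cell n (code n a)"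
    proof
      fix x assume "x \<in> P - {a}"
      then obtain X where "open X" "a \<in> X" "x \<notin> X" using t1_space[of a x] by blast
      from eventually_cell_subset[OF this(1,2)]
      show "\<forall>\<^sub>F n in sequentially. x \<notin> cell n (code n a)"
        by eventually_elim (use \<open>x \<notin> X\<close> in auto)
    qed
  qed (use finP in auto)
  have ev: "\<forall>\<^sub>F n in sequentially. \<forall>x\<in>P - {a, b}. x \<notin> ?B n"
  proof (rule eventually_ball_finite)
    show "\<forall>x\<in>P - {a, b}. \<forall>\<^sub>F n in sequentially. x \<notin> ?B n"
    proof
      fix x assume x: "x \<in> P - {a, b}"
      then have "x \<in> \<Phi> \<omega>" by (auto simp: P_def)
      with x void have "x \<notin> K a b" by auto
      then obtain k where k: "x \<notin> ?B k" using Inter_khull[of a b] by auto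
      have "x \<notin> ?B n" if "n \<ge> k" for n using khull_code_antimono[OF that, of a b] k by auto
      then show "\<forall>\<^sub>F n in sequentially. x \<notin> ?B n" by (auto simp: eventually_sequentially)
    qed
  qed (use finP in auto)
  have "\<forall>\<^sub>F n in sequentially. n \<ge> m \<and> (\<forall>x\<in>P - {a}. x \<notin> cell n (code n a)) \<and>
      (\<forall>x\<in>P - {b}. x \<notin> cell n (code n b)) \<and> (\<forall>x\<in>P - {a, b}. x \<notin> ?B n)"
    by (intro eventually_conj sep ev eventually_ge_at_top)
  then obtain n where n: "n \<ge> m" "\<forall>x\<in>P - {a}. x \<notin> cell n (code n a)"
      "\<forall>x\<in>P - {b}. x \<notin> cell n (code n b)" "\<forall>x\<in>P - {a, b}. x \<notin> ?B n"
    by (auto simp: eventually_sequentially)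
  have "\<Phi> \<omega> \<inter> (U \<inter> cell n (code n a)) = {a}" "\<Phi> \<omega> \<inter> (V \<inter> cell n (code n b)) = {b}"
    using n(2,3) a b by (auto simp: P_def)
  moreover have "\<Phi> \<omega> \<inter> (?B n - (U \<inter> cell n (code n a) \<union> V \<inter> cell n (code n b))) = {}"
    using n(4) khull_code_antimono[OF n(1), of a b] a b by (auto simp: P_def)
  ultimately have "isolated U V n (code n a) (code n b) \<omega>"
    using good_code_mono[OF n(1) m] by (simp add: isolated_def)
  then show ?thesis ..
qed

definition nisolated :: "nat \<Rightarrow> 'w \<Rightarrow> ennreal" where
  "nisolated n \<omega> = (\<Sum>ST\<in>Pow {..<n} \<times> Pow {..<n}.
     indicator {\<omega>\<in>space M. isolated U V n (fst ST) (snd ST) \<omega>} \<omega>) * indicator reg \<omega>"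

text \<open>An isolated pair of cells contains exactly one pair of points, so addresses give a
  bijection. The sum over cells is visibly measurable, the set of point pairs visibly increasing in
  \<open>n\<close>; both views are used.\<close>

lemma nisolated_eq:
  assumes \<omega>: "\<omega> \<in> reg"
  shows "nisolated n \<omega> = emeasure (count_space UNIV)
    {(a, b). a \<in> \<Phi> \<omega> \<inter> U \<and> b \<in> \<Phi> \<omega> \<inter> V \<and> isolated U V n (code n a) (code n b) \<omega>}"
proof -
  let ?L = "{(a, b). a \<in> \<Phi> \<omega> \<inter> U \<and> b \<in> \<Phi> \<omega> \<inter> V \<and> isolated U V n (code n a) (code n b) \<omega>}"
  let ?I = "{ST \<in> Pow {..<n} \<times> Pow {..<n}. isolated U V n (fst ST) (snd ST) \<omega>}"
  have fin: "finite ?L"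
    by (rule finite_subset[of _ "(\<Phi> \<omega> \<inter> U) \<times> (\<Phi> \<omega> \<inter> V)"]) (use UV_reg[OF \<omega>] in auto)
  have inj: "inj_on (map_prod (code n) (code n)) ?L"
  proof (rule inj_onI, clarsimp)
    fix a b a' b'
    assume *: "a \<in> \<Phi> \<omega>" "a \<in> U" "b \<in> \<Phi> \<omega>" "b \<in> V" "a' \<in> \<Phi> \<omega>" "a' \<in> U" "b' \<in> \<Phi> \<omega>" "b' \<in> V"
      and iso: "isolated U V n (code n a') (code n b') \<omega>" and c: "code n a = code n a'" "code n b = code n b'"
    have "{a, a'} \<subseteq> \<Phi> \<omega> \<inter> (U \<inter> cell n (code n a'))" "{b, b'} \<subseteq> \<Phi> \<omega> \<inter> (V \<inter> cell n (code n b'))"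
      using * c by (auto simp: cell_def)
    with iso show "a = a' \<and> b = b'"
      unfolding isolated_def by (metis card_1_singletonE insert_subset singletonD)
  qed
  have "map_prod (code n) (code n) ` ?L = ?I"
  proof (intro antisym subsetI)
    fix ST assume "ST \<in> ?I"
    then obtain S T where ST: "ST = (S, T)" "isolated U V n S T \<omega>" by (cases ST) auto
    then obtain a b where "\<Phi> \<omega> \<inter> (U \<inter> cell n S) = {a}" "\<Phi> \<omega> \<inter> (V \<inter> cell n T) = {b}"
      unfolding isolated_def by (metis card_1_singletonE)
    then have "a \<in> \<Phi> \<omega> \<inter> U" "code n a = S" "b \<in> \<Phi> \<omega> \<inter> V" "code n b = T"
      by (auto simp: cell_def)
    with ST show "ST \<in> map_prod (code n) (code n) ` ?L"
      by (auto intro!: image_eqI[of _ _ "(a, b)"])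
  next
    fix ST assume "ST \<in> map_prod (code n) (code n) ` ?L"
    then show "ST \<in> ?I" using code_subset[of n] by fastforce
  qed
  then have "card ?L = card ?I" using card_image[OF inj] by simp
  moreover have "nisolated n \<omega> = of_nat (card ?I)"
  proof -
    have "nisolated n \<omega> = (\<Sum>ST\<in>Pow {..<n} \<times> Pow {..<n}. if isolated U V n (fst ST) (snd ST) \<omega> then 1 else 0)"
      unfolding nisolated_def using \<omega> reg_space[OF \<omega>] by (auto intro!: sum.cong)
    also have "\<dots> = (\<Sum>ST\<in>?I. 1)"
      by (intro sum.inter_filter[symmetric]) auto
    finally show ?thesis by simp
  qed
  ultimately show ?thesis
    using fin by (simp add: emeasure_count_space_finite)
qed

lemma nisolated_measurable [measurable]: "nisolated n \<in> borel_measurable M"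
  using reg_props(1) unfolding nisolated_def by measurable

lemma incseq_nisolated: "incseq nisolated"
proof (rule incseq_SucI, rule le_funI)
  fix n \<omega>
  show "nisolated n \<omega> \<le> nisolated (Suc n) \<omega>"
  proof (cases "\<omega> \<in> reg")
    case True
    show ?thesis unfolding nisolated_eq[OF True]
      by (rule emeasure_mono) (auto intro!: isolated_code_mono(1)[of n "Suc n"] True)
  qed (simp add: nisolated_def)
qed

lemma nisolated_LIMSEQ: "(\<lambda>n. nisolated n \<omega>) \<longlonglongrightarrow> npairs (U \<times> V) \<omega> * indicator reg \<omega>"
proof (cases "\<omega> \<in> reg")
  case True
  let ?L = "\<lambda>n. {(a, b). a \<in> \<Phi> \<omega> \<inter> U \<and> b \<in> \<Phi> \<omega> \<inter> V \<and> isolated U V n (code n a) (code n b) \<omega>}"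
  have "(\<lambda>n. emeasure (count_space UNIV) (?L n)) \<longlonglongrightarrow> emeasure (count_space UNIV) (\<Union>n. ?L n)"
    by (intro Lim_emeasure_incseq incseq_SucI) (auto intro!: isolated_code_mono(1)[OF le_SucI[OF order_refl]] True)
  moreover have "(\<Union>n. ?L n) = {(a, b). (a, b) \<in> U \<times> V \<and> a \<in> \<Phi> \<omega> \<and> b \<in> \<Phi> \<omega> \<and> \<Phi> \<omega> \<inter> K a b \<subseteq> {a, b}}"
  proof (intro antisym subsetI)
    fix x assume "x \<in> (\<Union>n. ?L n)"
    then obtain n a b where x: "x = (a, b)" "a \<in> \<Phi> \<omega> \<inter> U" "b \<in> \<Phi> \<omega> \<inter> V" "isolated U V n (code n a) (code n b) \<omega>" by auto
    with isolated_code_mono(2)[OF order_refl x(2,3) True x(4)]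
    show "x \<in> {(a, b). (a, b) \<in> U \<times> V \<and> a \<in> \<Phi> \<omega> \<and> b \<in> \<Phi> \<omega> \<and> \<Phi> \<omega> \<inter> K a b \<subseteq> {a, b}}" by auto
  next
    fix x assume "x \<in> {(a, b). (a, b) \<in> U \<times> V \<and> a \<in> \<Phi> \<omega> \<and> b \<in> \<Phi> \<omega> \<and> \<Phi> \<omega> \<inter> K a b \<subseteq> {a, b}}"
    then obtain a b where x: "x = (a, b)" "a \<in> \<Phi> \<omega> \<inter> U" "b \<in> \<Phi> \<omega> \<inter> V" "\<Phi> \<omega> \<inter> K a b \<subseteq> {a, b}" by auto
    from ex_isolated[OF x(2,3) True x(4)] x show "x \<in> (\<Union>n. ?L n)" by auto
  qed
  ultimately show ?thesis
    using True by (simp add: nisolated_eq npairs_def)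
qed (simp add: nisolated_def)

text \<open>The products of cells partition the space of pairs, so the finite sum of expectations is
  the integral of a step function; on \<open>U \<times> V\<close> this function increases to
  \<open>dens\<close>.\<close>

lemma nn_integral_nisolated:
  "(\<integral>\<^sup>+\<omega>. nisolated n \<omega> \<partial>M)
    = (\<integral>\<^sup>+p. indicator (U \<times> V) p * ker n (code n (fst p)) (code n (snd p)) \<partial>(\<mu> \<Otimes>\<^sub>M \<mu>))"
proof -
  let ?J = "Pow {..<n} \<times> Pow {..<n}"
  have "(\<integral>\<^sup>+\<omega>. nisolated n \<omega> \<partial>M) = (\<integral>\<^sup>+\<omega>. (\<Sum>ST\<in>?J. indicator {\<omega>\<in>space M. isolated U V n (fst ST) (snd ST) \<omega>} \<omega>) \<partial>M)"
    using AE_reg by (intro nn_integral_cong_AE) (auto simp: nisolated_def)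
  also have "\<dots> = (\<Sum>ST\<in>?J. emeasure M {\<omega>\<in>space M. isolated U V n (fst ST) (snd ST) \<omega>})"
    by (subst nn_integral_sum) auto
  also have "\<dots> = (\<Sum>ST\<in>?J. ker n (fst ST) (snd ST) * emeasure (\<mu> \<Otimes>\<^sub>M \<mu>) ((U \<inter> cell n (fst ST)) \<times> (V \<inter> cell n (snd ST))))"
    by (intro sum.cong refl) (simp add: emeasure_isolated mu.emeasure_pair_measure_Times sets_mu ac_simps)
  also have "\<dots> = (\<integral>\<^sup>+p. (\<Sum>ST\<in>?J. ker n (fst ST) (snd ST) * indicator ((U \<inter> cell n (fst ST)) \<times> (V \<inter> cell n (snd ST))) p) \<partial>(\<mu> \<Otimes>\<^sub>M \<mu>))"
    by (subst nn_integral_sum) (auto simp: nn_integral_cmult_indicator sets_mu)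
  also have "\<dots> = (\<integral>\<^sup>+p. indicator (U \<times> V) p * ker n (code n (fst p)) (code n (snd p)) \<partial>(\<mu> \<Otimes>\<^sub>M \<mu>))"
  proof (intro nn_integral_cong)
    fix p :: "'p \<times> 'p"
    have "(\<Sum>ST\<in>?J. ker n (fst ST) (snd ST) * indicator ((U \<inter> cell n (fst ST)) \<times> (V \<inter> cell n (snd ST))) p)
      = (\<Sum>ST\<in>?J. if (code n (fst p), code n (snd p)) = ST then indicator (U \<times> V) p * ker n (fst ST) (snd ST) else 0)"
      by (intro sum.cong refl) (auto simp: cell_def indicator_def split: prod.splits)
    also have "\<dots> = indicator (U \<times> V) p * ker n (code n (fst p)) (code n (snd p))"
      by (subst sum.delta'; simp)
    finally show "(\<Sum>ST\<in>?J. ker n (fst ST) (snd ST) * indicator ((U \<inter> cell n (fst ST)) \<times> (V \<inter> cell n (snd ST))) p)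
      = indicator (U \<times> V) p * ker n (code n (fst p)) (code n (snd p))" .
  qed
  finally show ?thesis .
qed

lemma npairs_rectangle:
  shows "(\<lambda>\<omega>. npairs (U \<times> V) \<omega> * indicator reg \<omega>) \<in> borel_measurable M"
    and "(\<integral>\<^sup>+\<omega>. npairs (U \<times> V) \<omega> * indicator reg \<omega> \<partial>M) = (\<integral>\<^sup>+p. indicator (U \<times> V) p * dens p \<partial>(\<mu> \<Otimes>\<^sub>M \<mu>))"
proof -
  show "(\<lambda>\<omega>. npairs (U \<times> V) \<omega> * indicator reg \<omega>) \<in> borel_measurable M"
    by (rule borel_measurable_LIMSEQ_order[where u="nisolated"])
       (use nisolated_LIMSEQ in auto)
  have 1: "(\<lambda>n. \<integral>\<^sup>+\<omega>. nisolated n \<omega> \<partial>M) \<longlonglongrightarrow> (\<integral>\<^sup>+\<omega>. npairs (U \<times> V) \<omega> * indicator reg \<omega> \<partial>M)"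
    by (rule nn_integral_LIMSEQ) (use nisolated_LIMSEQ incseq_nisolated in auto)
  let ?g = "\<lambda>n p. indicator (U \<times> V) p * ker n (code n (fst p)) (code n (snd p))"
  have "?g n \<in> borel_measurable (\<mu> \<Otimes>\<^sub>M \<mu>)" for n
  proof -
    \<comment> \<open>\<open>code n\<close> has finitely many values, each taken on a Borel cell;
      hence any function of it is measurable, \<open>ker n\<close> included.\<close>
    have [measurable]: "code n \<in> measurable borel (count_space (Pow {..<n}))" for n
    proof (rule measurable_count_space_eq2[THEN iffD2])
      have "code n -` {S} = cell n S" for S by (auto simp: cell_def)
      then show "code n \<in> space borel \<rightarrow> Pow {..<n} \<and> (\<forall>S\<in>Pow {..<n}. code n -` {S} \<inter> space borel \<in> sets borel)"
        using code_subset by auto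
    qed simp
    have "(\<lambda>p. (code n (fst p), code n (snd p))) \<in> measurable (\<mu> \<Otimes>\<^sub>M \<mu>) (count_space (Pow {..<n}) \<Otimes>\<^sub>M count_space (Pow {..<n}))"
      by measurable
    then have "(\<lambda>p. (code n (fst p), code n (snd p))) \<in> measurable (\<mu> \<Otimes>\<^sub>M \<mu>) (count_space (Pow {..<n} \<times> Pow {..<n}))"
      by (simp add: pair_measure_countable countable_finite)
    from measurable_compose[OF this, of "\<lambda>(S,T). ker n S T" borel]
    have [measurable]: "(\<lambda>p. ker n (code n (fst p)) (code n (snd p))) \<in> borel_measurable (\<mu> \<Otimes>\<^sub>M \<mu>)"
      by simp
    have "U \<times> V \<in> sets (\<mu> \<Otimes>\<^sub>M \<mu>)" by (rule pair_measureI) (auto simp: sets_mu)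
    then show ?thesis by measurable
  qed
  then have 2: "(\<lambda>n. \<integral>\<^sup>+p. ?g n p \<partial>(\<mu> \<Otimes>\<^sub>M \<mu>)) \<longlonglongrightarrow> (\<integral>\<^sup>+p. indicator (U \<times> V) p * dens p \<partial>(\<mu> \<Otimes>\<^sub>M \<mu>))"
  proof (rule nn_integral_LIMSEQ[rotated])
    show "incseq ?g"
      by (intro incseq_SucI le_funI mult_left_mono ker_mono) auto
    show "(\<lambda>n. ?g n p) \<longlonglongrightarrow> indicator (U \<times> V) p * dens p" for p
    proof (cases "p \<in> U \<times> V")
      case True
      then have "fst p \<in> H" "snd p \<in> H" using UV_H by auto
      from ker_LIMSEQ[OF this] True show ?thesis by (simp add: dens_def)
    qed simp
  qed
  from 1 2 show "(\<integral>\<^sup>+\<omega>. npairs (U \<times> V) \<omega> * indicator reg \<omega> \<partial>M) = (\<integral>\<^sup>+p. indicator (U \<times> V) p * dens p \<partial>(\<mu> \<Otimes>\<^sub>M \<mu>))"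
    unfolding nn_integral_nisolated by (rule LIMSEQ_unique)
qed

end

section \<open>From products to Borel sets of pairs off the diagonal\<close>

lemma npairs_eq: "npairs E \<omega> = emeasure (count_space UNIV)
    (E \<inter> {(a, b). a \<in> \<Phi> \<omega> \<and> b \<in> \<Phi> \<omega> \<and> \<Phi> \<omega> \<inter> K a b \<subseteq> {a, b}})"
  unfolding npairs_def by (rule arg_cong[where f="emeasure (count_space UNIV)"]) auto

lemma npairs_UN: "disjoint_family E \<Longrightarrow> npairs (\<Union>i. E i) \<omega> = (\<Sum>i. npairs (E i) \<omega>)"
  unfolding npairs_eq
  by (subst suminf_emeasure) (auto simp: disjoint_family_on_def)

text \<open>Dynkin's argument inside one product \<open>U \<times> V\<close>, starting from smaller
  products. Measurability is carried along with the formula, since complements are integrated as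
  differences.\<close>

lemma npairs_in_rectangle:
  assumes UV [measurable]: "U \<in> sets borel" "V \<in> sets borel"
    and UV_fin: "emeasure \<mu> U < \<infinity>" "emeasure \<mu> V < \<infinity>"
    and UV_disj: "U \<inter> V = {}" and UV_H: "U \<subseteq> H" "V \<subseteq> H"
    and UV_reg: "\<And>\<omega>. \<omega> \<in> reg \<Longrightarrow> finite (\<Phi> \<omega> \<inter> U)" "\<And>\<omega>. \<omega> \<in> reg \<Longrightarrow> finite (\<Phi> \<omega> \<inter> V)"
    and E: "E \<in> sets borel"
  shows "(\<lambda>\<omega>. npairs (E \<inter> U \<times> V) \<omega> * indicator reg \<omega>) \<in> borel_measurable M \<and>
    (\<integral>\<^sup>+\<omega>. npairs (E \<inter> U \<times> V) \<omega> * indicator reg \<omega> \<partial>M) = (\<integral>\<^sup>+p. indicator (E \<inter> U \<times> V) p * dens p \<partial>(\<mu> \<Otimes>\<^sub>M \<mu>))"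
    (is "?P E")
proof -
  let ?G = "{A \<times> B | A B. A \<in> sets (borel :: 'p measure) \<and> B \<in> sets (borel :: 'p measure)}"
  have sig: "sets (borel :: ('p \<times> 'p) measure) = sigma_sets UNIV ?G"
    unfolding borel_prod[symmetric] sets_pair_measure by simp
  have UVs: "U \<times> V \<in> sets (\<mu> \<Otimes>\<^sub>M \<mu>)" by (rule pair_measureI) (auto simp: sets_mu)
  have rect: "?P (A \<times> B)" if "A \<in> sets borel" "B \<in> sets borel" for A B
  proof -
    have eq: "A \<times> B \<inter> U \<times> V = (A \<inter> U) \<times> (B \<inter> V)" by auto
    have "emeasure \<mu> (A \<inter> U) < \<infinity>" "emeasure \<mu> (B \<inter> V) < \<infinity>"
      using UV_fin emeasure_mono[of "A \<inter> U" U \<mu>] emeasure_mono[of "B \<inter> V" V \<mu>] by (auto simp: sets_mu)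
    moreover have "finite (\<Phi> \<omega> \<inter> (A \<inter> U))" "finite (\<Phi> \<omega> \<inter> (B \<inter> V))" if "\<omega> \<in> reg" for \<omega>
      by (rule rev_finite_subset[OF UV_reg(1)[OF that]], blast)
         (rule rev_finite_subset[OF UV_reg(2)[OF that]], blast)
    moreover have "A \<inter> U \<inter> (B \<inter> V) = {}" "A \<inter> U \<subseteq> H" "B \<inter> V \<subseteq> H" using UV_disj UV_H by auto
    ultimately show ?thesis
      unfolding eq using that UV by (intro conjI npairs_rectangle) auto
  qed
  have E': "E \<in> sigma_sets UNIV ?G" using E sig by simp
  have "Int_stable ?G" by (rule Int_stable_pair_measure_generator)
  moreover have "?G \<subseteq> Pow UNIV" by simp
  ultimately show ?thesis using E'
  proof (induction rule: sigma_sets_induct_disjoint)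
    case (basic A)
    then show ?case using rect by blast
  next
    case empty
    then show ?case by (simp add: npairs_def)
  next
    case (compl A)
    have A [measurable]: "A \<in> sets (\<mu> \<Otimes>\<^sub>M \<mu>)" using compl sig sets_mu2 by simp
    have UNIV: "?P UNIV" using rect[of UNIV UNIV] by simp
    \<comment> \<open>Subtraction in \<open>ennreal\<close> undoes addition only for a finite
      subtrahend; on \<open>reg\<close> there are finitely many points in \<open>U\<close> and
      \<open>V\<close>.\<close>
    have fin: "npairs (B \<inter> U \<times> V) \<omega> * indicator reg \<omega> < \<infinity>" for B \<omega>
    proof (cases "\<omega> \<in> reg")
      case True
      have "finite (B \<inter> U \<times> V \<inter> {(a, b). a \<in> \<Phi> \<omega> \<and> b \<in> \<Phi> \<omega> \<and> \<Phi> \<omega> \<inter> K a b \<subseteq> {a, b}})"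
        by (rule finite_subset[of _ "(\<Phi> \<omega> \<inter> U) \<times> (\<Phi> \<omega> \<inter> V)"]) (use UV_reg[OF True] in auto)
      then show ?thesis using True by (simp add: npairs_eq emeasure_count_space_finite of_nat_less_top)
    qed simp
    have add: "npairs (UNIV \<inter> U \<times> V) \<omega> = npairs (A \<inter> U \<times> V) \<omega> + npairs ((UNIV - A) \<inter> U \<times> V) \<omega>" for \<omega>
      unfolding npairs_eq by (subst plus_emeasure) (auto intro!: arg_cong[where f="emeasure (count_space UNIV)"])
    have eq: "npairs ((UNIV - A) \<inter> U \<times> V) \<omega> * indicator reg \<omega>
      = npairs (UNIV \<inter> U \<times> V) \<omega> * indicator reg \<omega> - npairs (A \<inter> U \<times> V) \<omega> * indicator reg \<omega>" for \<omega>
      using fin[of A \<omega>] by (simp only: add distrib_right) (simp add: less_top)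
    have fin2: "(\<integral>\<^sup>+p. indicator (A \<inter> U \<times> V) p * dens p \<partial>(\<mu> \<Otimes>\<^sub>M \<mu>)) < \<infinity>"
    proof -
      have "(\<integral>\<^sup>+p. indicator (A \<inter> U \<times> V) p * dens p \<partial>(\<mu> \<Otimes>\<^sub>M \<mu>)) \<le> (\<integral>\<^sup>+p. indicator (U \<times> V) p \<partial>(\<mu> \<Otimes>\<^sub>M \<mu>))"
        by (intro nn_integral_mono) (auto simp: dens_def indicator_def)
      also have "\<dots> = emeasure \<mu> U * emeasure \<mu> V"
        by (simp add: UVs mu.emeasure_pair_measure_Times sets_mu)
      also have "\<dots> < \<infinity>" using UV_fin by (simp add: ennreal_mult_less_top)
      finally show ?thesis .
    qed
    show ?case
    proof
      show "(\<lambda>\<omega>. npairs ((UNIV - A) \<inter> U \<times> V) \<omega> * indicator reg \<omega>) \<in> borel_measurable M"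
        unfolding eq using UNIV compl by (intro borel_measurable_minus_ennreal) auto
      have "(\<integral>\<^sup>+\<omega>. npairs ((UNIV - A) \<inter> U \<times> V) \<omega> * indicator reg \<omega> \<partial>M)
        = (\<integral>\<^sup>+\<omega>. npairs (UNIV \<inter> U \<times> V) \<omega> * indicator reg \<omega> \<partial>M) - (\<integral>\<^sup>+\<omega>. npairs (A \<inter> U \<times> V) \<omega> * indicator reg \<omega> \<partial>M)"
        unfolding eq
      proof (rule nn_integral_diff)
        show "AE \<omega> in M. npairs (A \<inter> U \<times> V) \<omega> * indicator reg \<omega> \<le> npairs (UNIV \<inter> U \<times> V) \<omega> * indicator reg \<omega>"
          unfolding npairs_eq by (intro AE_I2 mult_right_mono emeasure_mono) auto
      qed (use UNIV compl fin2 in auto)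
      also have "\<dots> = (\<integral>\<^sup>+p. indicator (UNIV \<inter> U \<times> V) p * dens p \<partial>(\<mu> \<Otimes>\<^sub>M \<mu>)) - (\<integral>\<^sup>+p. indicator (A \<inter> U \<times> V) p * dens p \<partial>(\<mu> \<Otimes>\<^sub>M \<mu>))"
        using UNIV compl by auto
      also have "\<dots> = (\<integral>\<^sup>+p. indicator (UNIV \<inter> U \<times> V) p * dens p - indicator (A \<inter> U \<times> V) p * dens p \<partial>(\<mu> \<Otimes>\<^sub>M \<mu>))"
        using fin2 UVs by (intro nn_integral_diff[symmetric]) (auto simp: indicator_def)
      also have "\<dots> = (\<integral>\<^sup>+p. indicator ((UNIV - A) \<inter> U \<times> V) p * dens p \<partial>(\<mu> \<Otimes>\<^sub>M \<mu>))"
        by (intro nn_integral_cong) (auto simp: indicator_def dens_def)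
      finally show "(\<integral>\<^sup>+\<omega>. npairs ((UNIV - A) \<inter> U \<times> V) \<omega> * indicator reg \<omega> \<partial>M)
        = (\<integral>\<^sup>+p. indicator ((UNIV - A) \<inter> U \<times> V) p * dens p \<partial>(\<mu> \<Otimes>\<^sub>M \<mu>))" .
    qed
  next
    case (union A)
    have A [measurable]: "A i \<in> sets (\<mu> \<Otimes>\<^sub>M \<mu>)" for i using union sig sets_mu2 by auto
    have d: "disjoint_family (\<lambda>i. A i \<inter> U \<times> V)" using union by (auto simp: disjoint_family_on_def)
    have eq: "\<Union> (range A) \<inter> U \<times> V = (\<Union>i. A i \<inter> U \<times> V)" by auto
    have eq1: "npairs (\<Union> (range A) \<inter> U \<times> V) \<omega> * indicator reg \<omega> = (\<Sum>i. npairs (A i \<inter> U \<times> V) \<omega> * indicator reg \<omega>)" for \<omega>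
      unfolding eq npairs_UN[OF d] by simp
    have eq2: "indicator (\<Union> (range A) \<inter> U \<times> V) p * dens p = (\<Sum>i. indicator (A i \<inter> U \<times> V) p * dens p)" for p
      unfolding eq suminf_indicator[OF d, symmetric] by simp
    show ?case unfolding eq1 eq2
    proof
      show "(\<lambda>\<omega>. \<Sum>i. npairs (A i \<inter> U \<times> V) \<omega> * indicator reg \<omega>) \<in> borel_measurable M"
        using union by (intro borel_measurable_suminf_order) auto
      have "(\<integral>\<^sup>+\<omega>. (\<Sum>i. npairs (A i \<inter> U \<times> V) \<omega> * indicator reg \<omega>) \<partial>M) = (\<Sum>i. \<integral>\<^sup>+\<omega>. npairs (A i \<inter> U \<times> V) \<omega> * indicator reg \<omega> \<partial>M)"
        using union by (intro nn_integral_suminf) auto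
      also have "\<dots> = (\<Sum>i. \<integral>\<^sup>+p. indicator (A i \<inter> U \<times> V) p * dens p \<partial>(\<mu> \<Otimes>\<^sub>M \<mu>))"
        using union by (intro suminf_cong) auto
      also have "\<dots> = (\<integral>\<^sup>+p. (\<Sum>i. indicator (A i \<inter> U \<times> V) p * dens p) \<partial>(\<mu> \<Otimes>\<^sub>M \<mu>))"
        using UVs by (intro nn_integral_suminf[symmetric]) auto
      finally show "(\<integral>\<^sup>+\<omega>. (\<Sum>i. npairs (A i \<inter> U \<times> V) \<omega> * indicator reg \<omega>) \<partial>M)
        = (\<integral>\<^sup>+p. (\<Sum>i. indicator (A i \<inter> U \<times> V) p * dens p) \<partial>(\<mu> \<Otimes>\<^sub>M \<mu>))" .
    qed
  qed
qed

lemma AE_npairs: "AE \<omega> in M. npairs E \<omega> = npairs E \<omega> * indicator reg \<omega>"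
  using AE_reg by eventually_elim auto

text \<open>Two distinct points get different addresses on a fine enough level, and different
  addresses mean disjoint cells. So \<open>E\<close> is covered by countably many admissible
  products; made disjoint, they allow summation.\<close>

theorem nn_integral_npairs:
  assumes E: "E \<in> sets borel" and E_H: "E \<subseteq> H \<times> H" and E_diag: "\<And>a. (a, a) \<notin> E"
  shows "(\<lambda>\<omega>. npairs E \<omega> * indicator reg \<omega>) \<in> borel_measurable M"
    and "(\<integral>\<^sup>+\<omega>. npairs E \<omega> \<partial>M) = (\<integral>\<^sup>+p. indicator E p * dens p \<partial>(\<mu> \<Otimes>\<^sub>M \<mu>))"
proof -
  have *: "(\<lambda>\<omega>. npairs E \<omega> * indicator reg \<omega>) \<in> borel_measurable M \<and>
    (\<integral>\<^sup>+\<omega>. npairs E \<omega> * indicator reg \<omega> \<partial>M) = (\<integral>\<^sup>+p. indicator E p * dens p \<partial>(\<mu> \<Otimes>\<^sub>M \<mu>))"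
  \<comment> \<open>A nonempty \<open>E\<close> makes the index set \<open>J\<close> nonempty, so
    that \<open>from_nat_into\<close> enumerates it.\<close>
  proof (cases "E = {}")
    case False
    \<comment> \<open>Both cells must meet \<open>H\<close>: only then does the hull contain the two
      pieces, and \<open>good\<close> yields that they have finite measure and, on
      \<open>reg\<close>, finitely many points.\<close>
    define J where "J = {(n, S, T) \<in> idx. S \<noteq> T \<and> good n S T \<and> cell n S \<inter> H \<noteq> {} \<and> cell n T \<inter> H \<noteq> {}}"
    define R where "R = (\<lambda>(n, S, T). (cell n S \<inter> H) \<times> (cell n T \<inter> H))"
    have cover: "\<exists>i\<in>J. p \<in> R i" if "p \<in> E" for p
    proof -
      obtain a b where p: "p = (a, b)" by (cases p)
      have ab: "a \<in> H" "b \<in> H" "a \<noteq> b" using that E_H E_diag p by auto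
      obtain m where m: "good m (code m a) (code m b)" using ex_good[OF ab(1,2)] by auto
      obtain X where X: "open X" "a \<in> X" "b \<notin> X" using t1_space[OF ab(3)] by blast
      have "\<forall>\<^sub>F n in sequentially. n \<ge> m \<and> cell n (code n a) \<subseteq> X"
        using X by (intro eventually_conj eventually_cell_subset eventually_ge_at_top) auto
      then obtain n where n: "n \<ge> m" "cell n (code n a) \<subseteq> X" by (auto simp: eventually_sequentially)
      have "code n a \<noteq> code n b" using n X by (auto simp: cell_def)
      then have "(n, code n a, code n b) \<in> J"
        using ab good_code_mono[OF n(1) m] in_cell_code[of a n] in_cell_code[of b n] code_subset
        unfolding J_def idx_def by blast
      moreover have "p \<in> R (n, code n a, code n b)" using p ab by (simp add: R_def)
      ultimately show ?thesis by blast
    qed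
    with False have "J \<noteq> {}" by auto
    moreover have "countable J"
      by (rule countable_subset[OF _ countable_idx]) (auto simp: J_def)
    ultimately have rng: "range (from_nat_into J) = J" by (rule range_from_nat_into)
    define Q where "Q = (\<lambda>i. R (from_nat_into J i))"
    have Rb: "R i \<in> sets borel" for i by (auto simp: R_def borel_prod[symmetric] split: prod.splits)
    define A where "A = (\<lambda>i. E \<inter> disjointed Q i)"
    have Ab: "A i \<in> sets borel" for i
    proof -
      have "range (disjointed Q) \<subseteq> sets borel"
        by (rule sets.range_disjointed_sets) (auto simp: Q_def Rb)
      then show ?thesis using E by (auto simp: A_def)
    qed
    have d: "disjoint_family A"
      using disjoint_family_disjointed[of Q] by (auto simp: A_def disjoint_family_on_def)
    have "(\<Union>i. Q i) = (\<Union>i\<in>J. R i)" unfolding Q_def using rng by (metis image_image)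
    then have EA: "E = (\<Union>i. A i)"
      using cover UN_disjointed_eq[of Q] by (auto simp: A_def)
    have part: "(\<lambda>\<omega>. npairs (A i) \<omega> * indicator reg \<omega>) \<in> borel_measurable M \<and>
      (\<integral>\<^sup>+\<omega>. npairs (A i) \<omega> * indicator reg \<omega> \<partial>M) = (\<integral>\<^sup>+p. indicator (A i) p * dens p \<partial>(\<mu> \<Otimes>\<^sub>M \<mu>))" for i
    proof -
      obtain n S T where nST: "from_nat_into J i = (n, S, T)" by (cases "from_nat_into J i")
      then have "(n, S, T) \<in> J" using rng by (metis rangeI)
      then have J: "S \<subseteq> {..<n}" "T \<subseteq> {..<n}" "S \<noteq> T" "good n S T" "cell n S \<inter> H \<noteq> {}" "cell n T \<inter> H \<noteq> {}"
        by (auto simp: J_def idx_def)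
      let ?U = "cell n S \<inter> H" and ?V = "cell n T \<inter> H"
      have sub: "?U \<subseteq> khull n S T" "?V \<subseteq> khull n S T"
      proof -
        obtain a b where ab: "a \<in> ?U" "b \<in> ?V" using J by blast
        show "?U \<subseteq> khull n S T"
          using K_left[of _ b] K_subset_khull[of _ b n] ab by (auto simp: cell_def)
        show "?V \<subseteq> khull n S T"
          using K_right[of a] K_subset_khull[of a _ n] ab by (auto simp: cell_def)
      qed
      have fin: "emeasure \<mu> ?U < \<infinity>" "emeasure \<mu> ?V < \<infinity>"
        using J(4) emeasure_mono[OF sub(1), of \<mu>] emeasure_mono[OF sub(2), of \<mu>]
        by (auto simp: good_def sets_mu)
      have disj: "?U \<inter> ?V = {}" using J(3) by (auto simp: cell_def)
      have "A i \<inter> ?U \<times> ?V = A i"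
        using disjointed_subset[of Q i] nST by (auto simp: A_def Q_def R_def)
      moreover have "finite (\<Phi> \<omega> \<inter> ?U)" "finite (\<Phi> \<omega> \<inter> ?V)" if "\<omega> \<in> reg" for \<omega>
        using reg_props(3)[OF that J(1,2,4)] sub by (auto intro: rev_finite_subset)
      ultimately show ?thesis
        using npairs_in_rectangle[of ?U ?V "A i"] fin Ab disj by simp
    qed
    have Am [measurable]: "A i \<in> sets (\<mu> \<Otimes>\<^sub>M \<mu>)" for i using Ab sets_mu2 by simp
    have eq1: "npairs E \<omega> * indicator reg \<omega> = (\<Sum>i. npairs (A i) \<omega> * indicator reg \<omega>)" for \<omega>
      unfolding EA npairs_UN[OF d] by simp
    have eq2: "indicator E p * dens p = (\<Sum>i. indicator (A i) p * dens p)" for p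
      unfolding EA suminf_indicator[OF d, symmetric] by simp
    show ?thesis unfolding eq1 eq2
    proof
      show "(\<lambda>\<omega>. \<Sum>i. npairs (A i) \<omega> * indicator reg \<omega>) \<in> borel_measurable M"
        using part by (intro borel_measurable_suminf_order) auto
      have "(\<integral>\<^sup>+\<omega>. (\<Sum>i. npairs (A i) \<omega> * indicator reg \<omega>) \<partial>M) = (\<Sum>i. \<integral>\<^sup>+\<omega>. npairs (A i) \<omega> * indicator reg \<omega> \<partial>M)"
        using part by (intro nn_integral_suminf) auto
      also have "\<dots> = (\<Sum>i. \<integral>\<^sup>+p. indicator (A i) p * dens p \<partial>(\<mu> \<Otimes>\<^sub>M \<mu>))"
        using part by (intro suminf_cong) auto
      also have "\<dots> = (\<integral>\<^sup>+p. (\<Sum>i. indicator (A i) p * dens p) \<partial>(\<mu> \<Otimes>\<^sub>M \<mu>))"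
        by (intro nn_integral_suminf[symmetric]) auto
      finally show "(\<integral>\<^sup>+\<omega>. (\<Sum>i. npairs (A i) \<omega> * indicator reg \<omega>) \<partial>M)
        = (\<integral>\<^sup>+p. (\<Sum>i. indicator (A i) p * dens p) \<partial>(\<mu> \<Otimes>\<^sub>M \<mu>))" .
    qed
  qed (simp add: npairs_def)
  then show "(\<lambda>\<omega>. npairs E \<omega> * indicator reg \<omega>) \<in> borel_measurable M" ..
  show "(\<integral>\<^sup>+\<omega>. npairs E \<omega> \<partial>M) = (\<integral>\<^sup>+p. indicator E p * dens p \<partial>(\<mu> \<Otimes>\<^sub>M \<mu>))"
    using * nn_integral_cong_AE[OF AE_npairs[of E]] by simp
qed

end

section \<open>Mutual nearest neighbours in the half space\<close>

locale marked_poisson = mark_density f for f :: "real \<Rightarrow> real" +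
  fixes M :: "'w measure" and \<Phi> :: "'w \<Rightarrow> pt set" and lam :: real and D :: "(real \<times> real) set"
  assumes lam_pos: "lam > 0"
    and D_borel: "D \<in> sets (borel :: (real \<times> real) measure)"
    and D_sub: "D \<subseteq> {0<..} \<times> {0<..}"
    and PPP: "poisson_pp M \<Phi> (intensity lam f)"
begin

definition basis_seq :: "nat \<Rightarrow> pt set" where
  "basis_seq = (SOME W. topological_basis (range W))"

lemma basis_seq: "topological_basis (range basis_seq)"
proof -
  obtain B :: "pt set set" where B: "countable B" "topological_basis B" using ex_countable_basis by blast
  have "B \<noteq> {}" using topological_basisE[OF B(2), of UNIV undefined] by auto
  then have "topological_basis (range (from_nat_into B))" using B by (simp add: range_from_nat_into)
  then show ?thesis 
    unfolding basis_seq_def by (rule someI[of "\<lambda>W. topological_basis (range W)"])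
qed

abbreviation \<mu> :: "pt measure" where "\<mu> \<equiv> intensity lam f"

lemma sets_intensity [measurable_cong]: "sets \<mu> = sets borel"
  unfolding intensity_def sets_scale_measure by (rule sets_N)

lemma emeasure_intensity: "emeasure \<mu> S = ennreal lam * emeasure N S"
  by (simp add: intensity_def)

lemma measure_intensity: "measure \<mu> S = lam * measure N S"
  using lam_pos by (simp add: measure_def emeasure_intensity enn2real_mult)

lemma nn_integral_intensity: "h \<in> borel_measurable borel \<Longrightarrow> (\<integral>\<^sup>+a. h a \<partial>\<mu>) = ennreal lam * (\<integral>\<^sup>+a. h a \<partial>N)"
  unfolding intensity_def by (rule nn_integral_scale_measure) (simp add: measurable_cong_sets[OF sets_N refl])

sublocale lm: pair_sigma_finite "lborel \<Otimes>\<^sub>M lborel :: (real \<times> real) measure" "mark_measure f"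
  unfolding lborel_prod ..

lemma sigma_finite_intensity: "sigma_finite_measure \<mu>"
proof -
  obtain A :: "pt set set" where A: "countable A" "A \<subseteq> sets N" "\<Union>A = space N" "\<forall>a\<in>A. emeasure N a \<noteq> \<infinity>"
    using lm.sigma_finite_countable by auto
  have "sets \<mu> = sets N" "space \<mu> = space N" 
    by (simp_all add: intensity_def space_scale_measure)
  moreover have "\<forall>a\<in>A. emeasure \<mu> a \<noteq> \<infinity>"
    using A(4) by (auto simp: emeasure_intensity ennreal_mult_eq_top_iff)
  ultimately show ?thesis using A by (intro sigma_finite_measure.intro) auto
qed

lemma emeasure_N_cylinder:
  assumes "A \<in> sets borel"
  shows "emeasure N (A \<times> UNIV) = emeasure lborel A"
proof -
  have "space (mark_measure f) = UNIV" by (simp add: mark_eq)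
  then have "emeasure (mark_measure f) UNIV = 1" using mark.emeasure_space_1 by simp
  moreover have "emeasure N (A \<times> UNIV) = emeasure (lborel \<Otimes>\<^sub>M lborel) A * emeasure (mark_measure f) UNIV"
  proof (rule mark.emeasure_pair_measure_Times)
    show "A \<in> sets (lborel \<Otimes>\<^sub>M lborel)" using assms by (simp only: lborel_prod sets_lborel)
  qed (simp add: sets_mark)
  ultimately show ?thesis by (simp add: lborel_prod)
qed

sublocale pv: poisson_void M \<Phi> \<mu> Kset "{a. 0 < snd a}" basis_seq
proof
  show "poisson_pp M \<Phi> \<mu>" by (rule PPP)
  show "sets \<mu> = sets borel" by (rule sets_intensity)
  show "closed {(a, b, c). c \<in> Kset a b}" by (rule closed_Kset_graph)
  show "{a :: pt. 0 < snd a} \<in> sets borel"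
    by (intro borel_open open_Collect_less continuous_intros)
  show "topological_basis (range basis_seq)" by (rule basis_seq)
  show "\<exists>A. countable A \<and> A \<subseteq> sets \<mu> \<and> \<Union> A = space \<mu> \<and> (\<forall>a\<in>A. emeasure \<mu> a \<noteq> \<infinity>)"
    using sigma_finite_intensity by (rule sigma_finite_measure.sigma_finite_countable)
  fix a b :: pt assume "a \<in> {a. 0 < snd a}" "b \<in> {a. 0 < snd a}"
  then have ab: "0 < snd a" "0 < snd b" by auto
  then show "a \<in> Kset a b" "b \<in> Kset a b" by (auto simp: Kset_left Kset_right)
  obtain X Y R where XY: "open X" "open Y" "a \<in> X" "b \<in> Y"
    "closure (\<Union>a'\<in>X. \<Union>b'\<in>Y. Kset a' b') \<subseteq> cball (fst a) R \<times> UNIV"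
    using Kset_locally_bounded[OF ab] by blast
  have "emeasure \<mu> (closure (\<Union>a'\<in>X. \<Union>b'\<in>Y. Kset a' b')) \<le> emeasure \<mu> (cball (fst a) R \<times> UNIV)"
    using XY(5) by (intro emeasure_mono) (simp_all add: sets_intensity closed_Times borel_closed)
  also have "\<dots> = ennreal lam * emeasure lborel (cball (fst a) R)"
    by (simp add: emeasure_intensity emeasure_N_cylinder)
  also have "\<dots> < \<infinity>" 
    using emeasure_lborel_cball_finite[of "fst a" R] by (simp add: ennreal_mult_less_top)
  finally show "\<exists>X Y. open X \<and> open Y \<and> a \<in> X \<and> b \<in> Y \<and>
        emeasure \<mu> (closure (\<Union>a'\<in>X. \<Union>b'\<in>Y. Kset a' b')) < \<infinity>" using XY by blast
qed

text \<open>\<open>poisson_pp\<close> places the points only in the space of the intensity, which is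
  all of \<open>pt\<close>. The region of nonpositive heights has intensity \<open>0\<close>; the
  almost sure finiteness is needed to conclude from \<open>card = 0\<close> that it is
  empty.\<close>

lemma AE_upper: "AE \<omega> in M. \<Phi> \<omega> \<subseteq> {a. 0 < snd a}"
proof -
  let ?H = "{a :: pt. snd a \<le> 0}"
  have H: "?H \<in> sets borel" by (intro borel_closed closed_Collect_le continuous_intros)
  have "emeasure N ?H = (\<integral>\<^sup>+x. \<integral>\<^sup>+y. \<integral>\<^sup>+z. 0 \<partial>(lborel :: real measure) \<partial>(lborel :: real measure) \<partial>(lborel :: real measure))"
    unfolding emeasure_N[OF H] by (intro nn_integral_cong) (auto simp: g_def indicator_def)
  then have 0: "emeasure \<mu> ?H = 0" by (simp add: emeasure_intensity)
  then have "measure M {\<omega>\<in>space M. card (\<Phi> \<omega> \<inter> ?H) = 0} = 1"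
    using pv.prob_card[OF H, of 0] by (simp add: measure_def)
  then have "AE \<omega> in M. \<omega> \<in> {\<omega>\<in>space M. card (\<Phi> \<omega> \<inter> ?H) = 0}" by (rule pv.M.AE_prob_1)
  moreover have "AE \<omega> in M. finite (\<Phi> \<omega> \<inter> ?H)"
    using PPP H 0 by (auto simp: poisson_pp_def sets_intensity)
  ultimately show ?thesis by eventually_elim auto
qed

definition pairs :: "(real \<times> real) set \<Rightarrow> (pt \<times> pt) set" where
  "pairs A = {p. fst (fst p) \<in> A} \<inter> {p. (snd (fst p), snd (snd p)) \<in> D} \<inter> {p. fst p \<noteq> snd p}"

lemma pairs_borel:
  assumes A: "A \<in> sets borel"
  shows "pairs A \<in> sets borel"
proof -
  have "(\<lambda>p :: pt \<times> pt. fst (fst p)) -` A \<inter> space borel \<in> sets borel"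
    by (rule measurable_sets[OF borel_measurable_continuous_onI A]) (intro continuous_intros)
  moreover have "(\<lambda>p :: pt \<times> pt. (snd (fst p), snd (snd p))) -` D \<inter> space borel \<in> sets borel"
    by (rule measurable_sets[OF borel_measurable_continuous_onI D_borel]) (intro continuous_intros)
  moreover have "{p :: pt \<times> pt. fst p \<noteq> snd p} \<in> sets borel"
    by (intro borel_open open_Collect_neq continuous_intros)
  ultimately show ?thesis by (simp add: pairs_def vimage_def)
qed

lemma emeasure_Phi2:
  assumes \<phi>: "\<Phi> \<omega> \<subseteq> {a. 0 < snd a}"
  shows "emeasure (count_space UNIV) {a \<in> Phi2 (\<Phi> \<omega>) D. fst a \<in> A} = pv.npairs (pairs A) \<omega>"
proof -
  let ?L = "{(a, b). (a, b) \<in> pairs A \<and> a \<in> \<Phi> \<omega> \<and> b \<in> \<Phi> \<omega> \<and> \<Phi> \<omega> \<inter> Kset a b \<subseteq> {a, b}}"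
  have void: "(\<Phi> \<omega> \<inter> Kset a b \<subseteq> {a, b}) \<longleftrightarrow> (\<forall>c\<in>\<Phi> \<omega> - {a, b}. dH a b < dH a c) \<and> (\<forall>c\<in>\<Phi> \<omega> - {b, a}. dH b a < dH b c)"
    if "a \<in> \<Phi> \<omega>" "b \<in> \<Phi> \<omega>" for a b
  proof -
    have "dH a b < dH a c \<and> dH b a < dH b c \<longleftrightarrow> c \<notin> Kset a b" if "c \<in> \<Phi> \<omega>" for c
      using dH_less_iff[of a b c] dH_less_iff[of b a c] \<phi> \<open>a \<in> \<Phi> \<omega>\<close> \<open>b \<in> \<Phi> \<omega>\<close> that by (auto simp: Kset_def)
    then show ?thesis by blast
  qed
  have mut: "(a, b) \<in> ?L \<longleftrightarrow> a \<in> \<Phi> \<omega> \<and> mutual_nn (\<Phi> \<omega>) D a b \<and> fst a \<in> A" for a b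
    using void[of a b] by (auto simp: pairs_def mutual_nn_def nn_to_def)
  have "fst ` ?L = {a \<in> Phi2 (\<Phi> \<omega>) D. fst a \<in> A}"
  proof (intro antisym subsetI)
    fix a assume "a \<in> fst ` ?L"
    then obtain b where "(a, b) \<in> ?L" by auto
    then show "a \<in> {a \<in> Phi2 (\<Phi> \<omega>) D. fst a \<in> A}"
      unfolding mut Phi2_def by (auto simp: mutual_nn_def nn_to_def)
  next
    fix a assume "a \<in> {a \<in> Phi2 (\<Phi> \<omega>) D. fst a \<in> A}"
    then obtain b where "a \<in> \<Phi> \<omega>" "mutual_nn (\<Phi> \<omega>) D a b" "fst a \<in> A" by (auto simp: Phi2_def)
    then have "(a, b) \<in> ?L" unfolding mut by blast
    then show "a \<in> fst ` ?L" by (rule image_eqI[rotated]) simp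
  qed
  moreover have "inj_on fst ?L"
  proof (rule inj_onI)
    fix p p' assume p: "p \<in> ?L" "p' \<in> ?L" and eq: "fst p = fst p'"
    obtain a b b' where ab: "p = (a, b)" "p' = (a, b')" using eq by (cases p; cases p') auto
    have "nn_to (\<Phi> \<omega>) a b" "nn_to (\<Phi> \<omega>) a b'"
      using p unfolding ab mut by (auto simp: mutual_nn_def)
    then have "b = b'" unfolding nn_to_def by (metis DiffI empty_iff insert_iff less_asym)
    then show "p = p'" using ab by simp
  qed
  ultimately show ?thesis
    unfolding pv.npairs_def using emeasure_count_space_image[of fst ?L] by simp
qed

text \<open>Expressed by the measure of \<open>Kset\<close> rather than by \<open>Fun_F\<close>:
  joint measurability in all three arguments then comes from the closed graph instead of the nested
  interval integrals.\<close>

definition \<Psi> :: "real \<Rightarrow> real \<Rightarrow> real \<Rightarrow> real" where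
  "\<Psi> s z z' = exp (- measure \<mu> (Kset ((0, 0), z) ((s, 0), z')))"

lemma \<Psi>_measurable [measurable (raw)]:
  assumes [measurable]: "a \<in> borel_measurable Q" "b \<in> borel_measurable Q" "c \<in> borel_measurable Q"
  shows "(\<lambda>\<omega>. \<Psi> (a \<omega>) (b \<omega>) (c \<omega>)) \<in> borel_measurable Q"
proof -
  have "(\<lambda>\<omega>. (((0, 0), b \<omega>), ((a \<omega>, 0), c \<omega>)) :: pt \<times> pt) \<in> borel_measurable Q"
    by (intro borel_measurable_Pair borel_measurable_const assms)
  from measurable_compose[OF this pv.measure_K_measurable]
  show ?thesis unfolding \<Psi>_def by simp
qed

lemma \<Psi>_eq: "s > 0 \<Longrightarrow> z > 0 \<Longrightarrow> z' > 0 \<Longrightarrow> \<Psi> s z z' = exp (- lam * Fun_F f s z z')"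
  by (simp add: \<Psi>_def measure_intensity measure_Kset_eq_Fun_F)

lemma dens_eq: "pv.dens ((x, z), (y, z')) = ennreal (\<Psi> (norm (y - x)) z z')"
proof -
  have "measure N (Kset (x, z) (y, z')) = measure N (Kset ((0, 0), z) ((norm (y - x), 0), z'))"
    unfolding measure_def emeasure_Kset_isometry[of x z y z'] ..
  then show ?thesis by (simp add: pv.dens_def \<Psi>_def measure_intensity)
qed

text \<open>The integral of the void probability over all horizontal displacements of the second
  point, in polar coordinates.\<close>

definition J :: "real \<Rightarrow> real \<Rightarrow> ennreal" where
  "J z z' = ennreal (2 * pi) * (\<integral>\<^sup>+s. ennreal (\<Psi> s z z' * s * indicator {0<..} s) \<partial>lborel)"

lemma J_measurable [measurable (raw)]:
  assumes [measurable]: "b \<in> borel_measurable Q" "c \<in> borel_measurable Q"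
  shows "(\<lambda>\<omega>. J (b \<omega>) (c \<omega>)) \<in> borel_measurable Q"
proof -
  have "(\<lambda>p. J (fst p) (snd p)) \<in> borel_measurable (borel \<Otimes>\<^sub>M borel)"
    unfolding J_def by measurable
  moreover have "(\<lambda>\<omega>. (b \<omega>, c \<omega>)) \<in> Q \<rightarrow>\<^sub>M borel \<Otimes>\<^sub>M borel" by measurable
  ultimately have "(\<lambda>\<omega>. J (fst (b \<omega>, c \<omega>)) (snd (b \<omega>, c \<omega>))) \<in> borel_measurable Q"
    by (rule measurable_compose[rotated])
  then show ?thesis by simp
qed

lemma D_pair [measurable]: "D \<in> sets (borel \<Otimes>\<^sub>M borel)"
  using D_borel unfolding borel_prod .

lemma nn_integral_translated_\<Psi>:
  fixes x :: "real \<times> real"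
  shows "(\<integral>\<^sup>+y. indicator {y. (x, z) \<noteq> (y, z')} y * ennreal (\<Psi> (norm (y - x)) z z') \<partial>(lborel \<Otimes>\<^sub>M lborel)) = J z z'"
proof -
  have "(\<integral>\<^sup>+y. indicator {y. (x, z) \<noteq> (y, z')} y * ennreal (\<Psi> (norm (y - x)) z z') \<partial>(lborel \<Otimes>\<^sub>M lborel))
    = (\<integral>\<^sup>+y. ennreal (\<Psi> (norm (y - x)) z z') \<partial>lborel)"
    unfolding lborel_prod
  proof (rule nn_integral_cong_AE)
    \<comment> \<open>Excluding the diagonal removes at most the single point
      \<open>x\<close>.\<close>
    have "AE y in lborel. y \<noteq> x" by (rule AE_lborel_singleton)
    then show "AE y in lborel. indicator {y. (x, z) \<noteq> (y, z')} y * ennreal (\<Psi> (norm (y - x)) z z') = ennreal (\<Psi> (norm (y - x)) z z')"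
      by eventually_elim auto
  qed
  also have "\<dots> = (\<integral>\<^sup>+y. ennreal (\<Psi> (norm y) z z') \<partial>(lborel :: (real \<times> real) measure))"
    using nn_integral_lborel_translate[of "\<lambda>y. ennreal (\<Psi> (norm (y - x)) z z')" x, symmetric] by simp
  also have "\<dots> = J z z'"
    unfolding J_def by (rule nn_integral_radial) (measurable, simp add: \<Psi>_def)
  finally show ?thesis .
qed

lemma nn_integral_N_iterated:
  assumes h: "h \<in> borel_measurable borel"
  shows "(\<integral>\<^sup>+b. h b \<partial>N) = (\<integral>\<^sup>+z'. \<integral>\<^sup>+y. h (y, z') \<partial>(lborel \<Otimes>\<^sub>M lborel) \<partial>mark_measure f)"
  by (rule lm.nn_integral_snd[symmetric]) (use h in \<open>simp add: measurable_cong_sets[OF sets_N refl]\<close>)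

text \<open>Fubini moves the integral over \<open>s\<close> innermost. It is applied after
  \<open>Fun_F\<close> has been replaced by \<open>\<Psi>\<close>, which is legitimate for
  \<open>s > 0\<close> because \<open>D\<close> contains only pairs of positive marks.\<close>

lemma P_D_eq: "P_D D lam f = ennreal lam * (\<integral>\<^sup>+z. \<integral>\<^sup>+z'. indicator D (z, z') * J z z' \<partial>mark_measure f \<partial>mark_measure f)"
proof -
  let ?m = "mark_measure f \<Otimes>\<^sub>M mark_measure f"
  interpret mm: pair_sigma_finite "mark_measure f" "mark_measure f" ..
  interpret smm: pair_sigma_finite "lborel :: real measure" ?m ..
  have "(\<integral>\<^sup>+s. (\<integral>\<^sup>+zz. ennreal (exp (- lam * Fun_F f s (fst zz) (snd zz)) * indicator D zz) \<partial>?m) * ennreal s \<partial>restrict_space lborel {0<..})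
    = (\<integral>\<^sup>+s. (\<integral>\<^sup>+zz. ennreal (exp (- lam * Fun_F f s (fst zz) (snd zz)) * indicator D zz) \<partial>?m) * ennreal s * indicator {0<..} s \<partial>lborel)"
    by (rule nn_integral_restrict_space) simp
  also have "\<dots> = (\<integral>\<^sup>+s. \<integral>\<^sup>+zz. indicator D zz * ennreal (\<Psi> s (fst zz) (snd zz) * s * indicator {0<..} s) \<partial>?m \<partial>lborel)"
  proof (rule nn_integral_cong)
    fix s :: real
    show "(\<integral>\<^sup>+zz. ennreal (exp (- lam * Fun_F f s (fst zz) (snd zz)) * indicator D zz) \<partial>?m) * ennreal s * indicator {0<..} s
      = (\<integral>\<^sup>+zz. indicator D zz * ennreal (\<Psi> s (fst zz) (snd zz) * s * indicator {0<..} s) \<partial>?m)"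
    proof (cases "s > 0")
      case True
      have "(\<integral>\<^sup>+zz. ennreal (exp (- lam * Fun_F f s (fst zz) (snd zz)) * indicator D zz) \<partial>?m)
        = (\<integral>\<^sup>+zz. indicator D zz * ennreal (\<Psi> s (fst zz) (snd zz)) \<partial>?m)"
        by (rule nn_integral_cong) (use D_sub True in \<open>auto simp: indicator_def \<Psi>_eq\<close>)
      moreover have "(\<integral>\<^sup>+zz. indicator D zz * ennreal (\<Psi> s (fst zz) (snd zz)) \<partial>?m) * ennreal s
        = (\<integral>\<^sup>+zz. indicator D zz * ennreal (\<Psi> s (fst zz) (snd zz)) * ennreal s \<partial>?m)"
        by (rule nn_integral_multc[symmetric]) measurable
      ultimately show ?thesis
        using True by (simp add: ennreal_mult \<Psi>_def mult.assoc)
    qed simp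
  qed
  also have "\<dots> = (\<integral>\<^sup>+zz. \<integral>\<^sup>+s. indicator D zz * ennreal (\<Psi> s (fst zz) (snd zz) * s * indicator {0<..} s) \<partial>lborel \<partial>?m)"
    by (rule smm.Fubini'[symmetric]) measurable
  also have "\<dots> = (\<integral>\<^sup>+zz. indicator D zz * (\<integral>\<^sup>+s. ennreal (\<Psi> s (fst zz) (snd zz) * s * indicator {0<..} s) \<partial>lborel) \<partial>?m)"
    by (rule nn_integral_cong, rule nn_integral_cmult) measurable
  finally have "P_D D lam f = ennreal (2 * pi * lam) * (\<integral>\<^sup>+zz. indicator D zz * (\<integral>\<^sup>+s. ennreal (\<Psi> s (fst zz) (snd zz) * s * indicator {0<..} s) \<partial>lborel) \<partial>?m)"
    unfolding P_D_def by (rule arg_cong)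
  also have "\<dots> = ennreal lam * (ennreal (2 * pi) * (\<integral>\<^sup>+zz. indicator D zz * (\<integral>\<^sup>+s. ennreal (\<Psi> s (fst zz) (snd zz) * s * indicator {0<..} s) \<partial>lborel) \<partial>?m))"
    using lam_pos by (simp add: ennreal_mult mult_ac)
  also have "ennreal (2 * pi) * (\<integral>\<^sup>+zz. indicator D zz * (\<integral>\<^sup>+s. ennreal (\<Psi> s (fst zz) (snd zz) * s * indicator {0<..} s) \<partial>lborel) \<partial>?m)
    = (\<integral>\<^sup>+zz. indicator D zz * J (fst zz) (snd zz) \<partial>?m)"
    unfolding J_def by (subst nn_integral_cmult[symmetric]) (measurable, simp add: mult_ac)
  also have "\<dots> = (\<integral>\<^sup>+z. \<integral>\<^sup>+z'. indicator D (z, z') * J z z' \<partial>mark_measure f \<partial>mark_measure f)"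
    by (subst mark.nn_integral_fst[symmetric]) auto
  finally show ?thesis .
qed

text \<open>The integral over the second point depends on the first one only through its mark and
  the indicator of \<open>A\<close>, so the area of \<open>A\<close> factors out. One of the two
  factors \<open>lam\<close> goes into \<open>P_D\<close>, the other remains as the density of the
  first point.\<close>

lemma nn_integral_pairs:
  assumes A [measurable]: "A \<in> sets borel"
  shows "(\<integral>\<^sup>+p. indicator (pairs A) p * pv.dens p \<partial>(\<mu> \<Otimes>\<^sub>M \<mu>)) = P_D D lam f * ennreal lam * emeasure lborel A"
proof -
  let ?h = "\<lambda>p. indicator (pairs A) p * pv.dens p"
  have h2: "?h \<in> borel_measurable (\<mu> \<Otimes>\<^sub>M \<mu>)"
    using pairs_borel[OF A] pv.sets_mu2 by (intro borel_measurable_times_ennreal borel_measurable_indicator pv.dens_measurable) auto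
  then have hb: "?h \<in> borel_measurable borel"
    by (simp add: measurable_cong_sets[OF pv.sets_mu2 refl])
  have hs: "(\<lambda>b. ?h (a, b)) \<in> borel_measurable borel" for a
    by (rule measurable_compose[OF _ hb]) simp
  have inner: "(\<integral>\<^sup>+b. ?h (a, b) \<partial>\<mu>) = ennreal lam * (indicator A (fst a) * (\<integral>\<^sup>+z'. indicator D (snd a, z') * J (snd a) z' \<partial>mark_measure f))" for a
  proof -
    obtain x z where a: "a = (x, z)" by (cases a)
    have "(\<integral>\<^sup>+b. ?h (a, b) \<partial>\<mu>) = ennreal lam * (\<integral>\<^sup>+b. ?h (a, b) \<partial>N)" by (rule nn_integral_intensity[OF hs])
    also have "(\<integral>\<^sup>+b. ?h (a, b) \<partial>N) = (\<integral>\<^sup>+z'. \<integral>\<^sup>+y. ?h (a, (y, z')) \<partial>(lborel \<Otimes>\<^sub>M lborel) \<partial>mark_measure f)"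
      by (rule nn_integral_N_iterated[OF hs])
    also have "\<dots> = (\<integral>\<^sup>+z'. indicator A x * (indicator D (z, z') * J z z') \<partial>mark_measure f)"
    proof (rule nn_integral_cong)
      fix z' :: real
      have m: "(\<lambda>y. indicator {y. (x, z) \<noteq> (y, z')} y * ennreal (\<Psi> (norm (y - x)) z z')) \<in> borel_measurable (lborel \<Otimes>\<^sub>M lborel)"
      proof -
        have "{y. (x, z) \<noteq> (y, z')} = (if z = z' then UNIV - {x} else UNIV)" by auto
        then have "{y. (x, z) \<noteq> (y, z')} \<in> sets borel" by simp
        then show ?thesis unfolding lborel_prod by measurable
      qed
      have "(\<integral>\<^sup>+y. ?h (a, (y, z')) \<partial>(lborel \<Otimes>\<^sub>M lborel))
        = (\<integral>\<^sup>+y. (indicator A x * indicator D (z, z')) * (indicator {y. (x, z) \<noteq> (y, z')} y * ennreal (\<Psi> (norm (y - x)) z z')) \<partial>(lborel \<Otimes>\<^sub>M lborel))"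
        unfolding a dens_eq by (rule nn_integral_cong) (auto simp: pairs_def indicator_def)
      also have "\<dots> = (indicator A x * indicator D (z, z')) * J z z'"
        unfolding nn_integral_cmult[OF m] nn_integral_translated_\<Psi> ..
      finally show "(\<integral>\<^sup>+y. ?h (a, (y, z')) \<partial>(lborel \<Otimes>\<^sub>M lborel)) = indicator A x * (indicator D (z, z') * J z z')"
        by (simp add: mult.assoc)
    qed
    also have "\<dots> = indicator A x * (\<integral>\<^sup>+z'. indicator D (z, z') * J z z' \<partial>mark_measure f)"
      by (rule nn_integral_cmult) measurable
    finally show ?thesis by (simp add: a)
  qed
  let ?G = "\<lambda>z. \<integral>\<^sup>+z'. indicator D (z, z') * J z z' \<partial>mark_measure f"
  have G [measurable]: "?G \<in> borel_measurable borel" by measurable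
  have Am: "(\<lambda>a :: pt. indicator A (fst a) :: ennreal) \<in> borel_measurable borel"
    by (rule measurable_compose[of fst borel borel])
       (auto intro!: borel_measurable_continuous_onI continuous_intros)
  have Gm: "(\<lambda>a :: pt. ?G (snd a)) \<in> borel_measurable borel"
    by (rule measurable_compose[OF _ G]) (intro borel_measurable_continuous_onI continuous_intros)
  have "(\<integral>\<^sup>+p. ?h p \<partial>(\<mu> \<Otimes>\<^sub>M \<mu>)) = (\<integral>\<^sup>+a. \<integral>\<^sup>+b. ?h (a, b) \<partial>\<mu> \<partial>\<mu>)"
    by (rule pv.mu.nn_integral_fst[OF h2, symmetric])
  also have "\<dots> = (\<integral>\<^sup>+a. ennreal lam * (indicator A (fst a) * ?G (snd a)) \<partial>\<mu>)"
    unfolding inner ..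
  also have "\<dots> = ennreal lam * (\<integral>\<^sup>+a. ennreal lam * (indicator A (fst a) * ?G (snd a)) \<partial>N)"
    by (rule nn_integral_intensity) (intro borel_measurable_times_ennreal borel_measurable_const Am Gm)
  also have "(\<integral>\<^sup>+a. ennreal lam * (indicator A (fst a) * ?G (snd a)) \<partial>N)
    = (\<integral>\<^sup>+z. \<integral>\<^sup>+x. ennreal lam * (indicator A x * ?G z) \<partial>(lborel \<Otimes>\<^sub>M lborel) \<partial>mark_measure f)"
    by (subst nn_integral_N_iterated) (auto intro!: borel_measurable_times_ennreal borel_measurable_const Am Gm)
  also have "\<dots> = (\<integral>\<^sup>+z. (ennreal lam * emeasure lborel A) * ?G z \<partial>mark_measure f)"
  proof (rule nn_integral_cong)
    fix z :: real
    have "(\<integral>\<^sup>+x. ennreal lam * (indicator A x * ?G z) \<partial>(lborel \<Otimes>\<^sub>M lborel)) = (\<integral>\<^sup>+x. (ennreal lam * ?G z) * indicator A x \<partial>lborel)"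
      unfolding lborel_prod by (simp add: mult_ac)
    also have "\<dots> = (ennreal lam * ?G z) * emeasure lborel A"
      by (rule nn_integral_cmult_indicator) simp
    finally show "(\<integral>\<^sup>+x. ennreal lam * (indicator A x * ?G z) \<partial>(lborel \<Otimes>\<^sub>M lborel)) = (ennreal lam * emeasure lborel A) * ?G z"
      by (simp add: mult_ac)
  qed
  also have "\<dots> = (ennreal lam * emeasure lborel A) * (\<integral>\<^sup>+z. ?G z \<partial>mark_measure f)"
    by (rule nn_integral_cmult) measurable
  finally show ?thesis unfolding P_D_eq by (simp add: mult_ac)
qed

section \<open>The two mean measures and the bound on \<open>P_D\<close>\<close>

lemma AE_Phi2:
  "AE \<omega> in M. emeasure (count_space UNIV) {a \<in> Phi2 (\<Phi> \<omega>) D. fst a \<in> A} = pv.npairs (pairs A) \<omega> * indicator pv.reg \<omega>"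
  using AE_upper pv.AE_reg by eventually_elim (simp add: emeasure_Phi2)

lemma
  assumes A: "A \<in> sets borel"
  shows npairs_measurable: "(\<lambda>\<omega>. pv.npairs (pairs A) \<omega> * indicator pv.reg \<omega>) \<in> borel_measurable M"
    and mean_Phi2: "mean_meas M (\<lambda>\<omega>. Phi2 (\<Phi> \<omega>) D) A = P_D D lam f * ennreal lam * emeasure lborel A"
proof -
  have P: "pairs A \<subseteq> {a. 0 < snd a} \<times> {a. 0 < snd a}" "(a, a) \<notin> pairs A" for a
    using D_sub by (auto simp: pairs_def)
  show "(\<lambda>\<omega>. pv.npairs (pairs A) \<omega> * indicator pv.reg \<omega>) \<in> borel_measurable M"
    by (rule pv.nn_integral_npairs(1)[OF pairs_borel[OF A] P])
  have "mean_meas M (\<lambda>\<omega>. Phi2 (\<Phi> \<omega>) D) A = (\<integral>\<^sup>+\<omega>. pv.npairs (pairs A) \<omega> \<partial>M)"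
    unfolding mean_meas_def by (rule nn_integral_cong_AE) (use AE_upper in eventually_elim, simp add: emeasure_Phi2)
  also have "\<dots> = P_D D lam f * ennreal lam * emeasure lborel A"
    unfolding pv.nn_integral_npairs(2)[OF pairs_borel[OF A] P] by (rule nn_integral_pairs[OF A])
  finally show "mean_meas M (\<lambda>\<omega>. Phi2 (\<Phi> \<omega>) D) A = P_D D lam f * ennreal lam * emeasure lborel A" .
qed

lemma total_count:
  assumes A: "A \<in> sets borel" and fin: "emeasure lborel A < \<infinity>"
  shows "(\<lambda>\<omega>. card (\<Phi> \<omega> \<inter> A \<times> UNIV)) \<in> measurable M (count_space UNIV)"
    and "AE \<omega> in M. finite (\<Phi> \<omega> \<inter> A \<times> UNIV)"
    and "(\<integral>\<^sup>+\<omega>. of_nat (card (\<Phi> \<omega> \<inter> A \<times> UNIV)) \<partial>M) = ennreal lam * emeasure lborel A"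
proof -
  have S: "A \<times> UNIV \<in> sets (borel :: pt measure)"
    using A by (simp add: borel_prod[symmetric] del: borel_prod)
  have e: "emeasure \<mu> (A \<times> UNIV) = ennreal lam * emeasure lborel A"
    by (simp add: emeasure_intensity emeasure_N_cylinder[OF A])
  then have f: "emeasure \<mu> (A \<times> UNIV) < \<infinity>" using fin by (simp add: ennreal_mult_less_top)
  show m: "(\<lambda>\<omega>. card (\<Phi> \<omega> \<inter> A \<times> UNIV)) \<in> measurable M (count_space UNIV)"
    by (rule pv.card_measurable[OF S f])
  show "AE \<omega> in M. finite (\<Phi> \<omega> \<inter> A \<times> UNIV)"
    using PPP S f by (simp add: poisson_pp_def sets_intensity)
  have "(\<integral>\<^sup>+\<omega>. of_nat (card (\<Phi> \<omega> \<inter> A \<times> UNIV)) \<partial>M) = ennreal (measure \<mu> (A \<times> UNIV))"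
    by (rule nn_integral_poisson_mean[OF pv.M.prob_space_axioms m pv.prob_card[OF S f]]) simp
  then show "(\<integral>\<^sup>+\<omega>. of_nat (card (\<Phi> \<omega> \<inter> A \<times> UNIV)) \<partial>M) = ennreal lam * emeasure lborel A"
    using f by (simp add: emeasure_eq_ennreal_measure[symmetric] less_top[symmetric] e[symmetric])
qed

text \<open>Above a set of finite area all counts are almost surely finite, so \<open>Phi1\<close>
  is counted by subtraction. The right-hand side is the measurable version that can be
  integrated.\<close>

lemma AE_Phi1:
  assumes A: "A \<in> sets borel" and fin: "emeasure lborel A < \<infinity>"
  shows "AE \<omega> in M. pv.npairs (pairs A) \<omega> * indicator pv.reg \<omega> \<le> of_nat (card (\<Phi> \<omega> \<inter> A \<times> UNIV)) \<and>
    emeasure (count_space UNIV) {a \<in> Phi1 (\<Phi> \<omega>) D. fst a \<in> A}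
      = of_nat (card (\<Phi> \<omega> \<inter> A \<times> UNIV)) - pv.npairs (pairs A) \<omega> * indicator pv.reg \<omega>"
  using AE_Phi2[of A] total_count(2)[OF A fin]
proof eventually_elim
  case (elim \<omega>)
  let ?T = "\<Phi> \<omega> \<inter> A \<times> UNIV" and ?X = "{a \<in> Phi2 (\<Phi> \<omega>) D. fst a \<in> A}" and ?Y = "{a \<in> Phi1 (\<Phi> \<omega>) D. fst a \<in> A}"
  have sub: "?X \<subseteq> ?T" by (auto simp: Phi2_def)
  have Y: "?Y = ?T - ?X" by (auto simp: Phi1_def)
  have fX: "finite ?X" using elim(2) sub by (rule rev_finite_subset)
  have eX: "emeasure (count_space UNIV) ?X = of_nat (card ?X)" using fX by (simp add: emeasure_count_space_finite)
  have eY: "emeasure (count_space UNIV) ?Y = of_nat (card ?T - card ?X)"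
    unfolding Y using elim(2) fX sub by (simp add: emeasure_count_space_finite card_Diff_subset)
  have "card ?X \<le> card ?T" using elim(2) sub by (rule card_mono)
  then have eT: "(of_nat (card ?T) :: ennreal) = of_nat (card ?X) + of_nat (card ?T - card ?X)"
    by (simp flip: of_nat_add)
  show ?case unfolding elim(1)[symmetric] eX eY eT by simp
qed

text \<open>Over a unit square the whole process has mean \<open>lam\<close>, and
  \<open>Phi2\<close> is part of it; cancelling the positive factor \<open>lam\<close> gives the
  bound.\<close>

lemma P_D_le_1: "P_D D lam f \<le> 1"
proof -
  let ?A = "cbox (0, 0) (1, 1) :: (real \<times> real) set"
  have A: "?A \<in> sets borel" by simp
  have e: "emeasure lborel ?A = 1"
    by (subst emeasure_lborel_cbox_eq) (auto simp: Basis_prod_def inner_prod_def)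
  have "mean_meas M (\<lambda>\<omega>. Phi2 (\<Phi> \<omega>) D) ?A \<le> (\<integral>\<^sup>+\<omega>. of_nat (card (\<Phi> \<omega> \<inter> ?A \<times> UNIV)) \<partial>M)"
    unfolding mean_meas_def
  proof (rule nn_integral_mono_AE)
    show "AE \<omega> in M. emeasure (count_space UNIV) {a \<in> Phi2 (\<Phi> \<omega>) D. fst a \<in> ?A} \<le> of_nat (card (\<Phi> \<omega> \<inter> ?A \<times> UNIV))"
      using AE_Phi1[OF A] AE_Phi2[of ?A] unfolding e by auto
  qed
  then have "P_D D lam f * ennreal lam \<le> 1 * ennreal lam"
    unfolding mean_Phi2[OF A] using total_count(3)[OF A] e by simp
  then have "ennreal lam * P_D D lam f \<le> ennreal lam * 1" by (simp add: mult.commute)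
  then show ?thesis using lam_pos by (subst (asm) ennreal_mult_le_mult_iff) auto
qed

lemma mean_Phi1_finite:
  assumes A: "A \<in> sets borel" and fin: "emeasure lborel A < \<infinity>"
  shows "mean_meas M (\<lambda>\<omega>. Phi1 (\<Phi> \<omega>) D) A = (1 - P_D D lam f) * ennreal lam * emeasure lborel A"
proof -
  let ?c = "\<lambda>\<omega>. of_nat (card (\<Phi> \<omega> \<inter> A \<times> UNIV)) :: ennreal"
  let ?n = "\<lambda>\<omega>. pv.npairs (pairs A) \<omega> * indicator pv.reg \<omega>"
  have [measurable]: "?c \<in> borel_measurable M" by (rule measurable_compose[OF total_count(1)[OF A fin]]) simp
  have n: "(\<integral>\<^sup>+\<omega>. ?n \<omega> \<partial>M) = P_D D lam f * ennreal lam * emeasure lborel A"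
    unfolding mean_Phi2[OF A, symmetric] mean_meas_def
    by (rule nn_integral_cong_AE) (use AE_Phi2[of A] in eventually_elim, simp)
  have P: "P_D D lam f \<le> 1" by (rule P_D_le_1)
  then have P': "P_D D lam f < \<infinity>" by (rule le_less_trans) simp
  have "mean_meas M (\<lambda>\<omega>. Phi1 (\<Phi> \<omega>) D) A = (\<integral>\<^sup>+\<omega>. ?c \<omega> - ?n \<omega> \<partial>M)"
    unfolding mean_meas_def by (rule nn_integral_cong_AE) (use AE_Phi1[OF A fin] in eventually_elim, simp)
  also have "\<dots> = (\<integral>\<^sup>+\<omega>. ?c \<omega> \<partial>M) - (\<integral>\<^sup>+\<omega>. ?n \<omega> \<partial>M)"
  proof (rule nn_integral_diff)
    show "(\<integral>\<^sup>+\<omega>. ?n \<omega> \<partial>M) \<noteq> \<infinity>"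
      unfolding n using P' fin by (simp add: ennreal_mult_eq_top_iff less_top)
    show "AE \<omega> in M. ?n \<omega> \<le> ?c \<omega>" using AE_Phi1[OF A fin] by eventually_elim simp
  qed (use npairs_measurable[OF A] in auto)
  also have "\<dots> = (ennreal lam * emeasure lborel A) * 1 - (ennreal lam * emeasure lborel A) * P_D D lam f"
    unfolding n total_count(3)[OF A fin] by (simp add: mult_ac)
  also have "\<dots> = (1 - P_D D lam f) * ennreal lam * emeasure lborel A"
    using fin by (subst ennreal_right_diff_distrib[symmetric]) (auto simp: mult_ac ennreal_mult_eq_top_iff)
  finally show ?thesis .
qed

text \<open>For infinite area the difference of means may be
  \<open>\<infinity> - \<infinity>\<close>, so \<open>A\<close> is cut into countably many pieces of
  finite area. The measurable versions on the pieces justify exchanging sum and integral.\<close>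

lemma mean_Phi1:
  assumes A: "A \<in> sets borel"
  shows "mean_meas M (\<lambda>\<omega>. Phi1 (\<Phi> \<omega>) D) A = (1 - P_D D lam f) * ennreal lam * emeasure lborel A"
proof -
  obtain B :: "nat \<Rightarrow> (real \<times> real) set" where B: "range B \<subseteq> sets lborel" "(\<Union>i. B i) = space lborel"
    "\<And>i. emeasure lborel (B i) \<noteq> \<infinity>" "disjoint_family B"
    by (rule lborel.sigma_finite_disjoint) blast
  define C where "C = (\<lambda>i. A \<inter> B i)"
  have C: "C i \<in> sets borel" for i using A B(1) by (auto simp: C_def)
  have Cfin: "emeasure lborel (C i) < \<infinity>" for i
  proof -
    have "emeasure lborel (C i) \<le> emeasure lborel (B i)" using B(1) by (intro emeasure_mono) (auto simp: C_def)
    also have "\<dots> < \<infinity>" using B(3)[of i] by (simp add: top.not_eq_extremum)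
    finally show ?thesis .
  qed
  have d: "disjoint_family C" using B(4) by (auto simp: disjoint_family_on_def C_def)
  have AC: "A = (\<Union>i. C i)" using B(2) by (auto simp: C_def)
  let ?u = "\<lambda>i \<omega>. of_nat (card (\<Phi> \<omega> \<inter> C i \<times> UNIV)) - pv.npairs (pairs (C i)) \<omega> * indicator pv.reg \<omega> :: ennreal"
  have um: "?u i \<in> borel_measurable M" for i
  proof -
    have "(\<lambda>\<omega>. of_nat (card (\<Phi> \<omega> \<inter> C i \<times> UNIV)) :: ennreal) \<in> borel_measurable M"
      by (rule measurable_compose[OF total_count(1)[OF C Cfin]]) simp
    then show ?thesis using npairs_measurable[OF C] by (rule borel_measurable_minus_ennreal)
  qed
  have ae: "AE \<omega> in M. \<forall>i. emeasure (count_space UNIV) {a \<in> Phi1 (\<Phi> \<omega>) D. fst a \<in> C i} = ?u i \<omega>"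
    unfolding AE_all_countable
  proof
    fix i
    show "AE \<omega> in M. emeasure (count_space UNIV) {a \<in> Phi1 (\<Phi> \<omega>) D. fst a \<in> C i} = ?u i \<omega>"
      using AE_Phi1[OF C Cfin, of i] by eventually_elim simp
  qed
  have "mean_meas M (\<lambda>\<omega>. Phi1 (\<Phi> \<omega>) D) A = (\<integral>\<^sup>+\<omega>. (\<Sum>i. ?u i \<omega>) \<partial>M)"
    unfolding mean_meas_def
  proof (rule nn_integral_cong_AE, use ae in eventually_elim)
    case (elim \<omega>)
    have "{a \<in> Phi1 (\<Phi> \<omega>) D. fst a \<in> A} = (\<Union>i. {a \<in> Phi1 (\<Phi> \<omega>) D. fst a \<in> C i})" using AC by auto
    also have "emeasure (count_space UNIV) \<dots> = (\<Sum>i. emeasure (count_space UNIV) {a \<in> Phi1 (\<Phi> \<omega>) D. fst a \<in> C i})"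
      using d by (intro suminf_emeasure[symmetric]) (auto simp: disjoint_family_on_def)
    finally show ?case using elim by simp
  qed
  also have "\<dots> = (\<Sum>i. \<integral>\<^sup>+\<omega>. ?u i \<omega> \<partial>M)" by (rule nn_integral_suminf[OF um])
  also have "\<dots> = (\<Sum>i. mean_meas M (\<lambda>\<omega>. Phi1 (\<Phi> \<omega>) D) (C i))"
    unfolding mean_meas_def
    by (intro suminf_cong nn_integral_cong_AE) (use ae in eventually_elim, simp)
  also have "\<dots> = (\<Sum>i. (1 - P_D D lam f) * ennreal lam * emeasure lborel (C i))"
    by (intro suminf_cong mean_Phi1_finite C Cfin)
  also have "\<dots> = (1 - P_D D lam f) * ennreal lam * (\<Sum>i. emeasure lborel (C i))" by simp
  also have "(\<Sum>i. emeasure lborel (C i)) = emeasure lborel A"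
    unfolding AC using C d by (intro suminf_emeasure) auto
  finally show ?thesis .
qed

end

theorem theorem3:
  fixes M :: "'w measure" and \<Phi> :: "'w \<Rightarrow> pt set"
    and lam :: real and f :: "real \<Rightarrow> real" and D :: "(real \<times> real) set"
  assumes lam_pos: "lam > 0"
    and f_meas: "f \<in> borel_measurable borel"
    and f_nonneg: "\<And>z. z > 0 \<Longrightarrow> f z \<ge> 0"
    and f_prob: "(\<integral>\<^sup>+ z. ennreal (f z * indicator {0<..} z) \<partial>lborel) = 1"
    and D_borel: "D \<in> sets (borel :: (real \<times> real) measure)"
    and D_sub: "D \<subseteq> {0<..} \<times> {0<..}"
    and D_sym: "\<And>z z'. (z, z') \<in> D \<Longrightarrow> (z', z) \<in> D"
    and PPP: "poisson_pp M \<Phi> (intensity lam f)"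
  shows "P_D D lam f \<le> 1 \<and>
    (\<forall>A \<in> sets (borel :: (real \<times> real) measure).
       mean_meas M (\<lambda>\<omega>. Phi2 (\<Phi> \<omega>) D) A = P_D D lam f * ennreal lam * emeasure lborel A \<and>
       mean_meas M (\<lambda>\<omega>. Phi1 (\<Phi> \<omega>) D) A = (1 - P_D D lam f) * ennreal lam * emeasure lborel A)"
proof -
  interpret marked_poisson f M \<Phi> lam D
    by unfold_locales (rule f_meas f_nonneg f_prob lam_pos D_borel D_sub PPP | assumption)+
  show ?thesis
    using P_D_le_1 mean_Phi2 mean_Phi1 by blast
qed

end
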